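(* Let $n\in\mathbb{N}$, $0<c_0\le2^{-24}$, let $d\le c_0^2n$ be a positive integer, let $\alpha\in(0,1)$, let $0\le k\le2^{-10}\alpha d$ be an integer and let $N\le\exp(2^{-10}\alpha d)$. Let $X\in\mathbb{R}^d$ satisfy $\|X\|_2\ge c_02^{-10}n^{1/2}N$, and let $H$ be a random $(n-d)\times2d$ matrix with i.i.d. entries in $\{-1,0,1\}$, each equal to $\pm1$ with probability $1/8$ each and $0$ with probability $3/4$. Set $H_1:=H_{[n-d]\times[d]}$, $H_2:=H_{[n-d]\times[d+1,2d]}$, $r_n:=\frac{c_0}{16\sqrt n}$ and $R:=2^{39}c_0^{-3}$. If $D_\alpha(r_nX)>16$, then \[\mathbb{P}_H\Big(\sigma_{2d-k+1}(H)\le c_02^{-4}\sqrt n\ \text{ and }\ \|H_1X\|_2\le n,\ \|H_2X\|_2\le n\Big)\le e^{-c_0nk/4}\Big(\frac RN\Big)^{2n-2d}.\]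
   Context: For a matrix $H$, $\sigma_1(H)\ge\sigma_2(H)\ge\cdots$ denote its singular values, with the convention $\sigma_j(H)=0$ for $j>\mathrm{rk}(H)$. $H_{S\times T}$ denotes the submatrix with rows in $S$ and columns in $T$; $[a,b]=\{a,\dots,b\}$ and $[m]=\{1,\dots,m\}$. For $x\in\mathbb{R}^d$, $\|x\|_{\mathbb{T}}$ is the Euclidean distance from $x$ to $\mathbb{Z}^d$, and for $v\in\mathbb{R}^d$ and $\alpha\in(0,1)$, $D_\alpha(v):=\inf\{\phi>0:\|\phi v\|_{\mathbb{T}}\le\min\{\phi\|v\|_2/2,\sqrt{\alpha d}\}\}$. *)

theory Defs
  imports "HOL-Analysis.Analysis" "HOL-Probability.Product_PMF"
    "Jordan_Normal_Form.Char_Poly"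
begin

definition singular_values :: "real mat \<Rightarrow> real list" where
  "singular_values A =
     rev (sorted_list_of_multiset (image_mset sqrt (proots (char_poly (transpose_mat A * A)))))"

(* sigma_j(A), 1-based; 0 for indices beyond the list (in particular beyond the rank) *)
definition sing_val :: "real mat \<Rightarrow> nat \<Rightarrow> real" where
  "sing_val A j = (if 1 \<le> j \<and> j \<le> length (singular_values A)
                   then singular_values A ! (j - 1) else 0)"

definition mat_of_fun :: "nat \<Rightarrow> nat \<Rightarrow> (nat \<times> nat \<Rightarrow> real) \<Rightarrow> real mat" where
  "mat_of_fun m p H = mat m p H"

definition vnorm :: "nat \<Rightarrow> (nat \<Rightarrow> real) \<Rightarrow> real" where
  "vnorm d x = sqrt (\<Sum>i<d. (x i)\<^sup>2)"

definition torus_norm :: "nat \<Rightarrow> (nat \<Rightarrow> real) \<Rightarrow> real" where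
  "torus_norm d x = Inf {vnorm d (\<lambda>i. x i - of_int (z i)) | z :: nat \<Rightarrow> int. True}"

(* D_alpha(v) (infimum of the empty set is +infinity) *)
definition D_alpha :: "nat \<Rightarrow> real \<Rightarrow> (nat \<Rightarrow> real) \<Rightarrow> ereal" where
  "D_alpha d \<alpha> v = Inf (ereal ` {\<phi>. \<phi> > 0 \<and>
       torus_norm d (\<lambda>i. \<phi> * v i) \<le> min (\<phi> * vnorm d v / 2) (sqrt (\<alpha> * real d))})"

definition entry_pmf :: "real pmf" where
  "entry_pmf = do { b \<leftarrow> bernoulli_pmf (1/4); s \<leftarrow> bernoulli_pmf (1/2);
                    return_pmf (if b then (if s then 1 else -1) else 0) }"

definition rand_mat :: "nat \<Rightarrow> nat \<Rightarrow> (nat \<times> nat \<Rightarrow> real) pmf" where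
  "rand_mat m p = Pi_pmf ({..<m} \<times> {..<p}) 0 (\<lambda>_. entry_pmf)"

end

theory Submission
  imports Defs
begin

text \<open>
  If \<open>H\<close> has \<open>k\<close> small singular values, then \<open>H U\<close> is small for some \<open>2d \<times> k\<close> matrix \<open>U\<close> with
  orthonormal columns, and a random rounding of \<open>U\<close> to a lattice of mesh about \<open>1 / sqrt d\<close> produces
  a matrix \<open>W\<close> from a net of size \<open>exp (O (d k))\<close> with \<open>H W\<close> small. For fixed \<open>W\<close> the indicator of
  the event is dominated by a product over the rows \<open>\<tau>\<close> of \<open>H\<close> of a positive definite function of
  \<open>(W\<^sup>T \<tau>, \<langle>\<tau>\<^sub>1, X\<rangle>, \<langle>\<tau>\<^sub>2, X\<rangle>)\<close>. Its expectation is an average of \<open>J(u)\<close> over a two-dimensional grid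
  of \<open>u\<close>, where \<open>J(u)\<close> averages the characteristic function of \<open>\<tau>\<close> over the directions of \<open>W\<close>.

  Products of characteristic functions satisfy \<open>J(u) J(u') \<le> J'(u - u')\<close>, where \<open>J'\<close> is of the same
  kind. Hence \<open>J \<le> M\<^sup>1\<^sup>-\<^sup>2\<^sup>\<eta> J'(u - u\<^sup>*)\<^sup>\<eta>\<close> with \<open>M = J(u\<^sup>*)\<close> the maximum over the grid: \<open>M\<^sup>2 \<le> J'(0)\<close>
  is a small ball probability of order \<open>exp (- c k)\<close>, while \<open>D\<^sub>\<alpha> > 16\<close> makes \<open>J'\<close> decay away from \<open>0\<close>
  and contributes \<open>1 / N\<^sup>2\<close>, up to a loss \<open>exp (C \<eta> k)\<close> that is harmless for small \<open>\<eta>\<close>. All auxiliary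
  distributions have finite support, so that every expectation is a finite sum.
\<close>

section \<open>Finite product expectations\<close>

text \<open>The two gains cannot simply be multiplied. The decay estimate for J' passes through a
  random shift by the columns of W, and the exponential moment of this shift is as large as exp (8
  a^2 k), where \<open>a\<close> is the scale of W; the small ball gain is only about exp (- 3/32
  a^2 k) after the square root. Both exponents are proportional to a^2, so a smaller
  \<open>a\<close> does not help and only \<eta> changes the balance. It is squeezed from two sides:
  16 \<eta> has to stay below 3/32, and 3/8 \<eta> has to be at least 2 powr (-10), so that exp (-
  3/8 \<eta> \<alpha> d) is at most 1/N. The value 1/256 meets both.

  Gaussian weights are imitated with finite support: each column of W is split into L copies divided
  by sqrt L. For sign vectors \<tau> the arguments of the characteristic functions then stay in
  [-1/2, 1/2], where periodicity is invisible and the decay is Gaussian.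

  The exponential moment is truncated at a level D, because errors of a rounding are sub-Gaussian
  only with a bounded parameter; for longer shifts the truncation takes over.\<close>

definition law :: "'i set \<Rightarrow> ('i \<Rightarrow> 'b set) \<Rightarrow> ('i \<Rightarrow> 'b \<Rightarrow> real) \<Rightarrow> bool" where
  "law I S q \<longleftrightarrow> finite I \<and>
     (\<forall>i\<in>I. finite (S i) \<and> (\<forall>y\<in>S i. 0 \<le> q i y) \<and> (\<Sum>y\<in>S i. q i y) = 1)"

text \<open>Values lie in a real vector space so that one operator serves real functions and complex
  characters.\<close>

definition expect ::
  "'i set \<Rightarrow> ('i \<Rightarrow> 'b set) \<Rightarrow> ('i \<Rightarrow> 'b \<Rightarrow> real) \<Rightarrow> (('i \<Rightarrow> 'b) \<Rightarrow> 'v::real_vector) \<Rightarrow> 'v" where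
  "expect I S q f = (\<Sum>x\<in>PiE I S. (\<Prod>i\<in>I. q i (x i)) *\<^sub>R f x)"

lemma law_finite: "law I S q \<Longrightarrow> finite I"
  and law_finite_S: "law I S q \<Longrightarrow> i \<in> I \<Longrightarrow> finite (S i)"
  and law_nonneg: "law I S q \<Longrightarrow> i \<in> I \<Longrightarrow> y \<in> S i \<Longrightarrow> 0 \<le> q i y"
  and law_sum: "law I S q \<Longrightarrow> i \<in> I \<Longrightarrow> (\<Sum>y\<in>S i. q i y) = 1"
  by (auto simp: law_def)

lemma law_subset: "law I S q \<Longrightarrow> J \<subseteq> I \<Longrightarrow> law J S q"
  unfolding law_def by (meson finite_subset subsetD)

lemma law_finite_PiE: "law I S q \<Longrightarrow> finite (PiE I S)"
  by (auto simp: law_def intro: finite_PiE)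

lemma law_weight_nonneg: "law I S q \<Longrightarrow> x \<in> PiE I S \<Longrightarrow> 0 \<le> (\<Prod>i\<in>I. q i (x i))"
  by (intro prod_nonneg) (auto intro: law_nonneg)

lemma expect_add: "expect I S q (\<lambda>x. f x + g x) = expect I S q f + expect I S q g"
  by (simp add: expect_def scaleR_right_distrib sum.distrib)

lemma expect_sum: "expect I S q (\<lambda>x. \<Sum>k\<in>K. f k x) = (\<Sum>k\<in>K. expect I S q (f k))"
  unfolding expect_def by (simp add: scaleR_sum_right) (rule sum.swap)

lemma expect_mult_left:
  fixes c :: "'v::real_algebra"
  shows "expect I S q (\<lambda>x. c * f x) = c * expect I S q f"
  unfolding expect_def by (simp add: sum_distrib_left)

lemma expect_mult_right:
  fixes c :: "'v::real_algebra"
  shows "expect I S q (\<lambda>x. f x * c) = expect I S q f * c"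
  unfolding expect_def by (simp add: sum_distrib_right)

lemma expect_divide: "expect I S q (\<lambda>x. f x / (c::real)) = expect I S q f / c"
  using expect_mult_right[of I S q f "inverse c"] by (simp add: divide_inverse)

lemma expect_of_real:
  "expect I S q (\<lambda>x. of_real (f x) :: 'v::real_algebra_1) = of_real (expect I S q f)"
  unfolding expect_def by (simp add: scaleR_conv_of_real)

lemma expect_mono:
  fixes f g :: "_ \<Rightarrow> real"
  assumes "law I S q" "\<And>x. x \<in> PiE I S \<Longrightarrow> f x \<le> g x"
  shows "expect I S q f \<le> expect I S q g"
  unfolding expect_def by (intro sum_mono) (simp add: mult_left_mono assms(2) law_weight_nonneg[OF assms(1)])

lemma expect_prod:
  fixes f :: "'i \<Rightarrow> 'b \<Rightarrow> 'v::real_normed_field"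
  assumes "law I S q"
  shows "expect I S q (\<lambda>x. \<Prod>i\<in>I. f i (x i)) = (\<Prod>i\<in>I. \<Sum>y\<in>S i. q i y *\<^sub>R f i y)"
proof -
  have "(\<Prod>i\<in>I. \<Sum>y\<in>S i. q i y *\<^sub>R f i y) = (\<Sum>x\<in>PiE I S. \<Prod>i\<in>I. q i (x i) *\<^sub>R f i (x i))"
    by (rule prod_sum_PiE) (use assms in \<open>auto simp: law_def\<close>)
  also have "\<dots> = expect I S q (\<lambda>x. \<Prod>i\<in>I. f i (x i))"
    unfolding expect_def by (intro sum.cong) (auto simp: scaleR_conv_of_real prod.distrib)
  finally show ?thesis by simp
qed

lemma expect_one: "law I S q \<Longrightarrow> expect I S q (\<lambda>_. 1::real) = 1"
  using expect_prod[of I S q "\<lambda>_ _. 1::real"] by (simp add: law_sum)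

lemma expect_const: "law I S q \<Longrightarrow> expect I S q (\<lambda>_. c::real) = c"
  using expect_mult_left[of I S q c "\<lambda>_. 1"] by (simp add: expect_one)

lemma expect_nonneg:
  assumes "law I S q" "\<And>x. x \<in> PiE I S \<Longrightarrow> (0::real) \<le> f x"
  shows "0 \<le> expect I S q f"
  using expect_mono[OF assms(1), of "\<lambda>_. 0" f] assms by (simp add: expect_const)

lemma expect_le:
  assumes "law I S q" "\<And>x. x \<in> PiE I S \<Longrightarrow> f x \<le> (c::real)"
  shows "expect I S q f \<le> c"
  using expect_mono[OF assms(1), of f "\<lambda>_. c"] assms by (simp add: expect_const)

lemma expect_exists:
  fixes f :: "_ \<Rightarrow> real"
  assumes "law I S q"
  shows "\<exists>x\<in>PiE I S. f x \<le> expect I S q f"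
proof (rule ccontr)
  assume "\<not> ?thesis"
  then have less: "\<And>x. x \<in> PiE I S \<Longrightarrow> expect I S q f < f x" by auto
  have fin: "finite (PiE I S)" using assms by (rule law_finite_PiE)
  have "S i \<noteq> {}" if "i \<in> I" for i using law_sum[OF assms that] by auto
  then have ne: "PiE I S \<noteq> {}" by (auto simp: PiE_eq_empty_iff)
  define c where "c = Min (f ` PiE I S)"
  have c: "expect I S q f < c" unfolding c_def using less fin ne by (subst Min_gr_iff) auto
  have "expect I S q (\<lambda>_. c) \<le> expect I S q f" by (rule expect_mono[OF assms]) (auto simp: c_def fin)
  then show False using c assms by (simp add: expect_const)
qed

lemma expect_swap:
  "expect I S q (\<lambda>x. expect J S' q' (\<lambda>y. f x y)) = expect J S' q' (\<lambda>y. expect I S q (\<lambda>x. f x y))"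
  unfolding expect_def scaleR_sum_right by (subst sum.swap) (simp add: mult.commute)

lemma expect_Un:
  assumes "A \<inter> B = {}" "law (A \<union> B) S q"
  shows "expect (A \<union> B) S q f =
    expect A S q (\<lambda>x. expect B S q (\<lambda>y. f (\<lambda>i. if i \<in> A then x i else y i)))"
proof -
  let ?m = "\<lambda>(x, y). \<lambda>i. if i \<in> A then x i else y i"
  have fin: "finite A" "finite B" using assms by (auto simp: law_def)
  have bij: "bij_betw ?m (PiE A S \<times> PiE B S) (PiE (A \<union> B) S)"
  proof (rule bij_betwI[where g = "\<lambda>x. (restrict x A, restrict x B)"], goal_cases)
    case 1 then show ?case by (auto simp: PiE_iff extensional_def)
  next
    case 2 then show ?case by (auto simp: PiE_iff extensional_def)
  next
    case (3 z)
    obtain x y where z: "z = (x, y)" by (cases z)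
    have "restrict (?m z) A = x" using 3 z by (auto simp: PiE_iff extensional_def fun_eq_iff)
    moreover have "restrict (?m z) B = y" using 3 z assms(1) by (auto simp: PiE_iff extensional_def fun_eq_iff)
    ultimately show ?case unfolding z by simp
  next
    case (4 x) then show ?case by (auto simp: restrict_def PiE_iff extensional_def fun_eq_iff)
  qed
  have w: "(\<Prod>i\<in>A \<union> B. q i (if i \<in> A then x i else y i)) = (\<Prod>i\<in>A. q i (x i)) * (\<Prod>i\<in>B. q i (y i))" for x y
  proof -
    have "(\<Prod>i\<in>B. q i (if i \<in> A then x i else y i)) = (\<Prod>i\<in>B. q i (y i))"
      by (rule prod.cong) (use assms(1) in auto)
    then show ?thesis using fin assms(1) by (simp add: prod.union_disjoint)
  qed
  have "expect (A \<union> B) S q f = (\<Sum>z\<in>PiE A S \<times> PiE B S. (\<Prod>i\<in>A \<union> B. q i (?m z i)) *\<^sub>R f (?m z))"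
    unfolding expect_def by (rule sum.reindex_bij_betw[OF bij, symmetric])
  also have "\<dots> = (\<Sum>x\<in>PiE A S. \<Sum>y\<in>PiE B S.
      ((\<Prod>i\<in>A. q i (x i)) * (\<Prod>i\<in>B. q i (y i))) *\<^sub>R f (\<lambda>i. if i \<in> A then x i else y i))"
    unfolding sum.cartesian_product by (intro sum.cong refl) (auto simp: w)
  finally show ?thesis unfolding expect_def scaleR_sum_right by simp
qed

text \<open>A point composed with \<open>\<sigma>\<close> need not be \<open>undefined\<close>
  outside I, so it agrees with an element of the target product only on I; \<open>dep\<close> makes
  f blind to the difference.\<close>

lemma expect_reindex:
  assumes inj: "inj_on \<sigma> I"
    and dep: "\<And>x y. (\<And>i. i \<in> I \<Longrightarrow> x i = y i) \<Longrightarrow> f x = f y"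
  shows "expect (\<sigma> ` I) S q (\<lambda>x. f (\<lambda>i. x (\<sigma> i))) = expect I (\<lambda>i. S (\<sigma> i)) (\<lambda>i. q (\<sigma> i)) f"
proof -
  let ?r = "\<lambda>x. \<lambda>i\<in>I. x (\<sigma> i)"
  let ?g = "\<lambda>x. \<lambda>i\<in>\<sigma> ` I. x (the_inv_into I \<sigma> i)"
  have bij: "bij_betw ?r (PiE (\<sigma> ` I) S) (PiE I (\<lambda>i. S (\<sigma> i)))"
  proof (rule bij_betwI[where g = ?g], goal_cases)
    case 1 then show ?case by auto
  next
    case 2 then show ?case by (auto simp: the_inv_into_f_f[OF inj])
  next
    case (3 x) 
    then show ?case by (auto simp: restrict_def fun_eq_iff the_inv_into_f_f[OF inj] PiE_iff extensional_def)
  next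
    case (4 x) then show ?case
      by (auto simp: restrict_def fun_eq_iff the_inv_into_f_f[OF inj] PiE_iff extensional_def)
  qed
  have "expect I (\<lambda>i. S (\<sigma> i)) (\<lambda>i. q (\<sigma> i)) f =
      (\<Sum>x\<in>PiE (\<sigma> ` I) S. (\<Prod>i\<in>I. q (\<sigma> i) (?r x i)) *\<^sub>R f (?r x))"
    unfolding expect_def by (rule sum.reindex_bij_betw[OF bij, symmetric])
  also have "\<dots> = expect (\<sigma> ` I) S q (\<lambda>x. f (\<lambda>i. x (\<sigma> i)))" unfolding expect_def
  proof (intro sum.cong refl arg_cong2[where f = scaleR], goal_cases)
    case (1 x)
    show ?case by (simp add: prod.reindex[OF inj])
  next
    case (2 x)
    show ?case by (rule dep) simp
  qed
  finally show ?thesis by simp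
qed

text \<open>Independence of the rows of a random array, obtained by peeling off one row at a time.
  It serves the rows of H, the rows of a rounding, and the groups of L copies of a column.\<close>

lemma expect_rows:
  fixes f :: "'a \<Rightarrow> ('b \<Rightarrow> 'c) \<Rightarrow> real"
  assumes "law (A \<times> B) S q" "finite B"
    and "finite A"
    and dep: "\<And>a x y. (\<And>b. b \<in> B \<Longrightarrow> x b = y b) \<Longrightarrow> f a x = f a y"
  shows "expect (A \<times> B) S q (\<lambda>x. \<Prod>a\<in>A. f a (\<lambda>b. x (a, b))) =
    (\<Prod>a\<in>A. expect B (\<lambda>b. S (a, b)) (\<lambda>b. q (a, b)) (f a))" using \<open>finite A\<close> assms(1)
proof (induction A rule: finite_induct)
  case empty
  then show ?case by (simp add: expect_def)
next
  case (insert a A)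
  have eq: "insert a A \<times> B = (Pair a ` B) \<union> (A \<times> B)" by auto
  have disj: "(Pair a ` B) \<inter> (A \<times> B) = {}" using insert by auto
  have row: "(\<Prod>a'\<in>insert a A. f a' (\<lambda>b. if (a', b) \<in> Pair a ` B then x (a', b) else y (a', b)))
      = f a (\<lambda>b. x (a, b)) * (\<Prod>a'\<in>A. f a' (\<lambda>b. y (a', b)))" for x y :: "'a \<times> 'b \<Rightarrow> 'c"
  proof -
    have "f a (\<lambda>b. if (a, b) \<in> Pair a ` B then x (a, b) else y (a, b)) = f a (\<lambda>b. x (a, b))" by (rule dep) auto
    moreover have "(\<Prod>a'\<in>A. f a' (\<lambda>b. if (a', b) \<in> Pair a ` B then x (a', b) else y (a', b))) =
        (\<Prod>a'\<in>A. f a' (\<lambda>b. y (a', b)))" by (rule prod.cong) (use insert in \<open>auto intro!: dep\<close>)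
    ultimately show ?thesis using insert by simp
  qed
  have "expect (insert a A \<times> B) S q (\<lambda>x. \<Prod>a'\<in>insert a A. f a' (\<lambda>b. x (a', b))) =
      expect (Pair a ` B) S q (\<lambda>x. expect (A \<times> B) S q (\<lambda>y.
        f a (\<lambda>b. x (a, b)) * (\<Prod>a'\<in>A. f a' (\<lambda>b. y (a', b)))))"
    using insert.prems unfolding eq by (subst expect_Un[OF disj]) (simp_all add: row eq[symmetric])
  also have "\<dots> = expect (Pair a ` B) S q (\<lambda>x. f a (\<lambda>b. x (a, b))) *
      expect (A \<times> B) S q (\<lambda>y. \<Prod>a'\<in>A. f a' (\<lambda>b. y (a', b)))" by (simp add: expect_mult_left expect_mult_right)
  also have "expect (Pair a ` B) S q (\<lambda>x. f a (\<lambda>b. x (a, b))) =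
      expect B (\<lambda>b. S (a, b)) (\<lambda>b. q (a, b)) (f a)" by (rule expect_reindex) (auto simp: inj_on_def intro: dep)
  also have "expect (A \<times> B) S q (\<lambda>y. \<Prod>a'\<in>A. f a' (\<lambda>b. y (a', b))) =
      (\<Prod>a\<in>A. expect B (\<lambda>b. S (a, b)) (\<lambda>b. q (a, b)) (f a))"
    by (rule insert.IH, rule law_subset[OF insert.prems]) auto
  finally show ?case using insert by simp
qed

lemma expect_columns:
  fixes f :: "'b \<Rightarrow> ('a \<Rightarrow> 'c) \<Rightarrow> real"
  assumes l: "law (A \<times> B) S q" and fin: "finite A" "finite B"
    and dep: "\<And>b x y. (\<And>a. a \<in> A \<Longrightarrow> x a = y a) \<Longrightarrow> f b x = f b y"
  shows "expect (A \<times> B) S q (\<lambda>x. \<Prod>b\<in>B. f b (\<lambda>a. x (a, b))) =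
    (\<Prod>b\<in>B. expect A (\<lambda>a. S (a, b)) (\<lambda>a. q (a, b)) (f b))"
proof -
  have im: "prod.swap ` (B \<times> A) = A \<times> B" by auto
  have "expect (A \<times> B) S q (\<lambda>x. \<Prod>b\<in>B. f b (\<lambda>a. x (a, b))) =
     expect (prod.swap ` (B \<times> A)) S q (\<lambda>x. (\<lambda>z. \<Prod>b\<in>B. f b (\<lambda>a. z (b, a))) (\<lambda>i. x (prod.swap i)))"
    unfolding im by simp
  also have "\<dots> = expect (B \<times> A) (\<lambda>i. S (prod.swap i)) (\<lambda>i. q (prod.swap i)) (\<lambda>z. \<Prod>b\<in>B. f b (\<lambda>a. z (b, a)))"
  proof (rule expect_reindex)
    fix x y :: "'b \<times> 'a \<Rightarrow> 'c"
    assume "\<And>i. i \<in> B \<times> A \<Longrightarrow> x i = y i"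
    then show "(\<Prod>b\<in>B. f b (\<lambda>a. x (b, a))) = (\<Prod>b\<in>B. f b (\<lambda>a. y (b, a)))" by (intro prod.cong refl dep) simp
  qed simp
  also have "\<dots> = (\<Prod>b\<in>B. expect A (\<lambda>a. S (prod.swap (b, a))) (\<lambda>a. q (prod.swap (b, a))) (f b))"
  proof (rule expect_rows)
    show "law (B \<times> A) (\<lambda>i. S (prod.swap i)) (\<lambda>i. q (prod.swap i))" using l fin unfolding law_def by force
  qed (use fin dep in blast)+
  also have "\<dots> = (\<Prod>b\<in>B. expect A (\<lambda>a. S (a, b)) (\<lambda>a. q (a, b)) (f b))" by simp
  finally show ?thesis .
qed

lemma law_rows: "law (A \<times> B) S q \<Longrightarrow> a \<in> A \<Longrightarrow> finite B \<Longrightarrow> law B (\<lambda>b. S (a, b)) (\<lambda>b. q (a, b))"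
  and law_columns: "law (A \<times> B) S q \<Longrightarrow> b \<in> B \<Longrightarrow> finite A \<Longrightarrow> law A (\<lambda>a. S (a, b)) (\<lambda>a. q (a, b))"
  by (auto simp: law_def)

section \<open>Lazy random signs\<close>

text \<open>By concavity the sine lies above its chord over [0, pi/2]; 2 x is the relative position
  of pi x in this interval.\<close>

lemma sin_ge_chord:
  assumes "0 \<le> x" "x \<le> 1/2"
  shows "2 * x \<le> sin (pi * x)"
proof -
  have "convex_on {0..pi/2} (\<lambda>x. - sin x)"
  proof (rule f''_ge0_imp_convex[where f' = "\<lambda>x. - cos x" and f'' = sin])
    show "0 \<le> sin x" if "x \<in> {0..pi/2}" for x using that by (intro sin_ge_zero) auto
  qed (auto intro!: derivative_eq_intros)
  from convex_onD_Icc[OF this, of "2 * x"] assms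
  show ?thesis by (simp add: field_simps)
qed

lemma sin_sq_ge:
  assumes "\<bar>x\<bar> \<le> 1/2"
  shows "4 * x\<^sup>2 \<le> (sin (pi * x))\<^sup>2"
proof -
  have "(2 * \<bar>x\<bar>)\<^sup>2 \<le> (sin (pi * \<bar>x\<bar>))\<^sup>2" by (rule power_mono[OF sin_ge_chord]) (use assms in auto)
  also have "sin (pi * \<bar>x\<bar>) = (if x < 0 then - sin (pi * x) else sin (pi * x))" by simp
  finally show ?thesis by (simp add: power_mult_distrib split: if_splits)
qed

text \<open>\<beta> is the probability of a nonzero value. The entries of H have \<beta> = 1/4; the
  value 3/32 enters through \<open>lchar_mult_le\<close>.\<close>

definition lazy :: "real \<Rightarrow> real \<Rightarrow> real" where
  "lazy \<beta> y = (if y = 0 then 1 - \<beta> else \<beta> / 2)"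

abbreviation lexpect :: "real \<Rightarrow> 'i set \<Rightarrow> (('i \<Rightarrow> real) \<Rightarrow> 'v) \<Rightarrow> 'v::real_vector" where
  "lexpect \<beta> I \<equiv> expect I (\<lambda>_. {-1, 0, 1}) (\<lambda>_. lazy \<beta>)"

definition lchar :: "real \<Rightarrow> real \<Rightarrow> real" where
  "lchar \<beta> t = 1 - 2 * \<beta> * (sin (pi * t))\<^sup>2"

lemma law_lazy: "finite I \<Longrightarrow> 0 \<le> \<beta> \<Longrightarrow> \<beta> \<le> 1 \<Longrightarrow> law I (\<lambda>_. {-1, 0, 1}) (\<lambda>_. lazy \<beta>)"
  by (auto simp: law_def lazy_def)

lemma lchar_cos: "lchar \<beta> t = 1 - \<beta> + \<beta> * cos (2 * pi * t)"
proof -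
  have "cos (2 * pi * t) = 1 - 2 * (sin (pi * t))\<^sup>2" using cos_double_sin[of "pi * t"] by (simp add: mult.assoc)
  then show ?thesis unfolding lchar_def by (simp only:) (simp add: algebra_simps)
qed

lemma lchar_zero [simp]: "lchar \<beta> 0 = 1"
  and lchar_minus [simp]: "lchar \<beta> (- t) = lchar \<beta> t"
  by (simp_all add: lchar_def)

lemma lazy_cis: "(\<Sum>y\<in>{-1, 0, 1}. lazy \<beta> y *\<^sub>R cis (2 * pi * (y * t))) = of_real (lchar \<beta> t)"
  by (simp add: lazy_def lchar_cos complex_eq_iff)

lemma cis_sum: "cis (\<Sum>i\<in>I. f i) = (\<Prod>i\<in>I. cis (f i))"
  by (induction I rule: infinite_finite_induct) (simp_all flip: cis_mult)

lemma lazy_charfun: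
  assumes "finite I" "0 \<le> \<beta>" "\<beta> \<le> 1"
  shows "lexpect \<beta> I (\<lambda>x. cis (2 * pi * (\<Sum>i\<in>I. x i * t i))) = of_real (\<Prod>i\<in>I. lchar \<beta> (t i))"
proof -
  have cis: "cis (2 * pi * (\<Sum>i\<in>I. x i * t i)) = (\<Prod>i\<in>I. cis (2 * pi * (x i * t i)))" for x
    by (simp only: sum_distrib_left cis_sum)
  show ?thesis
    unfolding cis expect_prod[OF law_lazy[OF assms], where f = "\<lambda>i y. cis (2 * pi * (y * t i))"] lazy_cis
    by simp
qed

lemma lchar_le_1: "0 \<le> \<beta> \<Longrightarrow> lchar \<beta> t \<le> 1"
  by (simp add: lchar_def)

lemma lchar_nonneg: "0 \<le> \<beta> \<Longrightarrow> \<beta> \<le> 1/2 \<Longrightarrow> 0 \<le> lchar \<beta> t"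
proof -
  assume "0 \<le> \<beta>" "\<beta> \<le> 1/2"
  then have "2 * \<beta> * (sin (pi * t))\<^sup>2 \<le> 1 * 1" by (intro mult_mono) (auto simp: abs_square_le_1)
  then show ?thesis by (simp add: lchar_def)
qed

lemma lchar_pos: "0 \<le> \<beta> \<Longrightarrow> \<beta> < 1/2 \<Longrightarrow> 0 < lchar \<beta> t"
proof -
  assume \<beta>: "0 \<le> \<beta>" "\<beta> < 1/2"
  then have "2 * \<beta> * (sin (pi * t))\<^sup>2 \<le> 2 * \<beta> * 1" by (intro mult_left_mono) (auto simp: abs_square_le_1)
  then show ?thesis using \<beta> by (simp add: lchar_def)
qed

text \<open>The sine is subadditive in absolute value, so sin^2 at the difference is at most 2 a + 2
  b. On the left, a b \<le> (a + b) / 2 leaves a decay of 3/8 (a + b), hence at least 3/16 = 2 *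
  3/32 times that sin^2. The bound is again the characteristic function of a lazy sign, so the
  Fourier identities apply to it.\<close>

lemma lchar_mult_le: "lchar (1/4) s * lchar (1/4) t \<le> lchar (3/32) (s - t)"
proof -
  define a b where "a = (sin (pi * s))\<^sup>2" and "b = (sin (pi * t))\<^sup>2"
  have ab: "0 \<le> a" "a \<le> 1" "0 \<le> b" "b \<le> 1" by (auto simp: a_def b_def abs_square_le_1)
  have "sin (pi * (s - t)) = sin (pi * s) * cos (pi * t) - cos (pi * s) * sin (pi * t)"
    by (simp add: right_diff_distrib sin_diff)
  then have "\<bar>sin (pi * (s - t))\<bar> \<le> \<bar>sin (pi * s)\<bar> * \<bar>cos (pi * t)\<bar> + \<bar>cos (pi * s)\<bar> * \<bar>sin (pi * t)\<bar>"
    using abs_triangle_ineq4[of "sin (pi * s) * cos (pi * t)" "cos (pi * s) * sin (pi * t)"]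
    by (simp add: abs_mult)
  also have "\<dots> \<le> \<bar>sin (pi * s)\<bar> * 1 + 1 * \<bar>sin (pi * t)\<bar>" by (intro add_mono mult_mono) auto
  finally have "(sin (pi * (s - t)))\<^sup>2 \<le> (\<bar>sin (pi * s)\<bar> + \<bar>sin (pi * t)\<bar>)\<^sup>2"
    using abs_le_square_iff by fastforce
  also have "\<dots> \<le> 2 * a + 2 * b" using sum_squares_bound[of "\<bar>sin (pi * s)\<bar>" "\<bar>sin (pi * t)\<bar>"]
    by (simp add: a_def b_def power2_sum)
  finally have sin: "(sin (pi * (s - t)))\<^sup>2 \<le> 2 * a + 2 * b" .
  have "a * b \<le> (a + b) / 2" using mult_left_mono[of b 1 a] mult_right_mono[of a 1 b] ab by simp
  moreover have "(1 - a / 2) * (1 - b / 2) = 1 - (a + b) / 2 + a * b / 4" by (simp add: field_simps)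
  ultimately have "(1 - a / 2) * (1 - b / 2) \<le> 1 - 3 / 8 * (a + b)" by linarith
  also have "q \<le> 2 * a + 2 * b \<Longrightarrow> 1 - 3 / 8 * (a + b) \<le> 1 - 3 / 16 * q" for q by simp
  from this[OF sin] have "1 - 3 / 8 * (a + b) \<le> 1 - 3 / 16 * (sin (pi * (s - t)))\<^sup>2" .
  finally show ?thesis by (simp add: lchar_def a_def b_def)
qed

lemma lchar_upper:
  assumes "0 \<le> \<beta>"
  shows "lchar \<beta> t \<le> exp (- 8 * \<beta> * (t - of_int (round t))\<^sup>2)"
proof -
  define r where "r = t - of_int (round t)"
  have r: "\<bar>r\<bar> \<le> 1/2" using of_int_round_abs_le[of t] unfolding r_def by (simp add: abs_minus_commute)
  have "2 * pi * r = 2 * pi * t - 2 * pi * of_int (round t)" by (simp add: r_def right_diff_distrib)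
  then have "cos (2 * pi * r) = cos (2 * pi * t)"
    by (simp only: cos_diff cos_int_2pin sin_int_2pin mult_1_right mult_zero_right add_0_right)
  \<comment> \<open>Periodicity is read off at \<beta> = 1, where \<open>lchar\<close> determines
    sin^2, and then transferred to all \<beta>.\<close>
  then have "lchar 1 t = lchar 1 r" by (simp only: lchar_cos)
  then have "(sin (pi * t))\<^sup>2 = (sin (pi * r))\<^sup>2" by (simp add: lchar_def)
  then have "lchar \<beta> t \<le> 1 + (- 8 * \<beta> * r\<^sup>2)"
    using mult_left_mono[OF sin_sq_ge[OF r], of "2 * \<beta>"] assms by (simp add: lchar_def)
  also have "\<dots> \<le> exp (- 8 * \<beta> * r\<^sup>2)" by (rule exp_ge_add_one_self)
  finally show ?thesis unfolding r_def .
qed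

lemma lchar_upper_small:
  assumes "0 \<le> \<beta>" "\<bar>t\<bar> \<le> 1/2"
  shows "lchar \<beta> t \<le> exp (- 8 * \<beta> * t\<^sup>2)"
proof -
  have "lchar \<beta> t \<le> 1 + (- 8 * \<beta> * t\<^sup>2)"
    using mult_left_mono[OF sin_sq_ge[OF assms(2)], of "2 * \<beta>"] assms by (simp add: lchar_def)
  also have "\<dots> \<le> exp (- 8 * \<beta> * t\<^sup>2)" by (rule exp_ge_add_one_self)
  finally show ?thesis .
qed

text \<open>A Gaussian minorant on the whole line is possible because at \<beta> = 1/4 the
  characteristic function never drops below 1/2. The constant 16 bounds pi^2.\<close>

lemma lchar_lower: "exp (- 16 * t\<^sup>2) \<le> lchar (1/4) t"
proof -
  define y where "y = (sin (pi * t))\<^sup>2"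
  have y: "0 \<le> y" "y \<le> 1" by (auto simp: y_def abs_square_le_1)
  have "\<bar>sin (pi * t)\<bar> \<le> \<bar>pi * t\<bar>" by (rule abs_sin_x_le_abs_x)
  then have "y \<le> (pi * t)\<^sup>2" unfolding y_def using abs_le_square_iff by blast
  also have "\<dots> \<le> 4\<^sup>2 * t\<^sup>2"
    unfolding power_mult_distrib by (intro mult_right_mono power_mono) (use pi_less_4 in auto)
  finally have "exp (- 16 * t\<^sup>2) \<le> exp (- y)" by simp
  also have "\<dots> \<le> 1 / (1 + y)" using exp_ge_add_one_self[of y] y by (simp add: exp_minus field_simps)
  also have "\<dots> \<le> 1 - y / 2" using y mult_left_mono[of y 1 y] by (simp add: field_simps power2_eq_square)
  finally show ?thesis by (simp add: lchar_def y_def)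
qed

section \<open>A Fejer-type kernel with geometric weights\<close>

definition fweight :: "nat \<Rightarrow> nat \<Rightarrow> real" where
  "fweight P s = (1 - 1 / P) ^ s / P"

text \<open>As a squared modulus it is nonnegative, and expanding it gives nonnegative coefficients
  at the frequencies (s - s') / P. These lie in (-1, 1), well inside the range on which the
  hypothesis on \<open>D_alpha\<close> gives information.\<close>

definition fejer :: "nat \<Rightarrow> real \<Rightarrow> real" where
  "fejer P y = (cmod (\<Sum>s<P. of_real (fweight P s) * cis (2 * pi * (real s / P * y))))\<^sup>2"

lemma fejer_expand:
  "of_real (fejer P y) = (\<Sum>s<P. \<Sum>s'<P. of_real (fweight P s * fweight P s') *
     cis (2 * pi * ((real s - real s') / P * y)))"
proof -
  have "of_real (fejer P y) = (\<Sum>s<P. of_real (fweight P s) * cis (2 * pi * (real s / P * y))) *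
      cnj (\<Sum>s<P. of_real (fweight P s) * cis (2 * pi * (real s / P * y)))"
    unfolding fejer_def by (rule complex_norm_square)
  also have "\<dots> = (\<Sum>s<P. \<Sum>s'<P. (of_real (fweight P s) * cis (2 * pi * (real s / P * y))) *
     (of_real (fweight P s') * cis (- (2 * pi * (real s' / P * y)))))" by (simp add: sum_product cis_cnj)
  also have "\<dots> = (\<Sum>s<P. \<Sum>s'<P. of_real (fweight P s * fweight P s') *
     cis (2 * pi * ((real s - real s') / P * y)))"
  proof (intro sum.cong refl)
    fix s s' :: nat
    have "cis (2 * pi * ((real s - real s') / P * y)) =
        cis (2 * pi * (real s / P * y)) * cis (- (2 * pi * (real s' / P * y)))"
      by (simp add: cis_mult diff_divide_distrib left_diff_distrib right_diff_distrib)
    then show "(of_real (fweight P s) * cis (2 * pi * (real s / P * y))) *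
     (of_real (fweight P s') * cis (- (2 * pi * (real s' / P * y)))) =
      of_real (fweight P s * fweight P s') * cis (2 * pi * ((real s - real s') / P * y))" by simp
  qed
  finally show ?thesis .
qed

lemma fejer_nonneg: "0 \<le> fejer P y"
  by (simp add: fejer_def)

(* The geometric weights keep the kernel away from zero: a uniform average would vanish at
   nonzero integers y. *)
lemma fejer_lower:
  assumes "2 \<le> P"
  shows "exp (- 64 * y\<^sup>2) / 4 \<le> fejer P y"
proof -
  define r where "r = 1 - 1 / real P"
  define x where "x = 2 * pi * y / P"
  define w where "w = of_real r * cis x"
  have r: "0 \<le> r" "r < 1" using assms by (auto simp: r_def)
  have cw: "cmod w = r" using r by (simp add: w_def norm_mult)
  then have w1: "w \<noteq> 1" using r by auto
  have "(\<Sum>s<P. of_real (fweight P s) * cis (2 * pi * (real s / P * y))) = (\<Sum>s<P. w ^ s) / P"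
    unfolding sum_divide_distrib
  proof (rule sum.cong[OF refl])
    fix s
    show "of_real (fweight P s) * cis (2 * pi * (real s / P * y)) = w ^ s / P"
    proof -
      have "2 * pi * (real s / P * y) = real s * x" by (simp add: x_def)
      then have "cis (2 * pi * (real s / P * y)) = cis x ^ s" by (metis Complex.DeMoivre)
      then show ?thesis by (simp add: w_def r_def fweight_def power_mult_distrib)
    qed
  qed
  also have "(\<Sum>s<P. w ^ s) = (w ^ P - 1) / (w - 1)" using w1 by (rule geometric_sum)
  finally have F: "fejer P y = (cmod (w ^ P - 1))\<^sup>2 / (real P * cmod (w - 1))\<^sup>2"
    unfolding fejer_def by (simp add: norm_divide power_divide power_mult_distrib norm_mult mult.commute)
  have "r ^ P \<le> exp (- 1 / P) ^ P"
    using r exp_ge_add_one_self[of "- 1 / P"] by (intro power_mono) (auto simp: r_def)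
  also have "\<dots> = exp (- 1)" using assms by (simp flip: exp_of_nat_mult)
  also have "\<dots> \<le> 1 / 2" using exp_ge_add_one_self[of 1] by (simp add: exp_minus field_simps)
  finally have "1 / 2 \<le> cmod (w ^ P - 1)"
    using norm_triangle_ineq2[of 1 "w ^ P"] by (simp add: norm_power cw norm_minus_commute)
  then have num: "(1 / 2)\<^sup>2 \<le> (cmod (w ^ P - 1))\<^sup>2" by (intro power_mono) auto
  have "(cmod (w - 1))\<^sup>2 = (r * cos x - 1)\<^sup>2 + (r * sin x)\<^sup>2" unfolding cmod_power2 by (simp add: w_def)
  also have "\<dots> = (1 - r)\<^sup>2 + 2 * r * (1 - cos x)"
  proof -
    have "(r * c - 1)\<^sup>2 + (r * s)\<^sup>2 = r\<^sup>2 * (s\<^sup>2 + c\<^sup>2) - 2 * r * c + 1" for c s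
      by (simp add: power2_eq_square algebra_simps)
    from this[of "cos x" "sin x"]
    have "(r * cos x - 1)\<^sup>2 + (r * sin x)\<^sup>2 = r\<^sup>2 * ((sin x)\<^sup>2 + (cos x)\<^sup>2) - 2 * r * cos x + 1" .
    also have "(sin x)\<^sup>2 + (cos x)\<^sup>2 = 1" by (rule sin_cos_squared_add)
    also have "r\<^sup>2 * 1 - 2 * r * cos x + 1 = (1 - r)\<^sup>2 + 2 * r * (1 - cos x)"
      by (simp add: power2_eq_square algebra_simps)
    finally show ?thesis .
  qed
  finally have den: "(cmod (w - 1))\<^sup>2 = (1 - r)\<^sup>2 + 2 * r * (1 - cos x)" .
  have "1 - cos x = 2 * (sin (x / 2))\<^sup>2" using cos_double_sin[of "x / 2"] by simp
  also have "\<dots> \<le> 2 * (x / 2)\<^sup>2" by (intro mult_left_mono iffD1[OF abs_le_square_iff abs_sin_x_le_abs_x]) simp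
  finally have "2 * r * (1 - cos x) \<le> 2 * 1 * (2 * (x / 2)\<^sup>2)" using r by (intro mult_mono) auto
  then have "(cmod (w - 1))\<^sup>2 \<le> (1 - r)\<^sup>2 + x\<^sup>2" unfolding den by (simp add: power_divide)
  \<comment> \<open>The normalisation P cancels the 1 / P in both 1 - r and x, so the denominator is
    bounded independently of P.\<close>
  then have "(real P)\<^sup>2 * (cmod (w - 1))\<^sup>2 \<le> (real P)\<^sup>2 * ((1 - r)\<^sup>2 + x\<^sup>2)" by (intro mult_left_mono) auto
  also have "\<dots> = 1 + (2 * pi * y)\<^sup>2" using assms by (simp add: r_def x_def field_simps power_divide)
  also have "\<dots> \<le> 1 + (8 * y)\<^sup>2" unfolding power_mult_distrib
    by (intro add_left_mono mult_right_mono) (use pi_less_4 power_mono[of pi 4 2] in auto)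
  also have "\<dots> \<le> exp (64 * y\<^sup>2)" using exp_ge_add_one_self[of "64 * y\<^sup>2"] by (simp add: power_mult_distrib)
  finally have den2: "(real P * cmod (w - 1))\<^sup>2 \<le> exp (64 * y\<^sup>2)" by (simp add: power_mult_distrib)
  have "exp (- 64 * y\<^sup>2) / 4 = (1 / 2)\<^sup>2 / exp (64 * y\<^sup>2)" by (simp add: exp_minus field_simps power_divide)
  also have "\<dots> \<le> fejer P y" unfolding F using num den2 assms w1 by (intro frac_le) auto
  finally show ?thesis .
qed

section \<open>Fourier representation of a row\<close>

abbreviation mv :: "'j set \<Rightarrow> ('a \<Rightarrow> 'j \<Rightarrow> real) \<Rightarrow> ('j \<Rightarrow> real) \<Rightarrow> 'a \<Rightarrow> real" where
  "mv J V h l \<equiv> \<Sum>j\<in>J. V l j * h j"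

text \<open>For z = u1 \<open>lo\<close> + u2 \<open>hi\<close> this is the J(u) of the overview: h
  shifts z along the columns of V.\<close>

definition row_char :: "'a set \<Rightarrow> 'j set \<Rightarrow> ('a \<Rightarrow> 'j \<Rightarrow> real) \<Rightarrow> ('a \<Rightarrow> real) \<Rightarrow> real" where
  "row_char A J V z = lexpect (1/4) J (\<lambda>h. \<Prod>l\<in>A. lchar (1/4) (mv J V h l + z l))"

text \<open>The J' of the overview; 3/32 is the parameter produced by \<open>lchar_mult_le\<close>,
  and h - h' replaces h.\<close>

definition diff_char :: "'a set \<Rightarrow> 'j set \<Rightarrow> ('a \<Rightarrow> 'j \<Rightarrow> real) \<Rightarrow> ('a \<Rightarrow> real) \<Rightarrow> real" where
  "diff_char A J V z = lexpect (1/4) J (\<lambda>h. lexpect (1/4) J (\<lambda>h'.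
     \<Prod>l\<in>A. lchar (3/32) (mv J V h l - mv J V h' l + z l)))"

text \<open>Each factor \<open>lchar\<close> on the left is itself an average of characters over a
  lazy sign h j. Integrating over \<tau> before h moves the product from the index set J to the
  index set A.\<close>

lemma row_char_fourier:
  assumes "finite A" "finite J"
  shows "lexpect (1/4) A (\<lambda>\<tau>. of_real (\<Prod>j\<in>J. lchar (1/4) (\<Sum>l\<in>A. V l j * \<tau> l)) *
      cis (2 * pi * (\<Sum>l\<in>A. \<tau> l * z l))) = of_real (row_char A J V z)"
proof -
  have eq: "(\<Sum>j\<in>J. h j * (\<Sum>l\<in>A. V l j * \<tau> l)) + (\<Sum>l\<in>A. \<tau> l * z l) =
      (\<Sum>l\<in>A. \<tau> l * (mv J V h l + z l))" for h \<tau>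
    by (simp add: sum_distrib_left distrib_left sum.distrib sum.swap[of _ J A] mult_ac)
  have "lexpect (1/4) A (\<lambda>\<tau>. of_real (\<Prod>j\<in>J. lchar (1/4) (\<Sum>l\<in>A. V l j * \<tau> l)) *
      cis (2 * pi * (\<Sum>l\<in>A. \<tau> l * z l))) =
    lexpect (1/4) A (\<lambda>\<tau>. lexpect (1/4) J (\<lambda>h. cis (2 * pi * (\<Sum>j\<in>J. h j * (\<Sum>l\<in>A. V l j * \<tau> l)))) *
      cis (2 * pi * (\<Sum>l\<in>A. \<tau> l * z l)))" by (subst lazy_charfun) (use assms in auto)
  also have "\<dots> = lexpect (1/4) A (\<lambda>\<tau>. lexpect (1/4) J (\<lambda>h.
      cis (2 * pi * (\<Sum>l\<in>A. \<tau> l * (mv J V h l + z l)))))"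
    by (simp add: expect_mult_right[symmetric] cis_mult distrib_left[symmetric] eq)
  also have "\<dots> = lexpect (1/4) J (\<lambda>h. of_real (\<Prod>l\<in>A. lchar (1/4) (mv J V h l + z l)))"
    by (subst expect_swap, subst lazy_charfun) (use assms in auto)
  finally show ?thesis by (simp only: row_char_def expect_of_real)
qed

lemma row_char_nonneg: "finite J \<Longrightarrow> 0 \<le> row_char A J V z"
  unfolding row_char_def by (intro expect_nonneg law_lazy prod_nonneg lchar_nonneg) auto

text \<open>Strict positivity is what permits real powers of \<open>row_char\<close> in
  \<open>grid_bound\<close>.\<close>

lemma row_char_pos:
  assumes "finite J"
  shows "0 < row_char A J V z"
proof -
  have law: "law J (\<lambda>_. {-1, 0, 1::real}) (\<lambda>_. lazy (1/4))" using assms by (intro law_lazy) auto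
  obtain h where "(\<Prod>l\<in>A. lchar (1/4) (mv J V h l + z l)) \<le> row_char A J V z"
    using expect_exists[OF law, of "\<lambda>h. \<Prod>l\<in>A. lchar (1/4) (mv J V h l + z l)"] unfolding row_char_def by blast
  moreover have "0 < (\<Prod>l\<in>A. lchar (1/4) (mv J V h l + z l))" by (intro prod_pos lchar_pos) auto
  ultimately show ?thesis by linarith
qed

lemma row_char_mult_le:
  fixes V :: "'a \<Rightarrow> 'j \<Rightarrow> real"
  assumes "finite J"
  shows "row_char A J V z * row_char A J V z' \<le> diff_char A J V (\<lambda>l. z l - z' l)"
proof -
  have law: "law J (\<lambda>_. {-1, 0, 1::real}) (\<lambda>_. lazy (1/4))" using assms by (intro law_lazy) auto
  have "row_char A J V z * row_char A J V z' = lexpect (1/4) J (\<lambda>h. lexpect (1/4) J (\<lambda>h'.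
      (\<Prod>l\<in>A. lchar (1/4) (mv J V h l + z l)) *
      (\<Prod>l\<in>A. lchar (1/4) (mv J V h' l + z' l))))"
    unfolding row_char_def by (simp add: expect_mult_left expect_mult_right)
  also have "\<dots> \<le> diff_char A J V (\<lambda>l. z l - z' l)" unfolding diff_char_def
  proof (intro expect_mono[OF law])
    fix h h' :: "'j \<Rightarrow> real"
    have "(\<Prod>l\<in>A. lchar (1/4) (mv J V h l + z l)) *
        (\<Prod>l\<in>A. lchar (1/4) (mv J V h' l + z' l)) =
      (\<Prod>l\<in>A. lchar (1/4) (mv J V h l + z l) * lchar (1/4) (mv J V h' l + z' l))" by (simp add: prod.distrib)
    also have "\<dots> \<le> (\<Prod>l\<in>A. lchar (3/32) (mv J V h l + z l - (mv J V h' l + z' l)))"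
      by (intro prod_mono) (auto intro!: lchar_mult_le mult_nonneg_nonneg lchar_nonneg)
    finally show "(\<Prod>l\<in>A. lchar (1/4) (mv J V h l + z l)) *
        (\<Prod>l\<in>A. lchar (1/4) (mv J V h' l + z' l)) \<le>
      (\<Prod>l\<in>A. lchar (3/32) (mv J V h l - mv J V h' l + (z l - z' l)))" by (simp add: algebra_simps)
  qed
  finally show ?thesis .
qed

text \<open>The duality of \<open>row_char_fourier\<close> read backwards: h and h' each contribute
  one factor \<open>lchar\<close>, hence the square. The right-hand side is a smoothed small ball
  probability for V applied to a lazy sign vector.\<close>

lemma diff_char_zero:
  assumes "finite A" "finite J"
  shows "diff_char A J V (\<lambda>_. 0) = lexpect (3/32) A (\<lambda>\<tau>. \<Prod>j\<in>J. (lchar (1/4) (\<Sum>l\<in>A. V l j * \<tau> l))\<^sup>2)"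
proof -
  have eq: "(\<Sum>l\<in>A. \<tau> l * (mv J V h l - mv J V h' l)) =
    (\<Sum>j\<in>J. h j * (\<Sum>l\<in>A. V l j * \<tau> l)) + (\<Sum>j\<in>J. h' j * - (\<Sum>l\<in>A. V l j * \<tau> l))" for \<tau> h h'
    by (simp add: sum_distrib_left right_diff_distrib sum_subtractf sum.swap[of _ J A] sum_negf mult_ac)
  have "complex_of_real (diff_char A J V (\<lambda>_. 0)) = lexpect (1/4) J (\<lambda>h. lexpect (1/4) J (\<lambda>h'.
     of_real (\<Prod>l\<in>A. lchar (3/32) (mv J V h l - mv J V h' l))))"
    by (simp only: diff_char_def expect_of_real add_0_right)
  also have "\<dots> = lexpect (1/4) J (\<lambda>h. lexpect (1/4) J (\<lambda>h'. lexpect (3/32) A (\<lambda>\<tau>.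
     cis (2 * pi * (\<Sum>l\<in>A. \<tau> l * (mv J V h l - mv J V h' l))))))" by (subst lazy_charfun) (use assms in auto)
  also have "\<dots> = lexpect (3/32) A (\<lambda>\<tau>. lexpect (1/4) J (\<lambda>h. lexpect (1/4) J (\<lambda>h'.
     cis (2 * pi * (\<Sum>j\<in>J. h j * (\<Sum>l\<in>A. V l j * \<tau> l))) *
     cis (2 * pi * (\<Sum>j\<in>J. h' j * - (\<Sum>l\<in>A. V l j * \<tau> l))))))"
    unfolding eq distrib_left cis_mult[symmetric] by (simp only: expect_swap[of J _ _ A])
  also have "\<dots> = lexpect (3/32) A (\<lambda>\<tau>. lexpect (1/4) J (\<lambda>h. cis (2 * pi * (\<Sum>j\<in>J. h j * (\<Sum>l\<in>A. V l j * \<tau> l)))) *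
     lexpect (1/4) J (\<lambda>h'. cis (2 * pi * (\<Sum>j\<in>J. h' j * - (\<Sum>l\<in>A. V l j * \<tau> l)))))"
    by (simp only: expect_mult_left expect_mult_right)
  also have "\<dots> = lexpect (3/32) A (\<lambda>\<tau>. of_real (\<Prod>j\<in>J. (lchar (1/4) (\<Sum>l\<in>A. V l j * \<tau> l))\<^sup>2))"
    by (subst lazy_charfun, use assms in simp_all)
       (subst lazy_charfun, use assms in \<open>simp_all add: power2_eq_square prod.distrib\<close>)
  finally show ?thesis by (simp only: expect_of_real of_real_eq_iff)
qed

text \<open>If z is far from the integer points, then either the shift g = V (h - h') or the
  residual r of g + z modulo integers is long: T \<le> 2 |g|^2 + 2 |r|^2. A long residual makes the
  product small; a long shift is paid for by the exponential moment, which separates into h and h'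
  because |g|^2 \<le> 2 |V h|^2 + 2 |V h'|^2. The condition T \<le> 2 D allows the truncation at
  D.\<close>

lemma diff_char_le:
  fixes V :: "'a \<Rightarrow> 'j \<Rightarrow> real"
  assumes "finite J"
    and dist: "\<And>w. (\<And>l. l \<in> A \<Longrightarrow> z l + w l \<in> \<int>) \<Longrightarrow> T \<le> (\<Sum>l\<in>A. (w l)\<^sup>2)"
    and TD: "T \<le> 2 * D" and D: "0 \<le> D"
  shows "diff_char A J V z \<le> exp (- 3/8 * T) *
    (lexpect (1/4) J (\<lambda>h. exp (3/2 * min (\<Sum>l\<in>A. (mv J V h l)\<^sup>2) D)))\<^sup>2"
proof -
  have law: "law J (\<lambda>_. {-1, 0, 1::real}) (\<lambda>_. lazy (1/4))" using assms by (intro law_lazy) auto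
  define n where "n h = (\<Sum>l\<in>A. (mv J V h l)\<^sup>2)" for h
  have "diff_char A J V z \<le> lexpect (1/4) J (\<lambda>h. lexpect (1/4) J (\<lambda>h'.
      exp (- 3/8 * T) * (exp (3/2 * min (n h) D) * exp (3/2 * min (n h') D))))" unfolding diff_char_def
  proof (intro expect_mono[OF law])
    fix h h' :: "'j \<Rightarrow> real"
    define g where "g l = mv J V h l - mv J V h' l" for l
    define r where "r l = g l + z l - of_int (round (g l + z l))" for l
    have g: "(\<Sum>l\<in>A. (g l)\<^sup>2) \<le> 2 * n h + 2 * n h'" unfolding n_def sum_distrib_left sum.distrib[symmetric] g_def
      by (intro sum_mono) (smt (verit) power2_sum power2_diff zero_le_power2)
    \<comment> \<open>The choice w = g - r is admissible in \<open>dist\<close>, since z + g - r is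
      the rounded vector.\<close>
    have "T \<le> (\<Sum>l\<in>A. (g l - r l)\<^sup>2)" by (rule dist) (simp add: r_def)
    also have "\<dots> \<le> 2 * (\<Sum>l\<in>A. (g l)\<^sup>2) + 2 * (\<Sum>l\<in>A. (r l)\<^sup>2)" unfolding sum_distrib_left sum.distrib[symmetric]
      by (intro sum_mono) (smt (verit) power2_sum power2_diff zero_le_power2)
    finally have T: "T \<le> 2 * (\<Sum>l\<in>A. (g l)\<^sup>2) + 2 * (\<Sum>l\<in>A. (r l)\<^sup>2)" .
    have "(\<Prod>l\<in>A. lchar (3/32) (g l + z l)) \<le> (\<Prod>l\<in>A. exp (- 3/4 * (r l)\<^sup>2))"
    proof (intro prod_mono conjI)
      fix l
      show "lchar (3/32) (g l + z l) \<le> exp (- 3/4 * (r l)\<^sup>2)"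
        using lchar_upper[of "3/32" "g l + z l"] by (simp add: r_def)
    qed (auto intro: lchar_nonneg)
    also have "\<dots> = exp (- 3/4 * (\<Sum>l\<in>A. (r l)\<^sup>2))" by (cases "finite A") (simp_all add: exp_sum sum_distrib_left)
    finally have 1: "(\<Prod>l\<in>A. lchar (3/32) (g l + z l)) \<le> exp (- 3/4 * (\<Sum>l\<in>A. (r l)\<^sup>2))" .
    have 2: "(\<Prod>l\<in>A. lchar (3/32) (g l + z l)) \<le> 1" by (intro prod_le_1) (auto intro: lchar_nonneg lchar_le_1)
    have "(\<Prod>l\<in>A. lchar (3/32) (g l + z l)) \<le> exp (- 3/8 * T + 3/4 * min (\<Sum>l\<in>A. (g l)\<^sup>2) D)"
    proof (cases "(\<Sum>l\<in>A. (g l)\<^sup>2) \<le> D")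
      case True
      then have "- 3/4 * (\<Sum>l\<in>A. (r l)\<^sup>2) \<le> - 3/8 * T + 3/4 * min (\<Sum>l\<in>A. (g l)\<^sup>2) D" using T by simp
      then show ?thesis using 1 by (meson exp_le_cancel_iff order_trans)
    next
      \<comment> \<open>A shift longer than the truncation level: the trivial bound 1 suffices, as
        3/4 D compensates 3/8 T.\<close>
      case False
      then have "0 \<le> - 3/8 * T + 3/4 * min (\<Sum>l\<in>A. (g l)\<^sup>2) D" using TD by simp
      then show ?thesis using 2 by (meson one_le_exp_iff order_trans)
    qed
    also have "\<dots> \<le> exp (- 3/8 * T + (3/2 * min (n h) D + 3/2 * min (n h') D))"
    proof -
      have "0 \<le> n h" "0 \<le> n h'" "0 \<le> (\<Sum>l\<in>A. (g l)\<^sup>2)" by (auto simp: n_def intro: sum_nonneg)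
      then have "min (\<Sum>l\<in>A. (g l)\<^sup>2) D \<le> 2 * min (n h) D + 2 * min (n h') D" using g D by (auto simp: min_def)
      then show ?thesis by simp
    qed
    finally show "(\<Prod>l\<in>A. lchar (3/32) (mv J V h l - mv J V h' l + z l)) \<le>
      exp (- 3/8 * T) * (exp (3/2 * min (n h) D) * exp (3/2 * min (n h') D))" by (simp only: exp_add g_def)
  qed
  also have "\<dots> = exp (- 3/8 * T) * (lexpect (1/4) J (\<lambda>h. exp (3/2 * min (n h) D)))\<^sup>2"
    by (simp only: expect_mult_left expect_mult_right power2_eq_square)
  finally show ?thesis unfolding n_def .
qed

lemma row_fourier:
  fixes V :: "'a \<Rightarrow> 'j \<Rightarrow> real"
  assumes "finite A" "finite J"
  shows "lexpect (1/4) A (\<lambda>\<tau>. (\<Prod>j\<in>J. lchar (1/4) (\<Sum>l\<in>A. V l j * \<tau> l)) *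
      (fejer P (\<Sum>l\<in>A. \<tau> l * x l) * fejer P (\<Sum>l\<in>A. \<tau> l * y l))) =
    (\<Sum>s<P. \<Sum>s'<P. \<Sum>t<P. \<Sum>t'<P.
      (fweight P s * fweight P s') * (fweight P t * fweight P t') *
      row_char A J V (\<lambda>l. (real s - real s') / P * x l + (real t - real t') / P * y l))"
    (is "?lhs = ?rhs")
proof -
  define c where "c s s' = fweight P s * (fweight P s')" for s s' :: nat
  define f where "f \<tau> = (\<Prod>j\<in>J. lchar (1/4) (\<Sum>l\<in>A. V l j * \<tau> l))" for \<tau>
  have cs: "cis (2 * pi * (a * (\<Sum>l\<in>A. \<tau> l * x l))) * cis (2 * pi * (b * (\<Sum>l\<in>A. \<tau> l * y l))) =
      cis (2 * pi * (\<Sum>l\<in>A. \<tau> l * (a * x l + b * y l)))" for a b \<tau>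
    by (simp add: cis_mult distrib_left[symmetric] sum_distrib_left sum.distrib mult_ac)
       (simp add: sum_distrib_left sum.distrib distrib_left mult_ac)
  have "of_real (f \<tau> * (fejer P (\<Sum>l\<in>A. \<tau> l * x l) * fejer P (\<Sum>l\<in>A. \<tau> l * y l))) =
    (\<Sum>s<P. \<Sum>s'<P. \<Sum>t<P. \<Sum>t'<P. of_real (c s s' * c t t') * (of_real (f \<tau>) *
      cis (2 * pi * (\<Sum>l\<in>A. \<tau> l * ((real s - real s') / P * x l + (real t - real t') / P * y l)))))" for \<tau>
    unfolding of_real_mult[of "f \<tau>"] of_real_mult[of "fejer _ _"] fejer_expand c_def[symmetric]
    unfolding sum_distrib_right unfolding sum_distrib_left
    unfolding sum_distrib_left[symmetric, of _ _ A] cs[symmetric]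
    by (intro sum.cong refl) (simp only: of_real_mult mult_ac)
  then have "of_real ?lhs = lexpect (1/4) A (\<lambda>\<tau>.
    (\<Sum>s<P. \<Sum>s'<P. \<Sum>t<P. \<Sum>t'<P. of_real (c s s' * c t t') * (of_real (f \<tau>) *
      cis (2 * pi * (\<Sum>l\<in>A. \<tau> l * ((real s - real s') / P * x l + (real t - real t') / P * y l))))))"
    by (simp only: expect_of_real[symmetric] f_def)
  also have "\<dots> = of_real ?rhs"
    by (simp only: expect_sum expect_mult_left f_def row_char_fourier[OF assms] c_def of_real_mult of_real_sum)
  finally show ?thesis by (simp only: of_real_eq_iff)
qed

text \<open>All terms of the Fourier expansion are nonnegative and every weight is at most 1 / P, so
  the expansion is at most a uniform average. It then suffices to bound the sum over (s, t) for each
  base point (s', t').\<close>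

lemma row_bound:
  fixes V :: "'a \<Rightarrow> 'j \<Rightarrow> real"
  assumes "finite A" "finite J" "0 < P"
    and B: "\<And>s' t'. s' < P \<Longrightarrow> t' < P \<Longrightarrow>
      (\<Sum>s<P. \<Sum>t<P. row_char A J V (\<lambda>l. (real s - real s') / P * x l + (real t - real t') / P * y l)) \<le> (real P)\<^sup>2 * B"
  shows "lexpect (1/4) A (\<lambda>\<tau>. (\<Prod>j\<in>J. lchar (1/4) (\<Sum>l\<in>A. V l j * \<tau> l)) *
      (fejer P (\<Sum>l\<in>A. \<tau> l * x l) * fejer P (\<Sum>l\<in>A. \<tau> l * y l))) \<le> B"
proof -
  define w where "w s = fweight P s" for s :: nat
  define F where "F s s' t t' = row_char A J V (\<lambda>l. (real s - real s') / P * x l + (real t - real t') / P * y l)"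
    for s s' t t' :: nat
  have w0: "0 \<le> w s" and w1: "w s \<le> 1 / P" for s
    using assms(3) by (auto simp: w_def fweight_def intro!: divide_right_mono power_le_one)
  have F0: "0 \<le> F s s' t t'" for s s' t t' unfolding F_def by (rule row_char_nonneg) fact
  have "(\<Sum>s<P. \<Sum>s'<P. \<Sum>t<P. \<Sum>t'<P. w s * w s' * (w t * w t') * F s s' t t') \<le>
    (\<Sum>s<P. \<Sum>s'<P. \<Sum>t<P. \<Sum>t'<P. 1 / P * (1 / P) * (1 / P * (1 / P)) * F s s' t t')"
    by (intro sum_mono mult_right_mono F0 mult_mono w1) (auto intro: w0 mult_nonneg_nonneg)
  also have "\<dots> = 1 / P ^ 4 * (\<Sum>s'<P. \<Sum>t'<P. \<Sum>s<P. \<Sum>t<P. F s s' t t')"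
  proof -
    have "(\<Sum>s<P. \<Sum>s'<P. \<Sum>t<P. \<Sum>t'<P. F s s' t t') = (\<Sum>s'<P. \<Sum>s<P. \<Sum>t<P. \<Sum>t'<P. F s s' t t')" by (rule sum.swap)
    also have "\<dots> = (\<Sum>s'<P. \<Sum>s<P. \<Sum>t'<P. \<Sum>t<P. F s s' t t')" by (intro sum.cong refl sum.swap)
    also have "\<dots> = (\<Sum>s'<P. \<Sum>t'<P. \<Sum>s<P. \<Sum>t<P. F s s' t t')" by (intro sum.cong refl sum.swap)
    finally have swap: "(\<Sum>s<P. \<Sum>s'<P. \<Sum>t<P. \<Sum>t'<P. F s s' t t') =
        (\<Sum>s'<P. \<Sum>t'<P. \<Sum>s<P. \<Sum>t<P. F s s' t t')" .
    show ?thesis unfolding sum_distrib_left[symmetric] swap by (simp add: power4_eq_xxxx)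
  qed
  also have "\<dots> \<le> 1 / P ^ 4 * (\<Sum>s'<P. \<Sum>t'<P. (real P)\<^sup>2 * B)"
    unfolding F_def by (intro mult_left_mono sum_mono B) auto
  also have "\<dots> = B" using assms(3) by (simp add: power4_eq_xxxx power2_eq_square)
  finally show ?thesis unfolding row_fourier[OF assms(1,2)] w_def F_def .
qed

section \<open>Gaussian sums over the frequency grid\<close>

lemma sum_grid_le:
  fixes g :: "nat \<Rightarrow> real"
  assumes "\<And>j. 0 \<le> g j" "a < P"
  shows "(\<Sum>s<P. g (if s \<le> a then a - s else s - a)) \<le> 2 * (\<Sum>j<P. g j)"
proof -
  have "(\<Sum>s<P. g (if s \<le> a then a - s else s - a)) =
      (\<Sum>s\<in>{..a}. g (a - s)) + (\<Sum>s\<in>{a<..<P}. g (s - a))"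
  proof -
    let ?h = "\<lambda>s. g (if s \<le> a then a - s else s - a)"
    have "{..<P} = {..a} \<union> {a<..<P}" using assms(2) by auto
    then have "sum ?h {..<P} = sum ?h ({..a} \<union> {a<..<P})" by (rule arg_cong)
    also have "\<dots> = sum ?h {..a} + sum ?h {a<..<P}" by (rule sum.union_disjoint) auto
    also have "\<dots> = (\<Sum>s\<in>{..a}. g (a - s)) + (\<Sum>s\<in>{a<..<P}. g (s - a))"
      by (intro arg_cong2[where f = "(+)"] sum.cong) auto
    finally show ?thesis .
  qed
  also have "(\<Sum>s\<in>{..a}. g (a - s)) = sum g ((\<lambda>s. a - s) ` {..a})" by (subst sum.reindex) (auto simp: inj_on_def)
  also have "(\<Sum>s\<in>{a<..<P}. g (s - a)) = sum g ((\<lambda>s. s - a) ` {a<..<P})"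
    by (subst sum.reindex) (auto simp: inj_on_def)
  also have "sum g ((\<lambda>s. a - s) ` {..a}) \<le> (\<Sum>j<P. g j)" by (rule sum_mono2) (use assms in auto)
  also have "sum g ((\<lambda>s. s - a) ` {a<..<P}) \<le> (\<Sum>j<P. g j)" by (rule sum_mono2) (use assms in auto)
  finally show ?thesis by simp
qed

lemma sum_gaussian_le:
  assumes "0 < x" "a < P"
  shows "(\<Sum>s<P. exp (- (x * (real s - real a))\<^sup>2)) \<le> 4 * (1 + 1 / x)"
proof -
  define q where "q = exp (- x)"
  have q: "0 < q" "q < 1" using assms by (auto simp: q_def)
  have "exp (- (x * (real s - real a))\<^sup>2) \<le> 2 * q ^ (if s \<le> a then a - s else s - a)" for s
  proof -
    define y where "y = x * (if s \<le> a then a - s else s - a)"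
    have sq: "(x * (real s - real a))\<^sup>2 = y\<^sup>2"
      by (simp add: y_def of_nat_diff power_mult_distrib power2_commute)
    \<comment> \<open>Replacing y^2 by y - 1/2 dominates the Gaussian by a geometric sequence, which
      can be summed explicitly.\<close>
    have "0 \<le> (y - 1/2)\<^sup>2" by simp
    then have "- y\<^sup>2 \<le> 1/2 + - y" by (simp add: power2_eq_square algebra_simps)
    then have "exp (- y\<^sup>2) \<le> exp (1/2) * exp (- y)" by (simp flip: exp_add)
    also have "exp (1/2) \<le> (2::real)" using exp_bound_half[of "1/2::real"] by simp
    finally have "exp (- y\<^sup>2) \<le> 2 * exp (- y)" by simp
    also have "exp (- y) = q ^ (if s \<le> a then a - s else s - a)"
      unfolding q_def y_def by (simp flip: exp_of_nat_mult add: mult.commute)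
    finally show ?thesis unfolding sq .
  qed
  then have "(\<Sum>s<P. exp (- (x * (real s - real a))\<^sup>2)) \<le> (\<Sum>s<P. 2 * q ^ (if s \<le> a then a - s else s - a))"
    by (intro sum_mono) auto
  also have "\<dots> \<le> 2 * (\<Sum>j<P. 2 * q ^ j)" by (rule sum_grid_le) (use q assms in auto)
  also have "(\<Sum>j<P. 2 * q ^ j) = 2 * ((1 - q ^ P) / (1 - q))"
    using q by (simp flip: sum_distrib_left add: sum_gp_strict)
  also have "2 * (2 * ((1 - q ^ P) / (1 - q))) \<le> 4 * (1 / (1 - q))" using q by (simp add: divide_right_mono)
  also have "1 / (1 - q) \<le> 1 + 1 / x"
  proof -
    have "q \<le> 1 / (1 + x)" using exp_ge_add_one_self[of x] assms by (simp add: q_def exp_minus field_simps)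
    then have "x / (1 + x) \<le> 1 - q" using assms by (simp add: field_simps)
    then have "1 / (1 - q) \<le> 1 / (x / (1 + x))" using assms q by (intro divide_left_mono) auto
    also have "\<dots> = 1 + 1 / x" using assms by (simp add: field_simps)
    finally show ?thesis .
  qed
  finally show ?thesis by simp
qed

text \<open>The three terms are the discretisation error of the grid, the Gaussian integral, and the
  floor at which the truncated exponent stops decaying. In the application each of them is O(1 /
  N).\<close>

lemma grid_average:
  assumes "0 < c" "0 < \<nu>" "a < P"
  shows "(\<Sum>s<P. exp (- c * min (((real s - real a) / P)\<^sup>2 * \<nu>\<^sup>2 / 4) E)) \<le>
    P * (4 / P + 8 / (\<nu> * sqrt c) + exp (- c * E))"
proof -
  define x where "x = sqrt c * \<nu> / (2 * P)"
  have x: "0 < x" using assms by (simp add: x_def)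
  have "exp (- c * min (((real s - real a) / P)\<^sup>2 * \<nu>\<^sup>2 / 4) E) \<le>
      exp (- (x * (real s - real a))\<^sup>2) + exp (- c * E)" for s
  proof -
    have "(x * (real s - real a))\<^sup>2 = c * (((real s - real a) / P)\<^sup>2 * \<nu>\<^sup>2 / 4)"
      using assms by (simp add: x_def power_mult_distrib power_divide mult_ac)
    then have "exp (- (x * (real s - real a))\<^sup>2) = exp (- c * (((real s - real a) / P)\<^sup>2 * \<nu>\<^sup>2 / 4))" by simp
    moreover have "exp (- c * min A E) \<le> exp (- c * A) + exp (- c * E)" for A by (simp add: min_def)
    ultimately show ?thesis by (simp only:)
  qed
  then have "(\<Sum>s<P. exp (- c * min (((real s - real a) / P)\<^sup>2 * \<nu>\<^sup>2 / 4) E)) \<le>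
      (\<Sum>s<P. exp (- (x * (real s - real a))\<^sup>2) + exp (- c * E))" by (intro sum_mono) auto
  also have "\<dots> \<le> 4 * (1 + 1 / x) + P * exp (- c * E)"
    using sum_gaussian_le[OF x assms(3)] by (simp add: sum.distrib)
  also have "\<dots> = P * (4 / P + 8 / (\<nu> * sqrt c) + exp (- c * E))" using assms by (simp add: x_def field_simps)
  finally show ?thesis .
qed

(* Interpolation J = J^(1-eta) J^eta: the first factor is controlled by the maximum M of J over the
   grid (M^2 <= diff_char 0), the second by J * M <= diff_char at the difference of the grid points. *)
lemma grid_bound:
  fixes V :: "'a \<Rightarrow> 'j \<Rightarrow> real" and G :: real
  assumes "finite J" "0 < P" "0 < \<eta>" "\<eta> < 1/2" "0 < B2" "0 < B3"
    and diff0: "diff_char A J V (\<lambda>_. 0) \<le> B3"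
    and diff_char: "\<And>a b. \<bar>a\<bar> < 1 \<Longrightarrow> \<bar>b\<bar> < 1 \<Longrightarrow>
       diff_char A J V (\<lambda>l. a * x l + b * y l) \<le> exp (- 3/8 * (t a + t b)) * B2\<^sup>2"
    and G: "\<And>a. a < P \<Longrightarrow> (\<Sum>s<P. exp (- (3/8 * \<eta>) * t ((real s - real a) / P))) \<le> P * G"
    and "a' < P" "b' < P"
  shows "(\<Sum>s<P. \<Sum>u<P. row_char A J V (\<lambda>l. (real s - real a') / P * x l + (real u - real b') / P * y l)) \<le>
    (real P)\<^sup>2 * (B3 powr ((1 - 2 * \<eta>) / 2) * B2 powr (2 * \<eta>) * G\<^sup>2)"
proof -
  let ?d = "\<lambda>a s. (real s - real a) / P"
  let ?e = "\<lambda>a s. exp (- (3/8 * \<eta>) * t (?d a s))"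
  define f where "f s u = row_char A J V (\<lambda>l. (real s - real a') / P * x l + (real u - real b') / P * y l)" for s u :: nat
  have fpos: "0 < f s u" for s u unfolding f_def by (rule row_char_pos) fact
  define K where "K = (\<lambda>(s, u). f s u) ` ({..<P} \<times> {..<P})"
  have K: "finite K" "K \<noteq> {}" using assms(2) by (auto simp: K_def)
  have "Max K \<in> K" using K by (rule Max_in)
  then obtain a b where ab: "a < P" "b < P" "Max K = f a b" by (auto simp: K_def)
  define M where "M = f a b"
  have M0: "0 < M" unfolding M_def by (rule fpos)
  have fM: "f s u \<le> M" if "s < P" "u < P" for s u
    unfolding M_def ab(3)[symmetric] using that K by (intro Max_ge) (auto simp: K_def)
  \<comment> \<open>The base point (a', b') cancels in the difference, so the estimate only sees the
    displacement from the maximiser.\<close>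
  have diff: "f s u * M \<le> diff_char A J V (\<lambda>l. ?d a s * x l + ?d b u * y l)" for s u
  proof -
    have "(\<lambda>l. (real s - real a') / P * x l + (real u - real b') / P * y l -
        ((real a - real a') / P * x l + (real b - real b') / P * y l)) =
      (\<lambda>l. ?d a s * x l + ?d b u * y l)" by (simp add: fun_eq_iff diff_divide_distrib left_diff_distrib)
    moreover have "f s u * M \<le> diff_char A J V (\<lambda>l. (real s - real a') / P * x l + (real u - real b') / P * y l -
        ((real a - real a') / P * x l + (real b - real b') / P * y l))"
      unfolding f_def M_def by (rule row_char_mult_le[OF assms(1)])
    ultimately show ?thesis by (simp only:)
  qed
  have "M * M \<le> B3" using diff[of a b] diff0 unfolding M_def by simp
  then have "M \<le> sqrt B3" by (intro real_le_rsqrt) (simp add: power2_eq_square)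
  also have "\<dots> = B3 powr (1/2)" using assms by (simp add: powr_half_sqrt)
  finally have "M powr (1 - 2 * \<eta>) \<le> (B3 powr (1/2)) powr (1 - 2 * \<eta>)" using M0 assms by (intro powr_mono2) auto
  then have MB: "M powr (1 - 2 * \<eta>) \<le> B3 powr ((1 - 2 * \<eta>) / 2)" by (simp add: powr_powr)
  have key: "f s u \<le> B3 powr ((1 - 2 * \<eta>) / 2) * B2 powr (2 * \<eta>) *
      (?e a s * ?e b u)"
    if su: "s < P" "u < P" for s u
  proof -
    have "\<bar>?d a s\<bar> < 1" "\<bar>?d b u\<bar> < 1" using su ab by (auto simp: abs_if field_simps)
    then have fM': "f s u * M \<le> exp (- 3/8 * (t (?d a s) + t (?d b u))) * B2\<^sup>2"
      by (rule order_trans[OF diff[of s u] diff_char])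
    have "f s u = f s u powr (1 - \<eta>) * f s u powr \<eta>" using fpos[of s u] by (simp flip: powr_add)
    also have "\<dots> \<le> M powr (1 - \<eta>) * f s u powr \<eta>"
      using fM[OF su] fpos[of s u] assms by (intro mult_right_mono powr_mono2) auto
    also have "\<dots> = M powr (1 - 2 * \<eta>) * (f s u * M) powr \<eta>"
      using M0 fpos[of s u] by (simp add: powr_mult powr_add[symmetric])
    also have "\<dots> \<le> B3 powr ((1 - 2 * \<eta>) / 2) *
        (exp (- 3/8 * (t (?d a s) + t (?d b u))) * B2\<^sup>2) powr \<eta>"
      by (intro mult_mono MB powr_mono2 fM') (use M0 fpos[of s u] assms in auto)
    also have "(exp (- 3/8 * (t (?d a s) + t (?d b u))) * B2\<^sup>2) powr \<eta> =
        B2 powr (2 * \<eta>) * (?e a s * ?e b u)"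
    proof -
      have "(B2\<^sup>2) powr \<eta> = B2 powr (2 * \<eta>)" using assms by (simp add: powr_powr flip: powr_numeral)
      moreover have "exp (- 3/8 * (a + b)) powr \<eta> = exp (- (3/8 * \<eta>) * a) * exp (- (3/8 * \<eta>) * b)" for a b :: real
        unfolding exp_powr_real exp_add[symmetric] by (simp add: algebra_simps)
      note this[of "t (?d a s)" "t (?d b u)"]
      ultimately show ?thesis unfolding powr_mult by (simp only: mult.commute)
    qed
    finally show ?thesis by (simp add: mult.assoc)
  qed
  have "(\<Sum>s<P. \<Sum>u<P. f s u) \<le> (\<Sum>s<P. \<Sum>u<P. B3 powr ((1 - 2 * \<eta>) / 2) * B2 powr (2 * \<eta>) *
      (?e a s * ?e b u))" by (intro sum_mono key) auto
  also have "\<dots> = B3 powr ((1 - 2 * \<eta>) / 2) * B2 powr (2 * \<eta>) *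
      ((\<Sum>s<P. ?e a s) *
       (\<Sum>u<P. ?e b u))" unfolding sum_product unfolding sum_distrib_left by (rule refl)
  also have "\<dots> \<le> B3 powr ((1 - 2 * \<eta>) / 2) * B2 powr (2 * \<eta>) * ((P * G) * (P * G))"
  proof (intro mult_left_mono mult_mono G ab)
    show "0 \<le> real P * G" by (rule order_trans[OF sum_nonneg G[OF ab(1)]]) simp
  qed (auto intro: sum_nonneg)
  finally show ?thesis unfolding f_def by (simp add: power2_eq_square mult_ac)
qed

section \<open>Quadratic exponential moments\<close>

lemma expect_insert:
  assumes "i \<notin> I" "finite I"
  shows "expect (insert i I) S q f = (\<Sum>y\<in>S i. q i y *\<^sub>R expect I S q (\<lambda>x. f (x(i := y))))"
proof -
  have "expect (insert i I) S q f = (\<Sum>z\<in>S i \<times> PiE I S.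
      (\<Prod>j\<in>insert i I. q j (((\<lambda>(y, g). g(i := y)) z) j)) *\<^sub>R f ((\<lambda>(y, g). g(i := y)) z))"
    unfolding expect_def PiE_insert_eq by (rule sum.reindex[unfolded comp_def]) (rule inj_combinator[OF assms(1)])
  also have "\<dots> = (\<Sum>z\<in>S i \<times> PiE I S. q i (fst z) *\<^sub>R (\<Prod>j\<in>I. q j (snd z j)) *\<^sub>R f ((snd z)(i := fst z)))"
  proof (intro sum.cong refl)
    fix z assume "z \<in> S i \<times> PiE I S"
    have "(\<Prod>j\<in>I. q j (((snd z)(i := fst z)) j)) = (\<Prod>j\<in>I. q j (snd z j))" by (rule prod.cong) (use assms in auto)
    then show "(\<Prod>j\<in>insert i I. q j (((\<lambda>(y, g). g(i := y)) z) j)) *\<^sub>R f ((\<lambda>(y, g). g(i := y)) z) =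
      q i (fst z) *\<^sub>R (\<Prod>j\<in>I. q j (snd z j)) *\<^sub>R f ((snd z)(i := fst z))"
      using assms by (simp add: case_prod_beta)
  qed
  also have "\<dots> = (\<Sum>y\<in>S i. q i y *\<^sub>R expect I S q (\<lambda>x. f (x(i := y))))"
    unfolding expect_def scaleR_sum_right sum.cartesian_product by (simp add: case_prod_beta)
  finally show ?thesis .
qed

lemma exp_minus_le_quadratic:
  assumes "0 \<le> (x::real)"
  shows "exp (- x) \<le> 1 - x + x\<^sup>2"
proof -
  have "exp (- x) \<le> 1 / (1 + x)" using exp_ge_add_one_self[of x] assms by (simp add: exp_minus field_simps)
  also have "\<dots> \<le> 1 - x + x\<^sup>2"
  proof -
    have "1 \<le> (1 - x + x\<^sup>2) * (1 + x)" using assms by (simp add: algebra_simps power2_eq_square)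
    then show ?thesis using assms by (simp add: divide_le_eq)
  qed
  finally show ?thesis .
qed

text \<open>For a mean-zero variable the linear term disappears on averaging, and a sub-Gaussian
  bound with constant exactly 1 in front remains.\<close>

lemma exp_le_add_exp_square: "exp x \<le> x + exp (x\<^sup>2)" for x :: real
proof -
  have sq: "1 + x\<^sup>2 \<le> exp (x\<^sup>2)" by (rule exp_ge_add_one_self)
  consider "x < - 1" | "- 1 \<le> x" "x \<le> 0" | "0 \<le> x" "x \<le> 1" | "1 < x" by linarith
  then show ?thesis
  proof cases
    case 1
    then have "(- 1) * x \<le> x * x" by (intro mult_right_mono_neg) auto
    then have "- x \<le> x\<^sup>2" by (simp add: power2_eq_square)
    moreover have "exp x \<le> 1" using 1 by simp
    ultimately show ?thesis using sq by linarith
  next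
    case 2
    then have "exp x \<le> 1 + x + x\<^sup>2" using exp_minus_le_quadratic[of "- x"] by simp
    then show ?thesis using sq by linarith
  next
    case 3
    then have "exp x \<le> 1 + x + x\<^sup>2" using exp_bound[of x] by simp
    then show ?thesis using sq by linarith
  next
    case 4
    then have "1 * x \<le> x * x" by (intro mult_right_mono) auto
    then have "exp x \<le> exp (x\<^sup>2)" by (simp add: power2_eq_square)
    then show ?thesis using 4 by linarith
  qed
qed

lemma mgf_bounded_le:
  fixes g q :: "'b \<Rightarrow> real"
  assumes "\<And>y. y \<in> S \<Longrightarrow> 0 \<le> q y" "(\<Sum>y\<in>S. q y) = 1" "(\<Sum>y\<in>S. q y * g y) = 0"
    and "\<And>y. y \<in> S \<Longrightarrow> \<bar>g y\<bar> \<le> b"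
  shows "(\<Sum>y\<in>S. q y * exp (t * g y)) \<le> exp (t\<^sup>2 * b\<^sup>2)"
proof -
  have "(\<Sum>y\<in>S. q y * exp (t * g y)) \<le> (\<Sum>y\<in>S. q y * (t * g y + exp (t\<^sup>2 * b\<^sup>2)))"
  proof (intro sum_mono mult_left_mono assms(1))
    fix y assume y: "y \<in> S"
    have "(g y)\<^sup>2 \<le> b\<^sup>2" using assms(4)[OF y] by (metis abs_ge_zero power2_abs power_mono)
    then have "exp ((t * g y)\<^sup>2) \<le> exp (t\<^sup>2 * b\<^sup>2)" by (simp add: power_mult_distrib mult_left_mono)
    then show "exp (t * g y) \<le> t * g y + exp (t\<^sup>2 * b\<^sup>2)" using exp_le_add_exp_square[of "t * g y"] by linarith
  qed
  also have "\<dots> = t * (\<Sum>y\<in>S. q y * g y) + (\<Sum>y\<in>S. q y) * exp (t\<^sup>2 * b\<^sup>2)"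
    by (simp add: distrib_left sum.distrib sum_distrib_left sum_distrib_right mult_ac)
  finally show ?thesis by (simp add: assms)
qed

text \<open>The offset s carries the induction: after the other coordinates are integrated out, the
  value of coordinate i enters as a shift. Its cross term 2 C s g costs (2 C s)^2 b^2, that is, it
  raises the constant C by 4 C^2 b^2. The smallness assumption keeps C below 4/3 c, so the increase
  is at most 8 c^2 b^2, exactly the growth built into 1 + 8 c (sum of b^2).\<close>

lemma expect_exp_square_aux:
  fixes g :: "'i \<Rightarrow> 'b \<Rightarrow> real"
  assumes "finite I" "law I S q" "0 \<le> c" "24 * c * (\<Sum>i\<in>I. (b i)\<^sup>2) \<le> 1"
    and "\<And>i. i \<in> I \<Longrightarrow> (\<Sum>y\<in>S i. q i y * g i y) = 0"
    and "\<And>i y. i \<in> I \<Longrightarrow> y \<in> S i \<Longrightarrow> \<bar>g i y\<bar> \<le> b i"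
  shows "expect I S q (\<lambda>x. exp (c * (s + (\<Sum>i\<in>I. g i (x i)))\<^sup>2)) \<le>
    exp (c * (1 + 8 * c * (\<Sum>i\<in>I. (b i)\<^sup>2)) * (s\<^sup>2 + (\<Sum>i\<in>I. (b i)\<^sup>2)))" using assms
proof (induction I arbitrary: s rule: finite_induct)
  case empty
  then show ?case by (simp add: expect_def)
next
  case (insert i I)
  define \<sigma> where "\<sigma> = (\<Sum>i\<in>I. (b i)\<^sup>2)"
  define C where "C = c * (1 + 8 * c * \<sigma>)"
  have \<sigma>0: "0 \<le> \<sigma>" by (auto simp: \<sigma>_def intro: sum_nonneg)
  have c: "24 * c * ((b i)\<^sup>2 + \<sigma>) \<le> 1" using insert by (simp add: \<sigma>_def)
  have c\<sigma>: "24 * c * \<sigma> \<le> 1"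
  proof -
    have "24 * c * \<sigma> \<le> 24 * c * ((b i)\<^sup>2 + \<sigma>)" using insert.prems(2) by (intro mult_left_mono) auto
    then show ?thesis using c by linarith
  qed
  have C: "c \<le> C" "C \<le> 4/3 * c"
    using insert.prems(2) \<sigma>0 c\<sigma> mult_left_mono[of "8 * c * \<sigma>" "1/3" c] by (auto simp: C_def distrib_left)
  have law: "law I S q" using insert.prems(1) by (rule law_subset) auto
  have "expect (insert i I) S q (\<lambda>x. exp (c * (s + (\<Sum>i\<in>insert i I. g i (x i)))\<^sup>2)) =
     (\<Sum>y\<in>S i. q i y * expect I S q (\<lambda>x. exp (c * ((s + g i y) + (\<Sum>i\<in>I. g i (x i)))\<^sup>2)))"
  proof -
    have "(\<Sum>j\<in>insert i I. g j ((x(i := y)) j)) = g i y + (\<Sum>j\<in>I. g j (x j))" for x y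
    proof -
      have "(\<Sum>j\<in>I. g j ((x(i := y)) j)) = (\<Sum>j\<in>I. g j (x j))" by (rule sum.cong) (use insert.hyps in auto)
      then show ?thesis using insert.hyps by simp
    qed
    then show ?thesis by (simp only: expect_insert[OF insert.hyps(2,1)] real_scaleR_def add.assoc)
  qed
  also have "\<dots> \<le> (\<Sum>y\<in>S i. q i y * exp (C * ((s + g i y)\<^sup>2 + \<sigma>)))"
  proof (intro sum_mono mult_left_mono)
    fix y assume "y \<in> S i"
    show "expect I S q (\<lambda>x. exp (c * ((s + g i y) + (\<Sum>i\<in>I. g i (x i)))\<^sup>2)) \<le> exp (C * ((s + g i y)\<^sup>2 + \<sigma>))"
      unfolding C_def \<sigma>_def by (rule insert.IH) (use law insert.prems c\<sigma> in \<open>auto simp: \<sigma>_def\<close>)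
    show "0 \<le> q i y" using insert.prems(1) \<open>y \<in> S i\<close> by (auto intro: law_nonneg)
  qed
  also have "\<dots> \<le> (\<Sum>y\<in>S i. q i y * (exp (C * (s\<^sup>2 + (b i)\<^sup>2 + \<sigma>)) * exp ((2 * C * s) * g i y)))"
  proof (intro sum_mono mult_left_mono)
    fix y assume y: "y \<in> S i"
    have "(g i y)\<^sup>2 \<le> (b i)\<^sup>2"
      using insert.prems(5)[of i y] y by (metis abs_ge_zero insertI1 power2_abs power_mono)
    then have "C * ((s + g i y)\<^sup>2 + \<sigma>) \<le> C * (s\<^sup>2 + (b i)\<^sup>2 + \<sigma> + 2 * s * g i y)"
      using C insert.prems(2) by (intro mult_left_mono) (auto simp: power2_sum)
    then show "exp (C * ((s + g i y)\<^sup>2 + \<sigma>)) \<le> exp (C * (s\<^sup>2 + (b i)\<^sup>2 + \<sigma>)) * exp ((2 * C * s) * g i y)"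
      by (simp add: algebra_simps flip: exp_add)
    show "0 \<le> q i y" using insert.prems(1) y by (auto intro: law_nonneg)
  qed
  also have "\<dots> = exp (C * (s\<^sup>2 + (b i)\<^sup>2 + \<sigma>)) * (\<Sum>y\<in>S i. q i y * exp ((2 * C * s) * g i y))"
    by (simp add: sum_distrib_left mult_ac)
  also have "\<dots> \<le> exp (C * (s\<^sup>2 + (b i)\<^sup>2 + \<sigma>)) * exp ((2 * C * s)\<^sup>2 * (b i)\<^sup>2)"
    using insert.prems by (intro mult_left_mono mgf_bounded_le) (auto intro: law_nonneg law_sum)
  also have "\<dots> = exp (C * (s\<^sup>2 + (b i)\<^sup>2 + \<sigma>) + (2 * C * s)\<^sup>2 * (b i)\<^sup>2)" by (simp add: exp_add)
  also have "\<dots> \<le> exp (c * (1 + 8 * c * ((b i)\<^sup>2 + \<sigma>)) * (s\<^sup>2 + ((b i)\<^sup>2 + \<sigma>)))"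
  proof -
    have "C * C \<le> (4/3 * c) * (4/3 * c)" using C insert.prems(2) by (intro mult_mono) auto
    then have "4 * (C * C) \<le> 8 * (c * c)" using mult_nonneg_nonneg[OF insert.prems(2,2)] by linarith
    then have "4 * (C * C) * (b i)\<^sup>2 \<le> 8 * (c * c) * (b i)\<^sup>2" by (rule mult_right_mono) simp
    then have *: "C + 4 * (C * C) * (b i)\<^sup>2 \<le> c * (1 + 8 * c * ((b i)\<^sup>2 + \<sigma>))"
      by (simp add: C_def algebra_simps)
    then have "(C + 4 * (C * C) * (b i)\<^sup>2) * s\<^sup>2 \<le> c * (1 + 8 * c * ((b i)\<^sup>2 + \<sigma>)) * s\<^sup>2"
      by (rule mult_right_mono) simp
    moreover have "C \<le> c * (1 + 8 * c * ((b i)\<^sup>2 + \<sigma>))"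
    proof -
      have "0 \<le> 4 * (C * C) * (b i)\<^sup>2" by simp
      then show ?thesis using * by linarith
    qed
    then have "C * ((b i)\<^sup>2 + \<sigma>) \<le> c * (1 + 8 * c * ((b i)\<^sup>2 + \<sigma>)) * ((b i)\<^sup>2 + \<sigma>)"
      by (rule mult_right_mono) (use \<sigma>0 in simp)
    moreover have "C * (s\<^sup>2 + (b i)\<^sup>2 + \<sigma>) + (2 * C * s)\<^sup>2 * (b i)\<^sup>2 =
        (C + 4 * (C * C) * (b i)\<^sup>2) * s\<^sup>2 + C * ((b i)\<^sup>2 + \<sigma>)" by (simp add: power2_eq_square algebra_simps)
    ultimately show ?thesis by (simp add: distrib_left)
  qed
  also have "(b i)\<^sup>2 + \<sigma> = (\<Sum>i\<in>insert i I. (b i)\<^sup>2)" using insert.hyps by (simp add: \<sigma>_def)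
  finally show ?case .
qed

lemma expect_exp_square:
  fixes g :: "'i \<Rightarrow> 'b \<Rightarrow> real"
  assumes "law I S q" "0 \<le> c" "24 * c * (\<Sum>i\<in>I. (b i)\<^sup>2) \<le> 1"
    and "\<And>i. i \<in> I \<Longrightarrow> (\<Sum>y\<in>S i. q i y * g i y) = 0"
    and "\<And>i y. i \<in> I \<Longrightarrow> y \<in> S i \<Longrightarrow> \<bar>g i y\<bar> \<le> b i"
  shows "expect I S q (\<lambda>x. exp (c * (\<Sum>i\<in>I. g i (x i))\<^sup>2)) \<le> exp (2 * c * (\<Sum>i\<in>I. (b i)\<^sup>2))"
proof -
  define \<sigma> where "\<sigma> = (\<Sum>i\<in>I. (b i)\<^sup>2)"
  have "0 \<le> \<sigma>" by (auto simp: \<sigma>_def intro: sum_nonneg)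
  have "expect I S q (\<lambda>x. exp (c * (0 + (\<Sum>i\<in>I. g i (x i)))\<^sup>2)) \<le>
    exp (c * (1 + 8 * c * \<sigma>) * (0\<^sup>2 + \<sigma>))"
    unfolding \<sigma>_def by (rule expect_exp_square_aux[OF law_finite[OF assms(1)] assms])
  also have "\<dots> \<le> exp (2 * c * \<sigma>)"
  proof -
    have "(1 + 8 * c * \<sigma>) * (c * \<sigma>) \<le> 2 * (c * \<sigma>)"
      using assms(2,3) \<open>0 \<le> \<sigma>\<close> unfolding \<sigma>_def[symmetric] by (intro mult_right_mono) auto
    then show ?thesis by (simp add: mult_ac)
  qed
  finally show ?thesis by (simp add: \<sigma>_def)
qed

text \<open>The hyperbolic cosine produces 4 b^2, and 4 \<le> 1 / (x + 1/8) for x \<le> 1/8. The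
  weaker bound is preferred because B y y - b^2 / (x + 1/8) is again a minimum, namely of B (y + u
  w) + u^2 / 8 over u, hence a form of the same kind.\<close>

lemma lazy_step:
  assumes "0 \<le> \<beta>" "\<beta> \<le> 1" "0 \<le> x" "x \<le> \<kappa>" "\<kappa> \<le> 1/8"
  shows "(\<Sum>t\<in>{-1, 0, 1}. lazy \<beta> t * exp (- (t * t * x + 2 * t * b))) \<le>
    exp (b\<^sup>2 / (x + 1/8) - \<beta> * (1 - \<kappa>) * x)"
proof -
  have "exp (2 * b) + exp (- 2 * b) \<le> 2 * exp (4 * b\<^sup>2)"
    using exp_le_add_exp_square[of "2 * b"] exp_le_add_exp_square[of "- 2 * b"]
    by (simp add: power_mult_distrib)
  then have cosh: "\<beta> / 2 * exp (- x) * (exp (2 * b) + exp (- 2 * b)) \<le> \<beta> / 2 * exp (- x) * (2 * exp (4 * b\<^sup>2))"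
    using assms by (intro mult_left_mono) auto
  have "(\<Sum>t\<in>{-1, 0, 1}. lazy \<beta> t * exp (- (t * t * x + 2 * t * b))) =
      \<beta> / 2 * exp (- x + 2 * b) + (1 - \<beta> + \<beta> / 2 * exp (- x + - 2 * b))" by (simp add: lazy_def)
  also have "\<dots> = 1 - \<beta> + \<beta> / 2 * exp (- x) * (exp (2 * b) + exp (- 2 * b))"
    unfolding exp_add by (simp add: algebra_simps)
  also have "\<dots> \<le> 1 - \<beta> + \<beta> * exp (- x) * exp (4 * b\<^sup>2)" using cosh by simp
  also have "\<dots> \<le> exp (4 * b\<^sup>2) * (1 - \<beta> + \<beta> * exp (- x))"
    using assms mult_left_mono[of 1 "exp (4 * b\<^sup>2)" "1 - \<beta>"] by (simp add: algebra_simps)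
  also have "1 - \<beta> + \<beta> * exp (- x) \<le> exp (- \<beta> * (1 - \<kappa>) * x)"
  proof -
    have "exp (- x) \<le> 1 - x + x * x" using exp_minus_le_quadratic[OF assms(3)] by (simp add: power2_eq_square)
    also have "x * x \<le> \<kappa> * x" using assms by (intro mult_right_mono) auto
    finally have "1 - \<beta> + \<beta> * exp (- x) \<le> 1 - \<beta> + \<beta> * (1 - x + \<kappa> * x)"
      using assms by (intro add_left_mono mult_left_mono) auto
    also have "\<dots> = 1 + (- \<beta> * (1 - \<kappa>) * x)" by (simp add: algebra_simps)
    also have "\<dots> \<le> exp (- \<beta> * (1 - \<kappa>) * x)" by (rule exp_ge_add_one_self)
    finally show ?thesis .
  qed
  also have "exp (4 * b\<^sup>2) * exp (- \<beta> * (1 - \<kappa>) * x) = exp (4 * b\<^sup>2 - \<beta> * (1 - \<kappa>) * x)" by (simp flip: exp_add)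
  also have "\<dots> \<le> exp (b\<^sup>2 / (x + 1/8) - \<beta> * (1 - \<kappa>) * x)"
  proof -
    have "b\<^sup>2 * 4 \<le> b\<^sup>2 * (1 / (x + 1/8))" using assms by (intro mult_left_mono) (auto simp: field_simps)
    then show ?thesis by simp
  qed
  finally show ?thesis by simp
qed

definition psd_form :: "(('j \<Rightarrow> real) \<Rightarrow> ('j \<Rightarrow> real) \<Rightarrow> real) \<Rightarrow> bool" where
  "psd_form B \<longleftrightarrow> (\<forall>x y. B x y = B y x) \<and> (\<forall>x y z c. B (\<lambda>j. x j + c * y j) z = B x z + c * B y z) \<and>
     (\<forall>x. 0 \<le> B x x)"

lemma psd_form_add:
  assumes "psd_form B"
  shows "B (\<lambda>j. x j + c * y j) (\<lambda>j. x j + c * y j) = B x x + 2 * c * B x y + c * c * B y y"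
proof -
  have sym: "\<And>x y. B x y = B y x" and lin: "\<And>x y z c. B (\<lambda>j. x j + c * y j) z = B x z + c * B y z"
    using assms by (auto simp: psd_form_def)
  have "B (\<lambda>j. x j + c * y j) (\<lambda>j. x j + c * y j) = B x (\<lambda>j. x j + c * y j) + c * B y (\<lambda>j. x j + c * y j)"
    by (rule lin)
  also have "B x (\<lambda>j. x j + c * y j) = B x x + c * B x y" by (subst sym, subst lin) (simp add: sym)
  also have "B y (\<lambda>j. x j + c * y j) = B x y + c * B y y" by (subst sym, subst lin) (simp add: sym)
  finally show ?thesis by (simp add: algebra_simps)
qed

(* Averaging over the coefficient of w_i replaces the form q by
   min over t of q(y - t w_i) + t^2/8, up to the gain exp(-beta (1-kappa) q(w_i)). *)
lemma lazy_quadratic_le: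
  fixes w :: "'i \<Rightarrow> 'j \<Rightarrow> real"
  assumes "finite I" "psd_form B" "0 \<le> \<beta>" "\<beta> \<le> 1" "\<kappa> \<le> 1/8"
    and "\<And>i. i \<in> I \<Longrightarrow> B (w i) (w i) \<le> \<kappa>"
    and "\<And>i t. i \<in> I \<Longrightarrow> \<rho> i \<le> B (\<lambda>j. w i j + (\<Sum>l\<in>I - {i}. t l * w l j)) (\<lambda>j. w i j + (\<Sum>l\<in>I - {i}. t l * w l j)) +
       (\<Sum>l\<in>I - {i}. (t l)\<^sup>2) / 8"
  shows "lexpect \<beta> I (\<lambda>\<tau>. exp (- B (\<lambda>j. \<Sum>i\<in>I. \<tau> i * w i j) (\<lambda>j. \<Sum>i\<in>I. \<tau> i * w i j))) \<le>
    exp (- \<beta> * (1 - \<kappa>) * (\<Sum>i\<in>I. \<rho> i))" using assms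
proof (induction I arbitrary: B rule: finite_induct)
  case empty
  then show ?case by (auto simp: expect_def psd_form_def)
next
  case (insert i I)
  have sym: "\<And>x y. B x y = B y x" and lin: "\<And>x y z c. B (\<lambda>j. x j + c * y j) z = B x z + c * B y z"
    and pos: "\<And>x. 0 \<le> B x x" using insert.prems(1) by (auto simp: psd_form_def)
  note quad = psd_form_add[OF insert.prems(1)]
  define x where "x = B (w i) (w i)"
  have x: "0 \<le> x" "x \<le> \<kappa>" using pos insert.prems by (auto simp: x_def)
  \<comment> \<open>The form left after minimising over the coefficient of w i with penalty 1/8;
    \<open>B1_min\<close> exhibits the minimiser.\<close>
  define B1 where "B1 y z = B y z - B y (w i) * B z (w i) / (x + 1/8)" for y z
  have B1_min: "B1 y y = B (\<lambda>j. y j + - (B y (w i) / (x + 1/8)) * w i j) (\<lambda>j. y j + - (B y (w i) / (x + 1/8)) * w i j) +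
      (B y (w i) / (x + 1/8))\<^sup>2 / 8" for y
  proof -
    have "B y y + 2 * - (b / v) * b + - (b / v) * - (b / v) * (v - 1/8) + (b / v)\<^sup>2 / 8 = B y y - b * b / v"
      if "v \<noteq> 0" for b v using that by (simp add: field_simps power2_eq_square)
    from this[of "x + 1/8" "B y (w i)"] x show ?thesis unfolding quad B1_def x_def[symmetric] by simp
  qed
  have psd: "psd_form B1" unfolding psd_form_def
  proof (intro conjI allI)
    show "B1 y z = B1 z y" for y z by (simp add: B1_def sym[of y z])
    show "B1 (\<lambda>j. y j + c * y' j) z = B1 y z + c * B1 y' z" for y y' z c
      by (simp add: B1_def lin algebra_simps add_divide_distrib diff_divide_distrib)
    show "0 \<le> B1 y y" for y unfolding B1_min by (intro add_nonneg_nonneg pos) auto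
  qed
  have B1_le: "B1 y y \<le> B y y" for y using x by (simp add: B1_def)
  have IH: "lexpect \<beta> I (\<lambda>\<tau>. exp (- B1 (\<lambda>j. \<Sum>i\<in>I. \<tau> i * w i j) (\<lambda>j. \<Sum>i\<in>I. \<tau> i * w i j))) \<le>
    exp (- \<beta> * (1 - \<kappa>) * (\<Sum>i\<in>I. \<rho> i))"
  proof (rule insert.IH[OF psd insert.prems(2-4)])
    show "B1 (w l) (w l) \<le> \<kappa>" if "l \<in> I" for l using B1_le[of "w l"] insert.prems(5)[of l] that by auto
  next
    fix l t assume l: "l \<in> I"
    define y where "y = (\<lambda>j. w l j + (\<Sum>l\<in>I - {l}. t l * w l j))"
    \<comment> \<open>The minimising coefficient of w i: extending t by u at i turns the hypothesis
      for B into the one for B1.\<close>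
    define u where "u = - (B y (w i) / (x + 1/8))"
    have il: "insert i I - {l} = insert i (I - {l})" "i \<notin> I - {l}" using insert.hyps l by auto
    have "(\<Sum>m\<in>insert i I - {l}. (t(i := u)) m * w m j) = u * w i j + (\<Sum>m\<in>I - {l}. t m * w m j)" for j
    proof -
      have "(\<Sum>m\<in>I - {l}. (t(i := u)) m * w m j) = (\<Sum>m\<in>I - {l}. t m * w m j)" by (rule sum.cong) (use il in auto)
      then show ?thesis using il insert.hyps by simp
    qed
    then have 1: "(\<lambda>j. w l j + (\<Sum>m\<in>insert i I - {l}. (t(i := u)) m * w m j)) = (\<lambda>j. y j + u * w i j)"
      by (simp add: y_def fun_eq_iff)
    have "(\<Sum>m\<in>I - {l}. ((t(i := u)) m)\<^sup>2) = (\<Sum>m\<in>I - {l}. (t m)\<^sup>2)" by (rule sum.cong) (use il in auto)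
    then have 2: "(\<Sum>m\<in>insert i I - {l}. ((t(i := u)) m)\<^sup>2) = u\<^sup>2 + (\<Sum>m\<in>I - {l}. (t m)\<^sup>2)"
      using il insert.hyps by simp
    have "\<rho> l \<le> B (\<lambda>j. y j + u * w i j) (\<lambda>j. y j + u * w i j) + (u\<^sup>2 + (\<Sum>m\<in>I - {l}. (t m)\<^sup>2)) / 8"
      using insert.prems(6)[of l "t(i := u)"] l unfolding 1 2 by simp
    also have "\<dots> = B1 y y + (\<Sum>m\<in>I - {l}. (t m)\<^sup>2) / 8"
      unfolding B1_min u_def[symmetric] by (simp add: u_def add_divide_distrib)
    finally show "\<rho> l \<le> B1 (\<lambda>j. w l j + (\<Sum>l\<in>I - {l}. t l * w l j)) (\<lambda>j. w l j + (\<Sum>l\<in>I - {l}. t l * w l j)) +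
        (\<Sum>l\<in>I - {l}. (t l)\<^sup>2) / 8" unfolding y_def .
  qed
  have law: "law I (\<lambda>_. {-1, 0, 1::real}) (\<lambda>_. lazy \<beta>)" using insert by (intro law_lazy) auto
  define Y where "Y \<tau> = (\<lambda>j. \<Sum>i\<in>I. \<tau> i * w i j)" for \<tau>
  have "lexpect \<beta> (insert i I) (\<lambda>\<tau>. exp (- B (\<lambda>j. \<Sum>i\<in>insert i I. \<tau> i * w i j) (\<lambda>j. \<Sum>i\<in>insert i I. \<tau> i * w i j))) =
     (\<Sum>t\<in>{-1, 0, 1}. lazy \<beta> t * lexpect \<beta> I (\<lambda>\<tau>. exp (- B (\<lambda>j. Y \<tau> j + t * w i j) (\<lambda>j. Y \<tau> j + t * w i j))))"
  proof -
    have "(\<lambda>j. \<Sum>l\<in>insert i I. (\<tau>(i := t)) l * w l j) = (\<lambda>j. Y \<tau> j + t * w i j)" for \<tau> t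
    proof
      fix j
      have "(\<Sum>l\<in>I. (\<tau>(i := t)) l * w l j) = (\<Sum>l\<in>I. \<tau> l * w l j)" by (rule sum.cong) (use insert.hyps in auto)
      then show "(\<Sum>l\<in>insert i I. (\<tau>(i := t)) l * w l j) = Y \<tau> j + t * w i j"
        using insert.hyps by (simp add: Y_def)
    qed
    then show ?thesis by (simp only: expect_insert[OF insert.hyps(2,1)] real_scaleR_def)
  qed
  also have "\<dots> = lexpect \<beta> I (\<lambda>\<tau>. exp (- B (Y \<tau>) (Y \<tau>)) *
      (\<Sum>t\<in>{-1, 0, 1}. lazy \<beta> t * exp (- (t * t * x + 2 * t * B (Y \<tau>) (w i)))))"
  proof -
    have "exp (- B (\<lambda>j. Y \<tau> j + t * w i j) (\<lambda>j. Y \<tau> j + t * w i j)) =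
        exp (- B (Y \<tau>) (Y \<tau>)) * exp (- (t * t * x + 2 * t * B (Y \<tau>) (w i)))" for \<tau> t
      unfolding quad x_def[symmetric] exp_add[symmetric] by (simp add: algebra_simps)
    then show ?thesis by (simp only: expect_mult_left[symmetric] expect_sum[symmetric] sum_distrib_left)
         (simp only: mult.left_commute)
  qed
  also have "\<dots> \<le> lexpect \<beta> I (\<lambda>\<tau>. exp (- B (Y \<tau>) (Y \<tau>)) *
      exp ((B (Y \<tau>) (w i))\<^sup>2 / (x + 1/8) - \<beta> * (1 - \<kappa>) * x))"
    by (intro expect_mono[OF law] mult_left_mono lazy_step x insert.prems) auto
  also have "\<dots> = exp (- \<beta> * (1 - \<kappa>) * x) * lexpect \<beta> I (\<lambda>\<tau>. exp (- B1 (Y \<tau>) (Y \<tau>)))"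
  proof -
    have "exp (- B (Y \<tau>) (Y \<tau>)) * exp ((B (Y \<tau>) (w i))\<^sup>2 / (x + 1/8) - \<beta> * (1 - \<kappa>) * x) =
      exp (- \<beta> * (1 - \<kappa>) * x) * exp (- B1 (Y \<tau>) (Y \<tau>))" for \<tau>
      unfolding B1_def exp_add[symmetric] by (simp add: power2_eq_square)
    then show ?thesis by (simp only: expect_mult_left)
  qed
  also have "\<dots> \<le> exp (- \<beta> * (1 - \<kappa>) * \<rho> i) * exp (- \<beta> * (1 - \<kappa>) * (\<Sum>i\<in>I. \<rho> i))"
  proof (intro mult_mono)
    \<comment> \<open>With all coefficients zero the hypothesis gives \<rho> i \<le> x.\<close>
    have "\<rho> i \<le> B (\<lambda>j. w i j + (\<Sum>l\<in>insert i I - {i}. 0 * w l j)) (\<lambda>j. w i j + (\<Sum>l\<in>insert i I - {i}. 0 * w l j)) +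
       (\<Sum>l\<in>insert i I - {i}. 0\<^sup>2) / 8" by (rule insert.prems(6)) simp
    then have "\<rho> i \<le> x" by (simp add: x_def)
    then have "\<beta> * (1 - \<kappa>) * \<rho> i \<le> \<beta> * (1 - \<kappa>) * x" using insert.prems by (intro mult_left_mono) auto
    then show "exp (- \<beta> * (1 - \<kappa>) * x) \<le> exp (- \<beta> * (1 - \<kappa>) * \<rho> i)" by simp
    show "lexpect \<beta> I (\<lambda>\<tau>. exp (- B1 (Y \<tau>) (Y \<tau>))) \<le> exp (- \<beta> * (1 - \<kappa>) * (\<Sum>i\<in>I. \<rho> i))"
      using IH by (simp only: Y_def)
  qed (auto intro: expect_nonneg[OF law])
  also have "\<dots> = exp (- \<beta> * (1 - \<kappa>) * (\<Sum>i\<in>insert i I. \<rho> i))"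
    using insert.hyps by (simp add: distrib_left flip: exp_add)
  finally show ?case .
qed

section \<open>Rounding of orthonormal matrices\<close>

definition orthonormal :: "nat \<Rightarrow> nat \<Rightarrow> (nat \<Rightarrow> nat \<Rightarrow> real) \<Rightarrow> bool" where
  "orthonormal p k U \<longleftrightarrow> (\<forall>j<k. \<forall>j'<k. (\<Sum>l<p. U l j * U l j') = (if j = j' then 1 else 0))"

abbreviation wnorm :: "nat \<Rightarrow> nat \<Rightarrow> (nat \<Rightarrow> nat \<Rightarrow> real) \<Rightarrow> (nat \<Rightarrow> real) \<Rightarrow> real" where
  "wnorm p k W \<tau> \<equiv> \<Sum>j<k. (\<Sum>l<p. \<tau> l * W l j)\<^sup>2"

abbreviation lattice_mat :: "real \<Rightarrow> (nat \<times> nat \<Rightarrow> int) \<Rightarrow> nat \<Rightarrow> nat \<Rightarrow> real" where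
  "lattice_mat e z \<equiv> \<lambda>l j. e * of_int (z (l, j))"

lemma orthonormal_isometry:
  assumes "orthonormal p k U"
  shows "(\<Sum>l<p. (\<Sum>j<k. U l j * c j)\<^sup>2) = (\<Sum>j<k. (c j)\<^sup>2)"
proof -
  have "(\<Sum>l<p. (\<Sum>j<k. U l j * c j)\<^sup>2) = (\<Sum>l<p. \<Sum>j<k. \<Sum>j'<k. c j * c j' * (U l j * U l j'))"
    by (simp add: power2_eq_square sum_product mult_ac)
  also have "\<dots> = (\<Sum>j<k. \<Sum>l<p. \<Sum>j'<k. c j * c j' * (U l j * U l j'))" by (rule sum.swap)
  also have "\<dots> = (\<Sum>j<k. \<Sum>j'<k. \<Sum>l<p. c j * c j' * (U l j * U l j'))" by (intro sum.cong refl sum.swap)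
  also have "\<dots> = (\<Sum>j<k. \<Sum>j'<k. c j * c j' * (if j = j' then 1 else 0))"
    using assms by (simp add: orthonormal_def flip: sum_distrib_left)
  also have "\<dots> = (\<Sum>j<k. (c j)\<^sup>2)" by (intro sum.cong refl) (simp add: power2_eq_square if_distrib cong: if_cong)
  finally show ?thesis .
qed

lemma orthonormal_bessel:
  assumes "orthonormal p k U"
  shows "(\<Sum>j<k. (\<Sum>l<p. t l * U l j)\<^sup>2) \<le> (\<Sum>l<p. (t l)\<^sup>2)"
proof -
  define c where "c j = (\<Sum>l<p. t l * U l j)" for j
  have cross: "(\<Sum>l<p. t l * (\<Sum>j<k. U l j * c j)) = (\<Sum>j<k. (c j)\<^sup>2)"
  proof -
    have "(\<Sum>l<p. t l * (\<Sum>j<k. U l j * c j)) = (\<Sum>l<p. \<Sum>j<k. c j * (t l * U l j))"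
      by (simp add: sum_distrib_left mult_ac)
    also have "\<dots> = (\<Sum>j<k. \<Sum>l<p. c j * (t l * U l j))" by (rule sum.swap)
    also have "\<dots> = (\<Sum>j<k. (c j)\<^sup>2)" by (simp add: c_def power2_eq_square flip: sum_distrib_left)
    finally show ?thesis .
  qed
  have "0 \<le> (\<Sum>l<p. (t l - (\<Sum>j<k. U l j * c j))\<^sup>2)" by (rule sum_nonneg) simp
  also have "\<dots> = (\<Sum>l<p. (t l)\<^sup>2) + (\<Sum>l<p. (\<Sum>j<k. U l j * c j)\<^sup>2) - 2 * (\<Sum>l<p. t l * (\<Sum>j<k. U l j * c j))"
    by (simp add: power2_diff sum.distrib sum_subtractf sum_distrib_left mult.assoc)
  also have "\<dots> = (\<Sum>l<p. (t l)\<^sup>2) - (\<Sum>j<k. (c j)\<^sup>2)" unfolding cross orthonormal_isometry[OF assms] by simp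
  finally show ?thesis by (simp add: c_def)
qed

lemma orthonormal_row_le:
  assumes "orthonormal p k U" "l < p"
  shows "(\<Sum>j<k. (U l j)\<^sup>2) \<le> 1"
  using orthonormal_bessel[OF assms(1), of "\<lambda>i. if i = l then 1 else 0"] assms(2)
  by (simp add: if_distrib[of "\<lambda>x. x * _"] if_distrib[of "\<lambda>x. x\<^sup>2"] cong: if_cong)

lemma orthonormal_sum_squares:
  assumes "orthonormal p k U"
  shows "(\<Sum>l<p. \<Sum>j<k. (U l j)\<^sup>2) = k"
proof -
  have "(\<Sum>l<p. \<Sum>j<k. (U l j)\<^sup>2) = (\<Sum>j<k. \<Sum>l<p. U l j * U l j)" by (subst sum.swap) (simp add: power2_eq_square)
  then show ?thesis using assms by (simp add: orthonormal_def)
qed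

text \<open>When p exceeds k, a row of U may well be a combination of the other rows, so an
  unpenalised distance could vanish. The penalty prevents this: by Bessel, a combination y of rows
  costs at least |y|^2 / 8, and minimising \<theta> |U_i + y|^2 + |y|^2 / 8 leaves \<theta> / (1 + 8
  \<theta>) |U_i|^2. The squared row lengths add up to k.\<close>

lemma orthonormal_small_ball:
  assumes orth: "orthonormal p k U" and "0 \<le> \<theta>" "\<theta> \<le> 1/8" "0 \<le> \<beta>" "\<beta> \<le> 1"
  shows "lexpect \<beta> {..<p} (\<lambda>\<tau>. exp (- \<theta> * wnorm p k U \<tau>)) \<le>
    exp (- \<beta> * (1 - \<theta>) * (\<theta> / (1 + 8 * \<theta>) * k))"
proof -
  define B where "B x y = \<theta> * (\<Sum>j<k. x j * y j)" for x y :: "nat \<Rightarrow> real"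
  define \<rho> where "\<rho> l = \<theta> / (1 + 8 * \<theta>) * (\<Sum>j<k. (U l j)\<^sup>2)" for l
  have "psd_form B" unfolding psd_form_def
  proof (intro conjI allI)
    show "0 \<le> B x x" for x unfolding B_def by (intro mult_nonneg_nonneg[OF assms(2)] sum_nonneg) simp
  qed (auto simp: B_def sum_distrib_left sum.distrib distrib_right distrib_left mult_ac)
  moreover have "B (U l) (U l) \<le> \<theta>" if "l \<in> {..<p}" for l
    using mult_left_mono[OF orthonormal_row_le[OF orth], of l \<theta>] that assms
    by (simp add: B_def power2_eq_square)
  moreover have "\<rho> i \<le> B (\<lambda>j. U i j + (\<Sum>l\<in>{..<p} - {i}. t l * U l j)) (\<lambda>j. U i j + (\<Sum>l\<in>{..<p} - {i}. t l * U l j)) +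
       (\<Sum>l\<in>{..<p} - {i}. (t l)\<^sup>2) / 8" if i: "i \<in> {..<p}" for i t
  proof -
    define y where "y j = (\<Sum>l\<in>{..<p} - {i}. t l * U l j)" for j
    \<comment> \<open>The minimum over b is attained where 8 \<theta> (a + b) + b = 0; the square
      below is this expression.\<close>
    have point: "\<theta> / (1 + 8 * \<theta>) * a\<^sup>2 \<le> \<theta> * (a + b)\<^sup>2 + b\<^sup>2 / 8" for a b :: real
    proof -
      have "0 \<le> (8 * \<theta> * (a + b) + b)\<^sup>2 / 8" by simp
      then have "\<theta> * a\<^sup>2 \<le> (1 + 8 * \<theta>) * (\<theta> * (a + b)\<^sup>2 + b\<^sup>2 / 8)"
        by (simp add: power2_eq_square algebra_simps add_divide_distrib)
      then show ?thesis using assms(2) by (simp add: field_simps)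
    qed
    have "\<rho> i \<le> (\<Sum>j<k. \<theta> * (U i j + y j)\<^sup>2 + (y j)\<^sup>2 / 8)"
      unfolding \<rho>_def sum_distrib_left by (intro sum_mono point)
    also have "\<dots> = B (\<lambda>j. U i j + y j) (\<lambda>j. U i j + y j) + (\<Sum>j<k. (y j)\<^sup>2) / 8"
      by (simp add: B_def sum.distrib sum_distrib_left power2_eq_square flip: sum_divide_distrib)
    also have "(\<Sum>j<k. (y j)\<^sup>2) \<le> (\<Sum>l\<in>{..<p} - {i}. (t l)\<^sup>2)"
    proof -
      have 1: "y j = (\<Sum>l<p. (if l = i then 0 else t l) * U l j)" for j
        unfolding y_def by (rule sum.mono_neutral_cong_left) auto
      have 2: "(\<Sum>l\<in>{..<p} - {i}. (t l)\<^sup>2) = (\<Sum>l<p. (if l = i then 0 else t l)\<^sup>2)"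
        by (rule sum.mono_neutral_cong_left) auto
      show ?thesis unfolding 1 2 by (rule orthonormal_bessel[OF orth])
    qed
    finally show ?thesis unfolding y_def by simp
  qed
  ultimately have "lexpect \<beta> {..<p} (\<lambda>\<tau>. exp (- B (\<lambda>j. \<Sum>i\<in>{..<p}. \<tau> i * U i j) (\<lambda>j. \<Sum>i\<in>{..<p}. \<tau> i * U i j))) \<le>
    exp (- \<beta> * (1 - \<theta>) * (\<Sum>i\<in>{..<p}. \<rho> i))" by (intro lazy_quadratic_le) (use assms in auto)
  also have "(\<Sum>i\<in>{..<p}. \<rho> i) = \<theta> / (1 + 8 * \<theta>) * k"
    unfolding \<rho>_def by (simp only: orthonormal_sum_squares[OF orth] flip: sum_distrib_left)
  finally show ?thesis by (simp add: B_def power2_eq_square)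
qed

lemma expect_square_le:
  fixes g :: "'i \<Rightarrow> 'b \<Rightarrow> real"
  assumes "finite I" "law I S q"
    and "\<And>i. i \<in> I \<Longrightarrow> (\<Sum>y\<in>S i. q i y * g i y) = 0"
    and "\<And>i y. i \<in> I \<Longrightarrow> y \<in> S i \<Longrightarrow> \<bar>g i y\<bar> \<le> b i"
  shows "expect I S q (\<lambda>x. (s + (\<Sum>i\<in>I. g i (x i)))\<^sup>2) \<le> s\<^sup>2 + (\<Sum>i\<in>I. (b i)\<^sup>2)"
  using assms
proof (induction I arbitrary: s rule: finite_induct)
  case empty
  then show ?case by (simp add: expect_def)
next
  case (insert i I)
  have law: "law I S q" using insert.prems(1) by (rule law_subset) auto
  have "(\<Sum>j\<in>insert i I. g j ((x(i := y)) j)) = g i y + (\<Sum>j\<in>I. g j (x j))" for x y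
  proof -
    have "(\<Sum>j\<in>I. g j ((x(i := y)) j)) = (\<Sum>j\<in>I. g j (x j))" by (rule sum.cong) (use insert.hyps in auto)
    then show ?thesis using insert.hyps by simp
  qed
  then have "expect (insert i I) S q (\<lambda>x. (s + (\<Sum>i\<in>insert i I. g i (x i)))\<^sup>2) =
     (\<Sum>y\<in>S i. q i y * expect I S q (\<lambda>x. ((s + g i y) + (\<Sum>i\<in>I. g i (x i)))\<^sup>2))"
    by (simp only: expect_insert[OF insert.hyps(2,1)] real_scaleR_def add.assoc)
  also have "\<dots> \<le> (\<Sum>y\<in>S i. q i y * ((s + g i y)\<^sup>2 + (\<Sum>i\<in>I. (b i)\<^sup>2)))"
    using insert.prems by (intro sum_mono mult_left_mono insert.IH law) (auto intro: law_nonneg)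
  also have "\<dots> \<le> (\<Sum>y\<in>S i. q i y * (s\<^sup>2 + (b i)\<^sup>2 + (\<Sum>i\<in>I. (b i)\<^sup>2)) + 2 * s * (q i y * g i y))"
  proof (intro sum_mono)
    fix y assume y: "y \<in> S i"
    have "(g i y)\<^sup>2 \<le> (b i)\<^sup>2"
      using insert.prems(3)[of i y] y by (metis abs_ge_zero insertI1 power2_abs power_mono)
    moreover have "0 \<le> q i y" using insert.prems(1) y by (auto intro: law_nonneg)
    ultimately have "q i y * (g i y)\<^sup>2 \<le> q i y * (b i)\<^sup>2" by (rule mult_left_mono)
    then show "q i y * ((s + g i y)\<^sup>2 + (\<Sum>i\<in>I. (b i)\<^sup>2)) \<le>
       q i y * (s\<^sup>2 + (b i)\<^sup>2 + (\<Sum>i\<in>I. (b i)\<^sup>2)) + 2 * s * (q i y * g i y)"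
      by (simp add: power2_sum algebra_simps)
  qed
  also have "\<dots> = (\<Sum>y\<in>S i. q i y) * (s\<^sup>2 + (b i)\<^sup>2 + (\<Sum>i\<in>I. (b i)\<^sup>2)) + 2 * s * (\<Sum>y\<in>S i. q i y * g i y)"
    by (simp only: sum.distrib sum_distrib_left sum_distrib_right)
  also have "\<dots> = s\<^sup>2 + (b i)\<^sup>2 + (\<Sum>i\<in>I. (b i)\<^sup>2)" using insert.prems by (simp add: law_sum)
  finally show ?case using insert.hyps by (simp add: add.assoc)
qed

text \<open>Independent rounding of the entries of \<open>U\<close> to neighbouring points of \<open>e\<int>\<close>, with mean \<open>U\<close>.\<close>

definition round_set :: "real \<Rightarrow> (nat \<Rightarrow> nat \<Rightarrow> real) \<Rightarrow> nat \<times> nat \<Rightarrow> int set" where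
  "round_set e U = (\<lambda>(l, j). {\<lfloor>U l j / e\<rfloor>, \<lfloor>U l j / e\<rfloor> + 1})"

definition round_weight :: "real \<Rightarrow> (nat \<Rightarrow> nat \<Rightarrow> real) \<Rightarrow> nat \<times> nat \<Rightarrow> int \<Rightarrow> real" where
  "round_weight e U = (\<lambda>(l, j) y. if y = \<lfloor>U l j / e\<rfloor> then 1 - frac (U l j / e) else frac (U l j / e))"

lemma law_round: "finite I \<Longrightarrow> law I (round_set e U) (round_weight e U)"
  by (auto simp: law_def round_set_def round_weight_def frac_ge_0 less_imp_le[OF frac_lt_1])

lemma round_mean:
  assumes "e \<noteq> 0"
  shows "(\<Sum>y\<in>round_set e U (l, j). round_weight e U (l, j) y * (e * of_int y - U l j)) = 0"
proof -
  define u where "u = U l j / e"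
  have U: "U l j = e * u" using assms by (simp add: u_def)
  have "(\<Sum>y\<in>round_set e U (l, j). round_weight e U (l, j) y * (e * of_int y - U l j)) =
     (1 - frac u) * (e * of_int \<lfloor>u\<rfloor> - e * u) + frac u * (e * (of_int \<lfloor>u\<rfloor> + 1) - e * u)"
    by (simp add: round_set_def round_weight_def u_def[symmetric] U)
  also have "\<dots> = 0" by (simp add: frac_def algebra_simps)
  finally show ?thesis .
qed

lemma round_error:
  assumes "0 < e" "y \<in> round_set e U (l, j)"
  shows "\<bar>e * of_int y - U l j\<bar> \<le> e"
proof -
  define u where "u = U l j / e"
  have U: "U l j = e * u" using assms by (simp add: u_def)
  have "\<bar>of_int y - u\<bar> \<le> 1" using assms(2) by (auto simp: round_set_def u_def[symmetric]) linarith+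
  then have "e * \<bar>of_int y - u\<bar> \<le> e * 1" using assms by (intro mult_left_mono) auto
  moreover have "\<bar>e * of_int y - U l j\<bar> = e * \<bar>of_int y - u\<bar>"
    unfolding U using assms by (simp add: abs_mult flip: right_diff_distrib)
  ultimately show ?thesis by simp
qed

section \<open>Moments of rounding errors and the quality of a random rounding\<close>

abbreviation cexpect :: "nat \<Rightarrow> real \<Rightarrow> (nat \<Rightarrow> nat \<Rightarrow> real) \<Rightarrow> nat \<Rightarrow> ((nat \<Rightarrow> int) \<Rightarrow> real) \<Rightarrow> real" where
  "cexpect p e U j \<equiv> expect {..<p} (\<lambda>l. round_set e U (l, j)) (\<lambda>l. round_weight e U (l, j))"

lemma round_exp_column:
  assumes "0 < e" "0 \<le> c" "24 * c * (e\<^sup>2 * (\<Sum>l<p. (t l)\<^sup>2)) \<le> 1"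
  shows "cexpect p e U j
      (\<lambda>x. exp (c * (\<Sum>l<p. (e * of_int (x l) - U l j) * t l)\<^sup>2)) \<le> exp (2 * c * (e\<^sup>2 * (\<Sum>l<p. (t l)\<^sup>2)))"
proof -
  have law: "law {..<p} (\<lambda>l. round_set e U (l, j)) (\<lambda>l. round_weight e U (l, j))"
    using law_round[of "{..<p} \<times> {j}" e U] by (simp add: law_def)
  have b: "(\<Sum>l<p. (e * \<bar>t l\<bar>)\<^sup>2) = e\<^sup>2 * (\<Sum>l<p. (t l)\<^sup>2)" by (simp add: power_mult_distrib sum_distrib_left)
  have "cexpect p e U j
      (\<lambda>x. exp (c * (\<Sum>l<p. (\<lambda>l y. (e * of_int y - U l j) * t l) l (x l))\<^sup>2)) \<le> exp (2 * c * (\<Sum>l<p. (e * \<bar>t l\<bar>)\<^sup>2))"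
  proof (rule expect_exp_square[OF law assms(2)])
    show "(\<Sum>y\<in>round_set e U (l, j). round_weight e U (l, j) y * ((e * of_int y - U l j) * t l)) = 0" for l
      using round_mean[of e U l j] assms(1) by (simp add: mult.assoc[symmetric] flip: sum_distrib_right)
    show "\<bar>(e * of_int y - U l j) * t l\<bar> \<le> e * \<bar>t l\<bar>" if "y \<in> round_set e U (l, j)" for l y
      unfolding abs_mult by (intro mult_right_mono round_error that assms) auto
  qed (use assms(3) b in simp)
  then show ?thesis by (simp add: b)
qed

abbreviation rowexpect :: "nat \<Rightarrow> real \<Rightarrow> (nat \<Rightarrow> nat \<Rightarrow> real) \<Rightarrow> nat \<Rightarrow> ((nat \<Rightarrow> int) \<Rightarrow> real) \<Rightarrow> real" where
  "rowexpect k e U l \<equiv> expect {..<k} (\<lambda>j. round_set e U (l, j)) (\<lambda>j. round_weight e U (l, j))"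

text \<open>The rounding law of an entry depends only on its value, so rows of U are columns of the
  transposed matrix.\<close>

lemma round_exp_row:
  assumes "0 < e" "0 \<le> c" "24 * c * (e\<^sup>2 * (\<Sum>j<k. (t j)\<^sup>2)) \<le> 1"
  shows "rowexpect k e U l
      (\<lambda>x. exp (c * (\<Sum>j<k. (e * of_int (x j) - U l j) * t j)\<^sup>2)) \<le> exp (2 * c * (e\<^sup>2 * (\<Sum>j<k. (t j)\<^sup>2)))"
  using round_exp_column[OF assms, of "\<lambda>a b. U b a" l] by (simp add: round_set_def round_weight_def)

lemma round_square:
  fixes H :: "nat \<Rightarrow> real"
  assumes "0 < e" "j < k" "\<And>l. l < p \<Longrightarrow> \<bar>H l\<bar> \<le> 1"
  shows "expect ({..<p} \<times> {..<k}) (round_set e U) (round_weight e U)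
    (\<lambda>z. (\<Sum>l<p. H l * (e * of_int (z (l, j)) - U l j))\<^sup>2) \<le> p * e\<^sup>2"
proof -
  \<comment> \<open>The summands vanish outside column j, which presents the column sum as a sum
    over all independent entries.\<close>
  define g where "g = (\<lambda>(l, j') y. if j' = j then H l * (e * of_int y - U l j) else 0 :: real)"
  define b where "b = (\<lambda>(l :: nat, j'). if j' = j then e else 0)"
  have law: "law ({..<p} \<times> {..<k}) (round_set e U) (round_weight e U)" by (rule law_round) simp
  have 1: "(\<Sum>i\<in>{..<p} \<times> {..<k}. g i (z i)) = (\<Sum>l<p. H l * (e * of_int (z (l, j)) - U l j))" for z
  proof -
    have "(\<Sum>i\<in>{..<p} \<times> {..<k}. g i (z i)) = (\<Sum>l<p. \<Sum>j'<k. g (l, j') (z (l, j')))"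
      by (simp add: sum.cartesian_product case_prod_beta)
    also have "\<dots> = (\<Sum>l<p. H l * (e * of_int (z (l, j)) - U l j))" using assms(2) by (simp add: g_def)
    finally show ?thesis .
  qed
  have 2: "(\<Sum>i\<in>{..<p} \<times> {..<k}. (b i)\<^sup>2) = p * e\<^sup>2"
  proof -
    have "(\<Sum>i\<in>{..<p} \<times> {..<k}. (b i)\<^sup>2) = (\<Sum>l<p. \<Sum>j'<k. (b (l, j'))\<^sup>2)"
      by (simp add: sum.cartesian_product case_prod_beta)
    also have "\<dots> = p * e\<^sup>2" using assms(2) by (simp add: b_def if_distrib[of "\<lambda>x. x\<^sup>2"] cong: if_cong)
    finally show ?thesis .
  qed
  have "expect ({..<p} \<times> {..<k}) (round_set e U) (round_weight e U)
      (\<lambda>z. (0 + (\<Sum>i\<in>{..<p} \<times> {..<k}. g i (z i)))\<^sup>2) \<le> 0\<^sup>2 + (\<Sum>i\<in>{..<p} \<times> {..<k}. (b i)\<^sup>2)"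
  proof (rule expect_square_le[OF _ law])
    fix i assume "i \<in> {..<p} \<times> {..<k}"
    then obtain l j' where i: "i = (l, j')" "l < p" by auto
    show "(\<Sum>y\<in>round_set e U i. round_weight e U i y * g i y) = 0"
    proof (cases "j' = j")
      case True
      have "(\<Sum>y\<in>round_set e U i. round_weight e U i y * g i y) =
          H l * (\<Sum>y\<in>round_set e U (l, j). round_weight e U (l, j) y * (e * of_int y - U l j))"
        unfolding sum_distrib_left i True by (rule sum.cong) (auto simp: g_def)
      then show ?thesis using round_mean[of e U l j] assms(1) by simp
    qed (simp add: g_def i)
    fix y assume y: "y \<in> round_set e U i"
    show "\<bar>g i y\<bar> \<le> b i"
    proof (cases "j' = j")
      case True
      have "\<bar>H l\<bar> * \<bar>e * of_int y - U l j\<bar> \<le> 1 * e" using y i True assms by (intro mult_mono round_error) auto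
      then show ?thesis using True by (simp add: g_def b_def i abs_mult)
    qed (simp add: g_def b_def i)
  qed simp
  then show ?thesis by (simp add: 1 2)
qed

text \<open>The exponential moment from \<open>diff_char_le\<close> for the matrix a W with each
  column split into L copies divided by sqrt L: index (j, i) is copy i of column j.\<close>

definition gauss_energy :: "nat \<Rightarrow> nat \<Rightarrow> nat \<Rightarrow> real \<Rightarrow> real \<Rightarrow> (nat \<Rightarrow> nat \<Rightarrow> real) \<Rightarrow> real" where
  "gauss_energy p k L a D W = lexpect (1/4) ({..<k} \<times> {..<L}) (\<lambda>h.
     exp (3/2 * min (\<Sum>l<p. (\<Sum>i\<in>{..<k} \<times> {..<L}. a * W l (fst i) / sqrt L * h i)\<^sup>2) D))"

text \<open>The first factor is the cost of rounding with q = p e^2; the second is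
  \<open>orthonormal_small_ball\<close> at \<theta> = 2 a^2 and \<beta> = 3/32.\<close>

abbreviation ball_rate :: "real \<Rightarrow> real \<Rightarrow> nat \<Rightarrow> real" where
  "ball_rate a q k \<equiv> exp (8 * a\<^sup>2 * q * k) *
     exp (- (3/32) * (1 - 2 * a\<^sup>2) * (2 * a\<^sup>2 / (1 + 8 * (2 * a\<^sup>2)) * k))"

text \<open>A Gaussian majorant of \<open>diff_char\<close> at 0: squaring the bound exp (- 2 x^2)
  for \<open>lchar (1/4)\<close> gives the factor 4, and 3/32 is the parameter of
  \<open>diff_char\<close>.\<close>

definition small_ball :: "nat \<Rightarrow> nat \<Rightarrow> real \<Rightarrow> (nat \<Rightarrow> nat \<Rightarrow> real) \<Rightarrow> real" where
  "small_ball p k a W = lexpect (3/32) {..<p} (\<lambda>\<tau>. exp (- 4 * a\<^sup>2 * wnorm p k W \<tau>))"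

abbreviation rexpect :: "nat \<Rightarrow> nat \<Rightarrow> real \<Rightarrow> (nat \<Rightarrow> nat \<Rightarrow> real) \<Rightarrow> ((nat \<times> nat \<Rightarrow> int) \<Rightarrow> real) \<Rightarrow> real" where
  "rexpect p k e U \<equiv> expect ({..<p} \<times> {..<k}) (round_set e U) (round_weight e U)"

lemma rounding_energy_fixed:
  fixes \<eta> :: "nat \<Rightarrow> real"
  assumes orth: "orthonormal p k U" and "0 < e" "0 < a" "6 * (p * e\<^sup>2) \<le> 1" "0 \<le> D" "27 * (e\<^sup>2 * D) \<le> 1"
  shows "rexpect p k e U (\<lambda>z. exp (3/2 * min (a\<^sup>2 * (\<Sum>l<p. (\<Sum>j<k. e * of_int (z (l, j)) * \<eta> j)\<^sup>2)) D)) \<le>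
    exp (4 * a\<^sup>2 * (\<Sum>j<k. (\<eta> j)\<^sup>2))"
proof -
  let ?w = "\<lambda>z l. \<Sum>j<k. e * of_int (z (l, j)) * \<eta> j"
    and ?r = "\<lambda>z l. \<Sum>j<k. (e * of_int (z (l, j)) - U l j) * \<eta> j"
    and ?x = "\<lambda>l x. \<Sum>j<k. (e * of_int (x j) - U l j) * \<eta> j"
  let ?E = "\<lambda>z. a\<^sup>2 * (\<Sum>l<p. (?w z l)\<^sup>2)"
  define s where "s = (\<Sum>j<k. (\<eta> j)\<^sup>2)"
  have s0: "0 \<le> s" by (auto simp: s_def intro: sum_nonneg)
  have law: "law ({..<p} \<times> {..<k}) (round_set e U) (round_weight e U)" by (rule law_round) simp
  show ?thesis
  proof (cases "24 * (3 * a\<^sup>2) * (e\<^sup>2 * s) \<le> 1")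
    case True
    have "rexpect p k e U (\<lambda>z. exp (3/2 * min (?E z) D)) \<le>
      rexpect p k e U (\<lambda>z. exp (3 * a\<^sup>2 * s) * (\<Prod>l<p. exp (3 * a\<^sup>2 * (?r z l)\<^sup>2)))"
    proof (rule expect_mono[OF law])
      fix z :: "nat \<times> nat \<Rightarrow> int"
      have "(\<Sum>l<p. (?w z l)\<^sup>2) \<le>
        (\<Sum>l<p. 2 * (\<Sum>j<k. U l j * \<eta> j)\<^sup>2 + 2 * (?r z l)\<^sup>2)"
      proof (rule sum_mono)
        fix l
        have "?w z l =
          (\<Sum>j<k. U l j * \<eta> j) + ?r z l" by (simp add: left_diff_distrib sum_subtractf)
        moreover have "(x + y)\<^sup>2 \<le> 2 * x\<^sup>2 + 2 * y\<^sup>2" for x y :: real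
          using zero_le_power2[of "x - y"] by (simp add: power2_eq_square algebra_simps)
        ultimately show "(?w z l)\<^sup>2 \<le>
          2 * (\<Sum>j<k. U l j * \<eta> j)\<^sup>2 + 2 * (?r z l)\<^sup>2" by simp
      qed
      also have "\<dots> = 2 * s + 2 * (\<Sum>l<p. (?r z l)\<^sup>2)"
        by (simp add: sum.distrib orthonormal_isometry[OF orth] s_def flip: sum_distrib_left)
      finally have "?E z \<le>
          a\<^sup>2 * (2 * s + 2 * (\<Sum>l<p. (?r z l)\<^sup>2))" by (rule mult_left_mono) simp
      then have "3/2 * min (?E z) D \<le>
         3/2 * (a\<^sup>2 * (2 * s + 2 * (\<Sum>l<p. (?r z l)\<^sup>2)))" by (intro mult_left_mono) auto
      also have "\<dots> = 3 * a\<^sup>2 * s + (\<Sum>l<p. 3 * a\<^sup>2 * (?r z l)\<^sup>2)" by (simp add: sum_distrib_left algebra_simps)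
      finally show "exp (3/2 * min (?E z) D) \<le>
        exp (3 * a\<^sup>2 * s) * (\<Prod>l<p. exp (3 * a\<^sup>2 * (?r z l)\<^sup>2))"
        by (simp only: exp_sum[symmetric] exp_add[symmetric] exp_le_cancel_iff finite_lessThan)
    qed
    also have "\<dots> = exp (3 * a\<^sup>2 * s) * (\<Prod>l<p. rowexpect k e U l
        (\<lambda>x. exp (3 * a\<^sup>2 * (?x l x)\<^sup>2)))" unfolding expect_mult_left
      by (subst expect_rows[OF law, where f = "\<lambda>l x. exp (3 * a\<^sup>2 * (?x l x)\<^sup>2)"])
         auto
    also have "\<dots> \<le> exp (3 * a\<^sup>2 * s) * (\<Prod>l<p. exp (2 * (3 * a\<^sup>2) * (e\<^sup>2 * s)))"
    proof (intro mult_left_mono prod_mono conjI)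
      fix l
      show "rowexpect k e U l
        (\<lambda>x. exp (3 * a\<^sup>2 * (?x l x)\<^sup>2)) \<le> exp (2 * (3 * a\<^sup>2) * (e\<^sup>2 * s))"
        using round_exp_row[of e "3 * a\<^sup>2" \<eta> k U l] True assms(2) by (simp add: s_def)
      assume "l \<in> {..<p}"
      then have "law {..<k} (\<lambda>j. round_set e U (l, j)) (\<lambda>j. round_weight e U (l, j))"
        by (rule law_rows[OF law]) simp
      then show "0 \<le> rowexpect k e U l
        (\<lambda>x. exp (3 * a\<^sup>2 * (?x l x)\<^sup>2))" by (rule expect_nonneg) simp
    qed auto
    also have "\<dots> = exp (a\<^sup>2 * s * (3 + 6 * (p * e\<^sup>2)))"
      by (simp add: algebra_simps flip: exp_of_nat_mult exp_add)
    also have "\<dots> \<le> exp (a\<^sup>2 * s * 4)" using assms(4) s0 by (simp add: mult_left_mono)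
    finally show ?thesis by (simp add: s_def mult_ac)
  next
    case False
    have "3/2 * D \<le> 4 * a\<^sup>2 * s"
    proof -
      have "1 < 72 * (a\<^sup>2 * (e\<^sup>2 * s))" using False by (simp add: not_le mult.assoc)
      then have "27 * (e\<^sup>2 * D) < 72 * (a\<^sup>2 * (e\<^sup>2 * s))" using assms(6) by linarith
      then have "e\<^sup>2 * (27 * D) < e\<^sup>2 * (72 * (a\<^sup>2 * s))" by (simp add: mult_ac)
      then have "27 * D < 72 * (a\<^sup>2 * s)" using assms(2) by (simp add: mult_less_cancel_left)
      then show ?thesis by (simp add: mult_ac)
    qed
    then have "3/2 * min x D \<le> 4 * a\<^sup>2 * s" for x by (simp add: min_def)
    then show ?thesis unfolding s_def[symmetric] by (intro expect_le[OF law]) simp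
  qed
qed

text \<open>The normalised sum has the square-exponential moments of a Gaussian of bounded variance,
  uniformly in L.\<close>

lemma lazy_scaled_square_le:
  fixes L :: nat
  assumes "0 < L" "0 \<le> c" "24 * c \<le> 1"
  shows "lexpect (1/4) {..<L} (\<lambda>x. exp (c * (\<Sum>i<L. x i / sqrt L)\<^sup>2)) \<le> exp (2 * c)"
proof -
  have law: "law {..<L} (\<lambda>_. {-1, 0, 1::real}) (\<lambda>_. lazy (1/4))" by (rule law_lazy) auto
  have b: "(\<Sum>i<L. (1 / sqrt L)\<^sup>2) = 1" using assms(1) by (simp add: power_divide)
  have "lexpect (1/4) {..<L} (\<lambda>x. exp (c * (\<Sum>i<L. (\<lambda>i y. y / sqrt L) i (x i))\<^sup>2)) \<le>
      exp (2 * c * (\<Sum>i<L. (1 / sqrt L)\<^sup>2))"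
  proof (rule expect_exp_square[OF law assms(2)])
    show "24 * c * (\<Sum>i<L. (1 / sqrt L)\<^sup>2) \<le> 1" unfolding b using assms by simp
    show "(\<Sum>y\<in>{-1, 0, 1}. lazy (1/4) y * (y / sqrt L)) = 0" for i :: nat by (simp add: lazy_def)
    show "\<bar>y / sqrt L\<bar> \<le> 1 / sqrt L" if "y \<in> {-1, 0, 1}" for i :: nat and y using that by auto
  qed
  then show ?thesis unfolding b by simp
qed

text \<open>Averaging over the rounding first reduces to a fixed direction, whose coordinates are
  the normalised sums of the L signs of each column. The condition 96 a^2 \<le> 1 is the range of
  \<open>lazy_scaled_square_le\<close> at c = 4 a^2.\<close>

lemma rounding_energy:
  fixes e D :: real
  assumes orth: "orthonormal p k U" and eps: "0 < e" "6 * (p * e\<^sup>2) \<le> 1" "27 * (e\<^sup>2 * D) \<le> 1"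
    and "0 < a" "96 * a\<^sup>2 \<le> 1" "0 \<le> D" "0 < L"
  shows "rexpect p k e U (\<lambda>z. gauss_energy p k L a D (lattice_mat e z)) \<le> exp (8 * a\<^sup>2 * k)"
proof -
  let ?J = "{..<k} \<times> {..<L}"
  have law: "law ?J (\<lambda>_. {-1, 0, 1::real}) (\<lambda>_. lazy (1/4))" by (rule law_lazy) auto
  have eq: "(\<Sum>l<p. (\<Sum>i\<in>?J. a * (e * of_int (z (l, fst i))) / sqrt L * h i)\<^sup>2) =
      a\<^sup>2 * (\<Sum>l<p. (\<Sum>j<k. e * of_int (z (l, j)) * (\<Sum>i<L. h (j, i) / sqrt L))\<^sup>2)" for z :: "nat \<times> nat \<Rightarrow> int" and h
  proof -
    have inner: "(\<Sum>i\<in>?J. a * (e * of_int (z (l, fst i))) / sqrt L * h i) =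
        a * (\<Sum>j<k. e * of_int (z (l, j)) * (\<Sum>i<L. h (j, i) / sqrt L))" for l
    proof -
      have "(\<Sum>i\<in>?J. a * (e * of_int (z (l, fst i))) / sqrt L * h i) =
          (\<Sum>j<k. \<Sum>i<L. a * (e * of_int (z (l, j))) / sqrt L * h (j, i))"
        by (simp add: sum.cartesian_product case_prod_beta)
      then show ?thesis by (simp add: sum_distrib_left mult_ac)
    qed
    show ?thesis unfolding inner power_mult_distrib by (rule sum_distrib_left[symmetric])
  qed
  have "rexpect p k e U (\<lambda>z. gauss_energy p k L a D (lattice_mat e z)) =
    lexpect (1/4) ?J (\<lambda>h. rexpect p k e U (\<lambda>z.
      exp (3/2 * min (a\<^sup>2 * (\<Sum>l<p. (\<Sum>j<k. e * of_int (z (l, j)) * (\<Sum>i<L. h (j, i) / sqrt L))\<^sup>2)) D)))"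
    unfolding gauss_energy_def eq by (rule expect_swap)
  also have "\<dots> \<le> lexpect (1/4) ?J (\<lambda>h. exp (4 * a\<^sup>2 * (\<Sum>j<k. (\<Sum>i<L. h (j, i) / sqrt L)\<^sup>2)))"
    by (intro expect_mono[OF law] rounding_energy_fixed) (use assms in auto)
  also have "\<dots> = lexpect (1/4) ?J (\<lambda>h. \<Prod>j<k. exp (4 * a\<^sup>2 * (\<Sum>i<L. h (j, i) / sqrt L)\<^sup>2))"
    by (simp add: sum_distrib_left exp_sum)
  also have "\<dots> = (\<Prod>j<k. lexpect (1/4) {..<L} (\<lambda>x. exp (4 * a\<^sup>2 * (\<Sum>i<L. x i / sqrt L)\<^sup>2)))"
    by (subst expect_rows[OF law, where f = "\<lambda>j x. exp (4 * a\<^sup>2 * (\<Sum>i<L. x i / sqrt L)\<^sup>2)"]) auto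
  also have "\<dots> \<le> (\<Prod>j<k. exp (2 * (4 * a\<^sup>2)))"
  proof (intro prod_mono conjI)
    fix j
    show "lexpect (1/4) {..<L} (\<lambda>x. exp (4 * a\<^sup>2 * (\<Sum>i<L. x i / sqrt L)\<^sup>2)) \<le> exp (2 * (4 * a\<^sup>2))"
      by (rule lazy_scaled_square_le) (use assms in auto)
    show "0 \<le> lexpect (1/4) {..<L} (\<lambda>x. exp (4 * a\<^sup>2 * (\<Sum>i<L. x i / sqrt L)\<^sup>2))"
      by (rule expect_nonneg[OF law_lazy]) auto
  qed
  also have "\<dots> = exp (8 * a\<^sup>2 * k)" by (simp add: mult_ac flip: exp_of_nat_mult)
  finally show ?thesis .
qed

text \<open>For fixed \<tau> the rounding errors of different columns are independent. Giving up
  half of the exponent, - 4 a^2 (x + y)^2 \<le> - 2 a^2 x^2 + 4 a^2 y^2, separates the orthonormal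
  part x from the error y; this is the origin of \<theta> = 2 a^2.\<close>

lemma rounding_small_ball:
  fixes e :: real
  assumes orth: "orthonormal p k U" and eps: "0 < e" "p * e\<^sup>2 \<le> 1" and "0 < a" "96 * a\<^sup>2 \<le> 1"
  shows "rexpect p k e U (\<lambda>z. small_ball p k a (lattice_mat e z)) \<le>
    ball_rate a (p * e\<^sup>2) k"
proof -
  have lawz: "law ({..<p} \<times> {..<k}) (round_set e U) (round_weight e U)" by (rule law_round) simp
  have law: "law {..<p} (\<lambda>_. {-1, 0, 1::real}) (\<lambda>_. lazy (3/32))" by (rule law_lazy) auto
  have "rexpect p k e U (\<lambda>z. small_ball p k a (lattice_mat e z)) =
    lexpect (3/32) {..<p} (\<lambda>\<tau>. rexpect p k e U (\<lambda>z.
      exp (- 4 * a\<^sup>2 * wnorm p k (lattice_mat e z) \<tau>)))" unfolding small_ball_def by (rule expect_swap)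
  also have "\<dots> \<le> lexpect (3/32) {..<p} (\<lambda>\<tau>. exp (8 * a\<^sup>2 * (p * e\<^sup>2) * k) *
      exp (- (2 * a\<^sup>2) * wnorm p k U \<tau>))"
  proof (rule expect_mono[OF law])
    fix \<tau> :: "nat \<Rightarrow> real" assume \<tau>: "\<tau> \<in> {..<p} \<rightarrow>\<^sub>E {-1, 0, 1}"
    have "(\<Sum>l<p. (\<tau> l)\<^sup>2) \<le> (\<Sum>l<p. 1)"
    proof (rule sum_mono)
      fix l assume "l \<in> {..<p}"
      then have "\<tau> l \<in> {-1, 0, 1}" by (rule PiE_mem[OF \<tau>])
      then show "(\<tau> l)\<^sup>2 \<le> 1" by auto
    qed
    then have \<tau>2: "(\<Sum>l<p. (\<tau> l)\<^sup>2) \<le> p" by simp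
    have \<tau>2': "e\<^sup>2 * (\<Sum>l<p. (\<tau> l)\<^sup>2) \<le> p * e\<^sup>2" using mult_left_mono[OF \<tau>2, of "e\<^sup>2"] by (simp add: mult.commute)
    let ?g = "\<lambda>z j. (\<Sum>l<p. (e * of_int (z l) - U l j) * \<tau> l)\<^sup>2"
    have "rexpect p k e U (\<lambda>z. exp (- 4 * a\<^sup>2 * wnorm p k (lattice_mat e z) \<tau>)) \<le>
      rexpect p k e U (\<lambda>z. exp (- (2 * a\<^sup>2) * wnorm p k U \<tau>) *
        (\<Prod>j<k. exp (4 * a\<^sup>2 * ?g (\<lambda>l. z (l, j)) j)))"
    proof (rule expect_mono[OF lawz])
      fix z :: "nat \<times> nat \<Rightarrow> int"
      have "(\<Sum>j<k. - 4 * a\<^sup>2 * (\<Sum>l<p. \<tau> l * (e * of_int (z (l, j))))\<^sup>2) \<le>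
        (\<Sum>j<k. - (2 * a\<^sup>2) * (\<Sum>l<p. \<tau> l * U l j)\<^sup>2 + 4 * a\<^sup>2 * ?g (\<lambda>l. z (l, j)) j)"
      proof (rule sum_mono)
        fix j
        have "(\<Sum>l<p. \<tau> l * (e * of_int (z (l, j)))) =
            (\<Sum>l<p. \<tau> l * U l j) + (\<Sum>l<p. (e * of_int (z (l, j)) - U l j) * \<tau> l)"
          unfolding sum.distrib[symmetric] by (intro sum.cong refl) (simp add: algebra_simps)
        moreover have "- 4 * a\<^sup>2 * (x + y)\<^sup>2 \<le> - (2 * a\<^sup>2) * x\<^sup>2 + 4 * a\<^sup>2 * y\<^sup>2" for x y :: real
        proof -
          have "0 \<le> (x + 2 * y)\<^sup>2" by simp
          then have "a\<^sup>2 * (- 2 * (x + y)\<^sup>2) \<le> a\<^sup>2 * (- x\<^sup>2 + 2 * y\<^sup>2)"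
            by (intro mult_left_mono) (simp_all add: power2_eq_square algebra_simps)
          then show ?thesis by (simp add: algebra_simps)
        qed
        ultimately show "- 4 * a\<^sup>2 * (\<Sum>l<p. \<tau> l * (e * of_int (z (l, j))))\<^sup>2 \<le>
            - (2 * a\<^sup>2) * (\<Sum>l<p. \<tau> l * U l j)\<^sup>2 + 4 * a\<^sup>2 * ?g (\<lambda>l. z (l, j)) j" by simp
      qed
      then have "- 4 * a\<^sup>2 * wnorm p k (lattice_mat e z) \<tau> \<le>
          - (2 * a\<^sup>2) * wnorm p k U \<tau> + (\<Sum>j<k. 4 * a\<^sup>2 * ?g (\<lambda>l. z (l, j)) j)"
        by (simp only: sum.distrib sum_distrib_left)
      then show "exp (- 4 * a\<^sup>2 * wnorm p k (lattice_mat e z) \<tau>) \<le>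
          exp (- (2 * a\<^sup>2) * wnorm p k U \<tau>) * (\<Prod>j<k. exp (4 * a\<^sup>2 * ?g (\<lambda>l. z (l, j)) j))"
        by (simp only: exp_sum[symmetric] exp_add[symmetric] exp_le_cancel_iff finite_lessThan)
    qed
    also have "\<dots> = exp (- (2 * a\<^sup>2) * wnorm p k U \<tau>) *
        (\<Prod>j<k. cexpect p e U j (\<lambda>x. exp (4 * a\<^sup>2 * ?g x j)))" unfolding expect_mult_left
      by (subst expect_columns[OF lawz, where f = "\<lambda>j x. exp (4 * a\<^sup>2 * ?g x j)"]) auto
    also have "\<dots> \<le> exp (- (2 * a\<^sup>2) * wnorm p k U \<tau>) * (\<Prod>j<k. exp (8 * a\<^sup>2 * (p * e\<^sup>2)))"
    proof (intro mult_left_mono prod_mono conjI)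
      fix j assume j: "j \<in> {..<k}"
      have "4 * a\<^sup>2 * 24 * (e\<^sup>2 * (\<Sum>l<p. (\<tau> l)\<^sup>2)) \<le> 1 * 1"
        using assms by (intro mult_mono order_trans[OF \<tau>2' eps(2)] mult_nonneg_nonneg sum_nonneg) auto
      then have "cexpect p e U j (\<lambda>x. exp (4 * a\<^sup>2 * ?g x j)) \<le>
          exp (2 * (4 * a\<^sup>2) * (e\<^sup>2 * (\<Sum>l<p. (\<tau> l)\<^sup>2)))" by (intro round_exp_column) (use assms in auto)
      also have "\<dots> \<le> exp (8 * a\<^sup>2 * (p * e\<^sup>2))" using mult_left_mono[OF \<tau>2', of "8 * a\<^sup>2"] by simp
      finally show "cexpect p e U j (\<lambda>x. exp (4 * a\<^sup>2 * ?g x j)) \<le>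
          exp (8 * a\<^sup>2 * (p * e\<^sup>2))" .
      have "law {..<p} (\<lambda>l. round_set e U (l, j)) (\<lambda>l. round_weight e U (l, j))"
        by (rule law_columns[OF lawz j]) simp
      then show "0 \<le> cexpect p e U j (\<lambda>x. exp (4 * a\<^sup>2 * ?g x j))" by (rule expect_nonneg) simp
    qed auto
    also have "(\<Prod>j<k. exp (8 * a\<^sup>2 * (p * e\<^sup>2))) = exp (8 * a\<^sup>2 * (p * e\<^sup>2) * k)"
      by (simp add: mult_ac flip: exp_of_nat_mult)
    finally show "rexpect p k e U (\<lambda>z. exp (- 4 * a\<^sup>2 * wnorm p k (lattice_mat e z) \<tau>)) \<le>
        exp (8 * a\<^sup>2 * (p * e\<^sup>2) * k) * exp (- (2 * a\<^sup>2) * wnorm p k U \<tau>)" by (simp only: mult.commute)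
  qed
  also have "\<dots> \<le> ball_rate a (p * e\<^sup>2) k" unfolding expect_mult_left
    by (intro mult_left_mono orthonormal_small_ball[OF orth]) (use assms in auto)
  finally show ?thesis .
qed

lemma rounding_residual:
  fixes H :: "nat \<times> nat \<Rightarrow> real"
  assumes "0 < e" "\<And>i l. i < m \<Longrightarrow> l < p \<Longrightarrow> \<bar>H (i, l)\<bar> \<le> 1"
  shows "rexpect p k e U (\<lambda>z. \<Sum>i<m. \<Sum>j<k. (\<Sum>l<p. H (i, l) * (e * of_int (z (l, j)) - U l j))\<^sup>2) \<le>
    m * k * p * e\<^sup>2"
proof -
  have "rexpect p k e U (\<lambda>z. \<Sum>i<m. \<Sum>j<k. (\<Sum>l<p. H (i, l) * (e * of_int (z (l, j)) - U l j))\<^sup>2) \<le>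
      (\<Sum>i<m. \<Sum>j<k. p * e\<^sup>2)" unfolding expect_sum by (intro sum_mono round_square) (use assms in auto)
  then show ?thesis by simp
qed

text \<open>Three requirements for one rounding: each quantity is divided by its bound in the mean,
  the sum has mean at most 3, and at a point not exceeding the mean each nonnegative summand is at
  most 3. The factor 3 does not depend on k, so it only affects the base constant.\<close>

lemma good_rounding:
  fixes H :: "nat \<times> nat \<Rightarrow> real" and e D :: real
  assumes orth: "orthonormal p k U" and eps: "0 < e" "6 * (p * e\<^sup>2) \<le> 1" "27 * (e\<^sup>2 * D) \<le> 1"
    and "0 < a" "96 * a\<^sup>2 \<le> 1" "0 \<le> D" "0 < L" "0 < m" "0 < p"
    and H: "\<And>i l. i < m \<Longrightarrow> l < p \<Longrightarrow> \<bar>H (i, l)\<bar> \<le> 1"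
  obtains z where "z \<in> PiE ({..<p} \<times> {..<k}) (round_set e U)"
    and "(\<Sum>i<m. \<Sum>j<k. (\<Sum>l<p. H (i, l) * (e * of_int (z (l, j)) - U l j))\<^sup>2) \<le> 3 * (m * (k + 1) * p * e\<^sup>2)"
    and "gauss_energy p k L a D (lattice_mat e z) \<le> 3 * exp (8 * a\<^sup>2 * k)"
    and "small_ball p k a (lattice_mat e z) \<le> 3 * (ball_rate a (p * e\<^sup>2) k)"
proof -
  define f1 where "f1 z = (\<Sum>i<m. \<Sum>j<k. (\<Sum>l<p. H (i, l) * (e * of_int (z (l, j)) - U l j))\<^sup>2)" for z
  define f2 where "f2 z = gauss_energy p k L a D (lattice_mat e z)" for z
  define f3 where "f3 z = small_ball p k a (lattice_mat e z)" for z
  \<comment> \<open>Writing k + 1 instead of k keeps this divisor positive when k = 0.\<close>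
  define e1 where "e1 = m * (k + 1) * p * e\<^sup>2"
  define e2 where "e2 = exp (8 * a\<^sup>2 * k)"
  define e3 where "e3 = ball_rate a (p * e\<^sup>2) k"
  have "0 < m * (k + 1) * p" using assms by simp
  then have "0 < real (m * (k + 1) * p)" by (simp only: of_nat_0_less_iff)
  moreover have "0 < e\<^sup>2" using eps(1) by simp
  ultimately have "0 < e1" unfolding e1_def by (rule mult_pos_pos)
  then have e: "0 < e1" "0 < e2" "0 < e3" by (auto simp: e2_def e3_def)
  have "0 \<le> f1 z" for z unfolding f1_def by (intro sum_nonneg) simp
  moreover have "0 \<le> f2 z" for z unfolding f2_def gauss_energy_def by (rule expect_nonneg[OF law_lazy]) auto
  moreover have "0 \<le> f3 z" for z unfolding f3_def small_ball_def by (rule expect_nonneg[OF law_lazy]) auto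
  ultimately have f: "0 \<le> f1 z" "0 \<le> f2 z" "0 \<le> f3 z" for z by simp_all
  have law: "law ({..<p} \<times> {..<k}) (round_set e U) (round_weight e U)" by (rule law_round) simp
  have "rexpect p k e U f1 \<le> m * k * p * e\<^sup>2"
    unfolding f1_def using rounding_residual[OF eps(1), of m p H k U] H by simp
  also have "\<dots> \<le> e1"
  proof -
    have "m * k * p \<le> m * (k + 1) * p" by simp
    then have "real (m * k * p) \<le> real (m * (k + 1) * p)" by (simp only: of_nat_le_iff)
    then show ?thesis unfolding e1_def by (rule mult_right_mono) simp
  qed
  finally have 1: "rexpect p k e U f1 / e1 \<le> 1" using e by simp
  have "rexpect p k e U f2 \<le> e2" unfolding f2_def e2_def by (rule rounding_energy[OF orth eps assms(5-8)])
  then have 2: "rexpect p k e U f2 / e2 \<le> 1" using e(2) by simp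
  have "0 \<le> p * e\<^sup>2" by simp
  then have "p * e\<^sup>2 \<le> 1" using eps(2) by linarith
  then have "rexpect p k e U f3 \<le> e3"
    unfolding f3_def e3_def by (rule rounding_small_ball[OF orth eps(1) _ assms(5,6)])
  then have 3: "rexpect p k e U f3 / e3 \<le> 1" using e(3) by simp
  define g where "g z = f1 z / e1 + f2 z / e2 + f3 z / e3" for z
  have "rexpect p k e U g = rexpect p k e U f1 / e1 + rexpect p k e U f2 / e2 + rexpect p k e U f3 / e3"
    unfolding g_def expect_add expect_divide by (rule refl)
  then have g3: "rexpect p k e U g \<le> 3" using 1 2 3 by linarith
  obtain z where z: "z \<in> PiE ({..<p} \<times> {..<k}) (round_set e U)" "g z \<le> rexpect p k e U g"
    using expect_exists[OF law, of g] by blast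
  have "0 \<le> f1 z / e1" "0 \<le> f2 z / e2" "0 \<le> f3 z / e3" using e f by simp_all
  then have "f1 z / e1 \<le> 3" "f2 z / e2 \<le> 3" "f3 z / e3 \<le> 3" using z(2) g3 unfolding g_def by linarith+
  then have "f1 z \<le> 3 * e1" "f2 z \<le> 3 * e2" "f3 z \<le> 3 * e3" using e by (simp_all add: divide_le_eq)
  moreover have "e1 = real m * (real k + 1) * real p * e\<^sup>2" by (simp add: e1_def algebra_simps)
  ultimately show ?thesis using z(1) unfolding f1_def f2_def f3_def e2_def e3_def by (intro that) simp_all
qed

section \<open>Size of rounded matrices and counting of lattice points\<close>

lemma rounding_bounded:
  assumes orth: "orthonormal p k U" and eps: "0 < e" "e \<le> 1" and z: "z \<in> PiE ({..<p} \<times> {..<k}) (round_set e U)"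
    and lj: "l < p" "j < k"
  shows "\<bar>e * of_int (z (l, j))\<bar> \<le> 2"
proof -
  have "(U l j)\<^sup>2 \<le> (\<Sum>j<k. (U l j)\<^sup>2)" by (rule member_le_sum) (use lj in auto)
  also have "\<dots> \<le> 1" by (rule orthonormal_row_le[OF orth lj(1)])
  finally have "\<bar>U l j\<bar> \<le> 1" by (simp add: abs_square_le_1)
  moreover have "z (l, j) \<in> round_set e U (l, j)" using z lj by (intro PiE_mem[OF z]) auto
  then have "\<bar>e * of_int (z (l, j)) - U l j\<bar> \<le> e" by (rule round_error[OF eps(1)])
  ultimately show ?thesis using eps by linarith
qed

lemma rounding_norm:
  fixes e :: real
  assumes orth: "orthonormal p k U" and eps: "0 < e" "p * e\<^sup>2 \<le> 1" and z: "z \<in> PiE ({..<p} \<times> {..<k}) (round_set e U)"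
  shows "(\<Sum>i\<in>{..<p} \<times> {..<k}. (real_of_int (z i))\<^sup>2) \<le> 4 * real k / e\<^sup>2"
proof -
  have "(\<Sum>l<p. \<Sum>j<k. (e * of_int (z (l, j)))\<^sup>2) \<le> (\<Sum>l<p. \<Sum>j<k. 2 * (U l j)\<^sup>2 + 2 * e\<^sup>2)"
  proof (intro sum_mono)
    fix l j assume "l \<in> {..<p}" "j \<in> {..<k}"
    then have "z (l, j) \<in> round_set e U (l, j)" by (intro PiE_mem[OF z]) auto
    then have "\<bar>e * of_int (z (l, j)) - U l j\<bar> \<le> e" by (rule round_error[OF eps(1)])
    then have "(e * of_int (z (l, j)) - U l j)\<^sup>2 \<le> e\<^sup>2" by (metis abs_ge_zero power2_abs power_mono)
    moreover have "w\<^sup>2 \<le> 2 * u\<^sup>2 + 2 * (w - u)\<^sup>2" for w u :: real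
      using zero_le_power2[of "2 * u - w"] by (simp add: power2_eq_square algebra_simps)
    note this[of "e * of_int (z (l, j))" "U l j"]
    ultimately show "(e * of_int (z (l, j)))\<^sup>2 \<le> 2 * (U l j)\<^sup>2 + 2 * e\<^sup>2" by linarith
  qed
  also have "\<dots> = 2 * k + 2 * (k * (p * e\<^sup>2))"
    by (simp add: sum.distrib orthonormal_sum_squares[OF orth] flip: sum_distrib_left)
  also have "\<dots> \<le> 4 * k" using mult_left_mono[OF eps(2), of k] by simp
  finally have "e\<^sup>2 * (\<Sum>l<p. \<Sum>j<k. (of_int (z (l, j)))\<^sup>2) \<le> 4 * k"
    by (simp add: power_mult_distrib sum_distrib_left)
  moreover have "(\<Sum>i\<in>{..<p} \<times> {..<k}. (of_int (z i) :: real)\<^sup>2) = (\<Sum>l<p. \<Sum>j<k. (of_int (z (l, j)))\<^sup>2)"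
    by (simp add: sum.cartesian_product case_prod_beta)
  ultimately show ?thesis using eps by (simp add: field_simps)
qed

text \<open>An exponential Chebyshev bound: the indicator of the ball is at most exp (x^2 (R -
  |z|^2)), which factorises over coordinates. The box makes the set finite, and the bound is uniform
  in M.\<close>

lemma card_lattice_ball:
  fixes M :: nat
  assumes "finite I" "0 < x"
  shows "card {z \<in> PiE I (\<lambda>_. {- int M..int M}). (\<Sum>i\<in>I. (real_of_int (z i))\<^sup>2) \<le> R} \<le>
    exp (x\<^sup>2 * R) * (4 * (1 + 1 / x)) ^ card I"
proof -
  let ?Z = "{z \<in> PiE I (\<lambda>_. {- int M..int M}). (\<Sum>i\<in>I. (real_of_int (z i))\<^sup>2) \<le> R}"
  have fin: "finite (PiE I (\<lambda>_. {- int M..int M}))" using assms(1) by (intro finite_PiE) auto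
  have "real (card ?Z) = (\<Sum>z\<in>?Z. 1)" by simp
  also have "\<dots> \<le> (\<Sum>z\<in>?Z. exp (x\<^sup>2 * R) * (\<Prod>i\<in>I. exp (- (x * real_of_int (z i))\<^sup>2)))"
  proof (rule sum_mono)
    fix z assume "z \<in> ?Z"
    then have "0 \<le> x\<^sup>2 * (R - (\<Sum>i\<in>I. (real_of_int (z i))\<^sup>2))" by (intro mult_nonneg_nonneg) auto
    also have "\<dots> = x\<^sup>2 * R + (\<Sum>i\<in>I. - (x * real_of_int (z i))\<^sup>2)"
      by (simp add: right_diff_distrib sum_distrib_left power_mult_distrib sum_negf)
    finally show "1 \<le> exp (x\<^sup>2 * R) * (\<Prod>i\<in>I. exp (- (x * real_of_int (z i))\<^sup>2))"
      by (simp add: exp_sum[OF assms(1), symmetric] flip: exp_add)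
  qed
  also have "\<dots> \<le> (\<Sum>z\<in>PiE I (\<lambda>_. {- int M..int M}). exp (x\<^sup>2 * R) * (\<Prod>i\<in>I. exp (- (x * real_of_int (z i))\<^sup>2)))"
    by (rule sum_mono2[OF fin]) (auto intro!: mult_nonneg_nonneg prod_nonneg)
  also have "\<dots> = exp (x\<^sup>2 * R) * (\<Prod>i\<in>I. \<Sum>y\<in>{- int M..int M}. exp (- (x * real_of_int y)\<^sup>2))"
    by (subst prod_sum_PiE) (use assms(1) in \<open>auto simp: sum_distrib_left\<close>)
  \<comment> \<open>Shifting by M turns the symmetric interval into a grid centred at s = M, as in
    \<open>sum_gaussian_le\<close>.\<close>
  also have "(\<Sum>y\<in>{- int M..int M}. exp (- (x * real_of_int y)\<^sup>2)) = (\<Sum>s<2 * M + 1. exp (- (x * (real s - real M))\<^sup>2))"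
    by (rule sum.reindex_bij_witness[of _ "\<lambda>s. int s - int M" "\<lambda>y. nat (y + int M)"]) auto
  also have "(\<Prod>i\<in>I. \<Sum>s<2 * M + 1. exp (- (x * (real s - real M))\<^sup>2)) =
      (\<Sum>s<2 * M + 1. exp (- (x * (real s - real M))\<^sup>2)) ^ card I" by simp
  also have "exp (x\<^sup>2 * R) * (\<Sum>s<2 * M + 1. exp (- (x * (real s - real M))\<^sup>2)) ^ card I \<le>
      exp (x\<^sup>2 * R) * (4 * (1 + 1 / x)) ^ card I"
    by (intro mult_left_mono power_mono sum_gaussian_le assms(2) sum_nonneg) auto
  finally show ?thesis .
qed

section \<open>From the random matrix to finite expectations\<close>

lemma pmf_entry: "y \<in> {-1, 0, 1} \<Longrightarrow> pmf entry_pmf y = lazy (1/4) y"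
  by (auto simp: entry_pmf_def lazy_def pmf_bind indicator_def)

lemma set_pmf_entry: "set_pmf entry_pmf \<subseteq> {-1, 0, 1}"
  by (auto simp: entry_pmf_def split: if_splits)

text \<open>The indicator of E is dominated by F. The two product spaces differ off the index set,
  where \<open>rand_mat\<close> takes the value 0 and \<open>lexpect\<close> the value
  \<open>undefined\<close>; restriction identifies them, and \<open>dep\<close> makes F insensitive
  to it.\<close>

lemma rand_mat_prob_le:
  assumes F0: "\<And>H. 0 \<le> F H"
    and F1: "\<And>H. (\<And>i. i \<in> {..<m} \<times> {..<p} \<Longrightarrow> H i \<in> {-1, 0, 1}) \<Longrightarrow> H \<in> E \<Longrightarrow> 1 \<le> F H"
    and dep: "\<And>H H'. (\<And>i. i \<in> {..<m} \<times> {..<p} \<Longrightarrow> H i = H' i) \<Longrightarrow> F H = F H'"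
  shows "measure_pmf.prob (rand_mat m p) E \<le> lexpect (1/4) ({..<m} \<times> {..<p}) F"
proof -
  let ?I = "{..<m} \<times> {..<p}"
  define K where "K = PiE_dflt ?I (0::real) (\<lambda>_. {-1, 0, 1::real})"
  have finK: "finite K" unfolding K_def by (rule finite_PiE_dflt) auto
  have sub: "set_pmf (rand_mat m p) \<subseteq> K"
    unfolding rand_mat_def K_def using set_Pi_pmf_subset'[of ?I 0 "\<lambda>_. entry_pmf"] set_pmf_entry
    by (fastforce simp: PiE_dflt_def)
  have pmfK: "pmf (rand_mat m p) H = (\<Prod>i\<in>?I. lazy (1/4) (H i))" if "H \<in> K" for H
    unfolding rand_mat_def using that
    by (subst pmf_Pi) (auto simp: K_def PiE_dflt_def intro!: prod.cong pmf_entry)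
  have "measure_pmf.prob (rand_mat m p) E = measure_pmf.prob (rand_mat m p) (E \<inter> K)"
    by (rule measure_pmf.finite_measure_eq_AE) (use sub in \<open>auto simp: AE_measure_pmf_iff\<close>)
  also have "\<dots> = (\<Sum>H\<in>E \<inter> K. pmf (rand_mat m p) H)" using finK by (intro measure_measure_pmf_finite) auto
  also have "\<dots> \<le> (\<Sum>H\<in>E \<inter> K. pmf (rand_mat m p) H * F H)"
  proof (rule sum_mono)
    fix H assume H: "H \<in> E \<inter> K"
    then have "1 \<le> F H" by (intro F1) (auto simp: K_def PiE_dflt_def)
    then show "pmf (rand_mat m p) H \<le> pmf (rand_mat m p) H * F H"
      using mult_left_mono[of 1 "F H" "pmf (rand_mat m p) H"] by simp
  qed
  also have "\<dots> \<le> (\<Sum>H\<in>K. pmf (rand_mat m p) H * F H)" by (rule sum_mono2) (auto simp: finK F0)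
  also have "\<dots> = (\<Sum>H\<in>K. (\<Prod>i\<in>?I. lazy (1/4) (restrict H ?I i)) * F (restrict H ?I))"
  proof (rule sum.cong[OF refl])
    fix H assume "H \<in> K"
    moreover have "F H = F (restrict H ?I)" by (rule dep) simp
    ultimately show "pmf (rand_mat m p) H * F H = (\<Prod>i\<in>?I. lazy (1/4) (restrict H ?I i)) * F (restrict H ?I)"
      by (simp add: pmfK cong: prod.cong)
  qed
  also have "\<dots> = (\<Sum>H\<in>(\<lambda>h. restrict h ?I) ` K. (\<Prod>i\<in>?I. lazy (1/4) (H i)) * F H)"
  proof (rule sum.reindex[symmetric, unfolded comp_def])
    show "inj_on (\<lambda>h. restrict h ?I) K"
    proof (rule inj_onI)
      fix f g assume fg: "f \<in> K" "g \<in> K" "restrict f ?I = restrict g ?I"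
      show "f = g"
      proof
        fix i
        show "f i = g i"
        proof (cases "i \<in> ?I")
          case True
          then show ?thesis using fun_cong[OF fg(3), of i] by simp
        next
          case False
          have "f' i = 0" if "f' \<in> K" for f' using that False unfolding K_def PiE_dflt_def by blast
          from this[OF fg(1)] this[OF fg(2)] show ?thesis by simp
        qed
      qed
    qed
  qed
  also have "(\<lambda>h. restrict h ?I) ` K = PiE ?I (\<lambda>_. {-1, 0, 1})" unfolding K_def by (rule restrict_PiE_dflt)
  finally show ?thesis unfolding expect_def by simp
qed

section \<open>Distance to the integers from the hypothesis on \<open>D_alpha\<close>\<close>

lemma D_alpha_gt_imp:
  assumes "D_alpha d \<alpha> v > 16" "0 < \<phi>" "\<phi> \<le> 16"
  shows "min (\<phi> * vnorm d v / 2) (sqrt (\<alpha> * d)) < torus_norm d (\<lambda>i. \<phi> * v i)"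
proof (rule ccontr)
  assume "\<not> ?thesis"
  then have "D_alpha d \<alpha> v \<le> ereal \<phi>" unfolding D_alpha_def using assms(2) by (intro Inf_lower) auto
  also have "\<dots> \<le> 16" using assms(3) by simp
  finally show False using assms(1) by simp
qed

lemma torus_norm_le: "torus_norm d x \<le> vnorm d (\<lambda>i. x i - of_int (z i))"
proof -
  have "bdd_below {vnorm d (\<lambda>i. x i - of_int (z i)) | z :: nat \<Rightarrow> int. True}"
    by (rule bdd_belowI[of _ 0]) (auto simp: vnorm_def intro!: sum_nonneg)
  then show ?thesis unfolding torus_norm_def by (intro cInf_lower) auto
qed

lemma D_alpha_lattice_distance:
  assumes D: "D_alpha d \<alpha> v > 16" and "\<bar>u\<bar> < 1" "0 \<le> \<alpha>"
    and int: "\<And>i. i < d \<Longrightarrow> u * v i + w i \<in> \<int>"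
  shows "min (u\<^sup>2 * (vnorm d v)\<^sup>2 / 4) (\<alpha> * d) \<le> (\<Sum>i<d. (w i)\<^sup>2)"
proof (cases "u = 0")
  case True
  then show ?thesis using assms by (auto simp: min_def intro: sum_nonneg order_trans[OF _ sum_nonneg])
next
  case False
  \<comment> \<open>\<open>D_alpha\<close> speaks of positive multiples of v only, so a negative u
    is reflected by its sign, which preserves integrality and the length of w.\<close>
  define \<sigma> where "\<sigma> = sgn u"
  have \<sigma>: "\<sigma> * u = \<bar>u\<bar>" "\<sigma>\<^sup>2 = 1" "\<sigma> \<in> \<int>" using False by (auto simp: \<sigma>_def sgn_if)
  define z where "z i = \<lfloor>\<sigma> * (u * v i + w i)\<rfloor>" for i
  have z: "of_int (z i) = \<sigma> * (u * v i + w i)" if "i < d" for i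
    using Ints_mult[OF \<sigma>(3) int[OF that]] by (auto simp: z_def elim: Ints_cases)
  have "min (\<bar>u\<bar> * vnorm d v / 2) (sqrt (\<alpha> * d)) < torus_norm d (\<lambda>i. \<bar>u\<bar> * v i)"
    by (rule D_alpha_gt_imp[OF D]) (use False assms in auto)
  also have "\<dots> \<le> vnorm d (\<lambda>i. \<bar>u\<bar> * v i - of_int (z i))" by (rule torus_norm_le)
  also have "\<dots> = sqrt (\<Sum>i<d. (w i)\<^sup>2)" unfolding vnorm_def
  proof (intro arg_cong[where f = sqrt] sum.cong refl)
    fix i assume "i \<in> {..<d}"
    then have "\<bar>u\<bar> * v i - of_int (z i) = - (\<sigma> * w i)" using z[of i] \<sigma>(1) by (simp add: algebra_simps)
    then show "(\<bar>u\<bar> * v i - of_int (z i))\<^sup>2 = (w i)\<^sup>2" using \<sigma>(2) by (simp add: power_mult_distrib)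
  qed
  finally have lt: "min (\<bar>u\<bar> * vnorm d v / 2) (sqrt (\<alpha> * d)) < sqrt (\<Sum>i<d. (w i)\<^sup>2)" .
  have s0: "0 \<le> (\<Sum>i<d. (w i)\<^sup>2)" by (rule sum_nonneg) simp
  have v0: "0 \<le> vnorm d v" by (simp add: vnorm_def sum_nonneg)
  show ?thesis
  proof (cases "\<bar>u\<bar> * vnorm d v / 2 < sqrt (\<Sum>i<d. (w i)\<^sup>2)")
    case True
    then have "(\<bar>u\<bar> * vnorm d v / 2)\<^sup>2 \<le> (sqrt (\<Sum>i<d. (w i)\<^sup>2))\<^sup>2" using v0 by (intro power_mono) auto
    then show ?thesis using s0 by (simp add: power_mult_distrib power_divide)
  next
    case False
    then have "sqrt (\<alpha> * d) < sqrt (\<Sum>i<d. (w i)\<^sup>2)" using lt by (simp add: min_less_iff_disj)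
    then show ?thesis by simp
  qed
qed

section \<open>The dominating function of a row\<close>

lemma sum_double: "(\<Sum>l<2 * d. f l) = (\<Sum>l<d. f l) + (\<Sum>l<d. f (d + l))" for f :: "nat \<Rightarrow> real"
proof -
  have "(\<Sum>l<2 * d. f l) = (\<Sum>l\<in>{0..<d}. f l) + (\<Sum>l\<in>{d..<2 * d}. f l)"
    by (simp add: sum.atLeastLessThan_concat flip: atLeast0LessThan)
  also have "(\<Sum>l\<in>{d..<2 * d}. f l) = (\<Sum>l\<in>{0..<d}. f (l + d))"
    using sum.shift_bounds_nat_ivl[of f 0 d d] by (simp add: mult_2)
  finally show ?thesis by (simp add: atLeast0LessThan add.commute)
qed

text \<open>\<open>lo\<close> and \<open>hi\<close> place v in the first and in the second half of
  the 2 d coordinates, matching the two blocks of H. Their supports are disjoint, so distances to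
  the integers add.\<close>

definition lo :: "nat \<Rightarrow> (nat \<Rightarrow> real) \<Rightarrow> nat \<Rightarrow> real" where "lo d v l = (if l < d then v l else 0)"
definition hi :: "nat \<Rightarrow> (nat \<Rightarrow> real) \<Rightarrow> nat \<Rightarrow> real" where "hi d v l = (if l < d then 0 else v (l - d))"

definition row_fun :: "nat \<Rightarrow> nat \<Rightarrow> nat \<Rightarrow> real \<Rightarrow> nat \<Rightarrow> (nat \<Rightarrow> real) \<Rightarrow> (nat \<Rightarrow> nat \<Rightarrow> real) \<Rightarrow> (nat \<Rightarrow> real) \<Rightarrow> real" where
  "row_fun d k L a P v W \<tau> = (\<Prod>i\<in>{..<k} \<times> {..<L}. lchar (1/4) (\<Sum>l<2 * d. a * W l (fst i) / sqrt L * \<tau> l)) *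
     (fejer P (\<Sum>l<2 * d. \<tau> l * lo d v l) * fejer P (\<Sum>l<2 * d. \<tau> l * hi d v l))"

lemma sum_split_columns:
  fixes L :: nat
  assumes "0 < L"
  shows "(\<Sum>i\<in>{..<k} \<times> {..<L}. (\<Sum>l<p. a * W l (fst i) / sqrt L * \<tau> l)\<^sup>2) = a\<^sup>2 * wnorm p k W \<tau>"
proof -
  have inner: "(\<Sum>l<p. a * W l j / sqrt L * \<tau> l)\<^sup>2 = a\<^sup>2 * (\<Sum>l<p. \<tau> l * W l j)\<^sup>2 / L" for j
  proof -
    have "(\<Sum>l<p. a * W l j / sqrt L * \<tau> l) = a * (\<Sum>l<p. \<tau> l * W l j) / sqrt L"
      by (simp add: sum_distrib_left sum_divide_distrib mult_ac)
    then show ?thesis by (simp add: power_mult_distrib power_divide)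
  qed
  have "(\<Sum>i\<in>{..<k} \<times> {..<L}. (\<Sum>l<p. a * W l (fst i) / sqrt L * \<tau> l)\<^sup>2) =
      (\<Sum>j<k. \<Sum>i<L. (\<Sum>l<p. a * W l j / sqrt L * \<tau> l)\<^sup>2)"
    unfolding sum.cartesian_product by (simp add: case_prod_beta)
  then show ?thesis using assms unfolding inner by (simp flip: sum_distrib_left)
qed

lemma sum_split_columns_scale:
  fixes L :: nat
  assumes "0 < L"
  shows "(\<Sum>i\<in>{..<k} \<times> {..<L}. c * (\<Sum>l<p. a * W l (fst i) / sqrt L * \<tau> l)\<^sup>2) =
    c * a\<^sup>2 * wnorm p k W \<tau>"
  unfolding sum_distrib_left[symmetric] sum_split_columns[OF assms] by (rule mult.assoc[symmetric])

lemma row_fun_nonneg: "0 \<le> row_fun d k L a P v W \<tau>"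
  unfolding row_fun_def by (intro mult_nonneg_nonneg prod_nonneg lchar_nonneg fejer_nonneg) auto

text \<open>The logarithm of the minorant is quadratic in \<tau>, so over all rows it sums to the
  squared norms that the event controls. The factor 16 collects the 1/4 of each of the two
  kernels.\<close>

lemma row_fun_lower:
  assumes "0 < L" "2 \<le> P"
  shows "exp (- 16 * a\<^sup>2 * wnorm (2 * d) k W \<tau>
      - 64 * ((\<Sum>l<d. \<tau> l * v l)\<^sup>2 + (\<Sum>l<d. \<tau> (d + l) * v l)\<^sup>2)) / 16 \<le> row_fun d k L a P v W \<tau>"
proof -
  have 1: "exp (- 16 * a\<^sup>2 * wnorm (2 * d) k W \<tau>) \<le>
    (\<Prod>i\<in>{..<k} \<times> {..<L}. lchar (1/4) (\<Sum>l<2 * d. a * W l (fst i) / sqrt L * \<tau> l))"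
  proof -
    have "exp (- 16 * a\<^sup>2 * wnorm (2 * d) k W \<tau>) =
        exp (\<Sum>i\<in>{..<k} \<times> {..<L}. - 16 * (\<Sum>l<2 * d. a * W l (fst i) / sqrt L * \<tau> l)\<^sup>2)"
      unfolding sum_split_columns_scale[OF assms(1)] by (rule refl)
    also have "\<dots> = (\<Prod>i\<in>{..<k} \<times> {..<L}. exp (- 16 * (\<Sum>l<2 * d. a * W l (fst i) / sqrt L * \<tau> l)\<^sup>2))"
      by (rule exp_sum) simp
    also have "\<dots> \<le> (\<Prod>i\<in>{..<k} \<times> {..<L}. lchar (1/4) (\<Sum>l<2 * d. a * W l (fst i) / sqrt L * \<tau> l))"
      by (intro prod_mono conjI lchar_lower) simp
    finally show ?thesis .
  qed
  have lo: "(\<Sum>l<2 * d. \<tau> l * lo d v l) = (\<Sum>l<d. \<tau> l * v l)"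
    and hi: "(\<Sum>l<2 * d. \<tau> l * hi d v l) = (\<Sum>l<d. \<tau> (d + l) * v l)"
    unfolding sum_double by (simp_all add: lo_def hi_def)
  have "exp (- 16 * a\<^sup>2 * wnorm (2 * d) k W \<tau>) *
      (exp (- 64 * (\<Sum>l<d. \<tau> l * v l)\<^sup>2) / 4 * (exp (- 64 * (\<Sum>l<d. \<tau> (d + l) * v l)\<^sup>2) / 4)) \<le> row_fun d k L a P v W \<tau>"
    unfolding row_fun_def lo hi
    by (intro mult_mono 1 fejer_lower assms(2) mult_nonneg_nonneg fejer_nonneg prod_nonneg lchar_nonneg) auto
  also have "exp (- 16 * a\<^sup>2 * wnorm (2 * d) k W \<tau>) *
      (exp (- 64 * (\<Sum>l<d. \<tau> l * v l)\<^sup>2) / 4 * (exp (- 64 * (\<Sum>l<d. \<tau> (d + l) * v l)\<^sup>2) / 4)) =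
    exp (- 16 * a\<^sup>2 * wnorm (2 * d) k W \<tau>
      - 64 * ((\<Sum>l<d. \<tau> l * v l)\<^sup>2 + (\<Sum>l<d. \<tau> (d + l) * v l)\<^sup>2)) / 16"
    by (simp add: distrib_left exp_diff exp_add exp_minus field_simps)
  finally show ?thesis .
qed

text \<open>The factor G is squared because the averages over the two frequency coordinates
  separate; this yields 1 / N^2 for each row.\<close>

lemma row_fun_expect:
  fixes G :: real
  assumes D: "D_alpha d \<alpha> v > 16" and \<alpha>: "0 \<le> \<alpha>" "\<alpha> \<le> 1" and "0 < d" "0 < P" "0 < \<eta>" "\<eta> < 1/2" "0 < B2" "0 < B3"
    and a: "0 < a" "a \<le> 1" and L: "L = 16 * (2 * d)\<^sup>2"
    and W: "\<And>l j. l < 2 * d \<Longrightarrow> j < k \<Longrightarrow> \<bar>W l j\<bar> \<le> 2"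
    and ge: "gauss_energy (2 * d) k L a d W \<le> B2" and sb: "small_ball (2 * d) k a W \<le> B3"
    and G: "4 / P + 8 / (vnorm d v * sqrt (3/8 * \<eta>)) + exp (- (3/8 * \<eta>) * (\<alpha> * d)) \<le> G" and v: "0 < vnorm d v"
  shows "lexpect (1/4) {..<2 * d} (row_fun d k L a P v W) \<le> B3 powr ((1 - 2 * \<eta>) / 2) * B2 powr (2 * \<eta>) * G\<^sup>2"
proof -
  let ?J = "{..<k} \<times> {..<L}" and ?V = "\<lambda>l i. a * W l (fst i) / sqrt L"
  let ?s = "\<lambda>\<tau> i. \<Sum>l<2 * d. ?V l i * \<tau> l"
  define t where "t u = min (u\<^sup>2 * (vnorm d v)\<^sup>2 / 4) (\<alpha> * d)" for u
  have L0: "0 < L" using L assms by simp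
  have diff0: "diff_char {..<2 * d} ?J ?V (\<lambda>_. 0) \<le> B3"
  proof -
    have "diff_char {..<2 * d} ?J ?V (\<lambda>_. 0) =
        lexpect (3/32) {..<2 * d} (\<lambda>\<tau>. \<Prod>i\<in>?J. (lchar (1/4) (?s \<tau> i))\<^sup>2)" by (rule diff_char_zero) auto
    also have "\<dots> \<le> small_ball (2 * d) k a W" unfolding small_ball_def
    proof (rule expect_mono[OF law_lazy])
      fix \<tau> :: "nat \<Rightarrow> real" assume \<tau>: "\<tau> \<in> {..<2 * d} \<rightarrow>\<^sub>E {-1, 0, 1}"
      have small: "\<bar>?s \<tau> i\<bar> \<le> 1/2" if i: "i \<in> ?J" for i
      proof -
        \<comment> \<open>L is chosen so that 2 d summands of size at most 2 / sqrt L add up to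
          exactly 1/2, the limit of \<open>lchar_upper_small\<close>.\<close>
        have sq: "sqrt L = 4 * (2 * real d)" by (simp add: L real_sqrt_mult)
        have "\<bar>?s \<tau> i\<bar> \<le> (\<Sum>l<2 * d. \<bar>?V l i * \<tau> l\<bar>)" by (rule sum_abs)
        also have "\<dots> \<le> (\<Sum>l<2 * d. 1 * 2 / sqrt L * 1)"
        proof (rule sum_mono)
          fix l assume l: "l \<in> {..<2 * d}"
          then have "\<tau> l \<in> {-1, 0, 1}" by (rule PiE_mem[OF \<tau>])
          then have "\<bar>\<tau> l\<bar> \<le> 1" by auto
          moreover have "\<bar>W l (fst i)\<bar> \<le> 2" using i l by (intro W) auto
          ultimately show "\<bar>?V l i * \<tau> l\<bar> \<le> 1 * 2 / sqrt L * 1"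
            unfolding abs_mult abs_divide using a L0 by (intro mult_mono divide_mono) auto
        qed
        also have "\<dots> = 1/2" using \<open>0 < d\<close> unfolding sq by simp
        finally show ?thesis .
      qed
      have "(\<Prod>i\<in>?J. (lchar (1/4) (?s \<tau> i))\<^sup>2) \<le>
          (\<Prod>i\<in>?J. exp (- 4 * (?s \<tau> i)\<^sup>2))"
      proof (intro prod_mono conjI)
        fix i assume "i \<in> ?J"
        then have "lchar (1/4) (?s \<tau> i) \<le> exp (- 8 * (1/4) * (?s \<tau> i)\<^sup>2)"
          by (intro lchar_upper_small small) auto
        then have "(lchar (1/4) (?s \<tau> i))\<^sup>2 \<le> (exp (- 8 * (1/4) * (?s \<tau> i)\<^sup>2))\<^sup>2"
          by (intro power_mono lchar_nonneg) auto
        then show "(lchar (1/4) (?s \<tau> i))\<^sup>2 \<le> exp (- 4 * (?s \<tau> i)\<^sup>2)" by (simp flip: exp_double)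
      qed simp
      also have "\<dots> = exp (\<Sum>i\<in>?J. - 4 * (?s \<tau> i)\<^sup>2)" by (rule exp_sum[symmetric]) simp
      also have "\<dots> = exp (- 4 * a\<^sup>2 * wnorm (2 * d) k W \<tau>)"
        unfolding sum_split_columns_scale[OF L0] by (rule refl)
      finally show "(\<Prod>i\<in>?J. (lchar (1/4) (?s \<tau> i))\<^sup>2) \<le>
          exp (- 4 * a\<^sup>2 * wnorm (2 * d) k W \<tau>)" .
    qed auto
    finally show ?thesis using sb by simp
  qed
  have diff_char: "diff_char {..<2 * d} ?J ?V (\<lambda>l. x * lo d v l + y * hi d v l) \<le> exp (- 3/8 * (t x + t y)) * B2\<^sup>2"
    if xy: "\<bar>x\<bar> < 1" "\<bar>y\<bar> < 1" for x y
  proof -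
    have "diff_char {..<2 * d} ?J ?V (\<lambda>l. x * lo d v l + y * hi d v l) \<le> exp (- 3/8 * (t x + t y)) *
      (lexpect (1/4) ?J (\<lambda>h. exp (3/2 * min (\<Sum>l\<in>{..<2 * d}. (\<Sum>j\<in>?J. ?V l j * h j)\<^sup>2) d)))\<^sup>2"
    proof (rule diff_char_le)
      fix w assume w: "\<And>l. l \<in> {..<2 * d} \<Longrightarrow> x * lo d v l + y * hi d v l + w l \<in> \<int>"
      have "t x \<le> (\<Sum>l<d. (w l)\<^sup>2)" unfolding t_def
      proof (rule D_alpha_lattice_distance[OF D xy(1) \<alpha>(1)])
        show "x * v l + w l \<in> \<int>" if "l < d" for l using w[of l] that by (simp add: lo_def hi_def)
      qed
      moreover have "t y \<le> (\<Sum>l<d. (w (d + l))\<^sup>2)" unfolding t_def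
      proof (rule D_alpha_lattice_distance[OF D xy(2) \<alpha>(1)])
        show "y * v l + w (d + l) \<in> \<int>" if "l < d" for l using w[of "d + l"] that by (simp add: lo_def hi_def)
      qed
      ultimately show "t x + t y \<le> (\<Sum>l\<in>{..<2 * d}. (w l)\<^sup>2)" unfolding sum_double by simp
    next
      \<comment> \<open>The truncation level D = d is admissible because \<alpha> d \<le> d.\<close>
      have "t u \<le> d" for u using \<alpha> mult_right_mono[of \<alpha> 1 "real d"] by (auto simp: t_def min_def)
      from this[of x] this[of y] show "t x + t y \<le> 2 * real d" by simp
    qed auto
    also have "\<dots> \<le> exp (- 3/8 * (t x + t y)) * B2\<^sup>2" using ge unfolding gauss_energy_def
      by (intro mult_left_mono power_mono expect_nonneg law_lazy) auto
    finally show ?thesis .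
  qed
  have grid: "(\<Sum>s<P. exp (- (3/8 * \<eta>) * t ((real s - real u) / P))) \<le> P * G" if "u < P" for u
  proof -
    have "(\<Sum>s<P. exp (- (3/8 * \<eta>) * t ((real s - real u) / P))) \<le>
        P * (4 / P + 8 / (vnorm d v * sqrt (3/8 * \<eta>)) + exp (- (3/8 * \<eta>) * (\<alpha> * d)))"
      unfolding t_def by (rule grid_average) (use assms that in auto)
    also have "\<dots> \<le> P * G" by (rule mult_left_mono[OF G]) simp
    finally show ?thesis .
  qed
  show ?thesis unfolding row_fun_def
  proof (rule row_bound[where x = "lo d v" and y = "hi d v" and J = ?J and V = ?V])
    fix s' t' assume st: "s' < P" "t' < P"
    show "(\<Sum>s<P. \<Sum>u<P. row_char {..<2 * d} ?J ?V (\<lambda>l. (real s - real s') / P * lo d v l + (real u - real t') / P * hi d v l)) \<le>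
      (real P)\<^sup>2 * (B3 powr ((1 - 2 * \<eta>) / 2) * B2 powr (2 * \<eta>) * G\<^sup>2)"
      by (rule grid_bound[where t = t, OF _ assms(5-9) diff0 diff_char grid st]) simp_all
  qed (use assms(5) in auto)
qed

section \<open>Small singular values\<close>

text \<open>A complex eigenvector u exists. By symmetry the Hermitian form of A at u is real, so the
  eigenvalue is real, and then the real and imaginary parts of u satisfy the same equation. One of
  them is nonzero at i0 and can be normalised.\<close>

lemma real_symmetric_eigenvector:
  fixes A :: "real mat"
  assumes A: "A \<in> carrier_mat n n" and sym: "transpose_mat A = A" and n: "0 < n"
  shows "\<exists>v \<mu>. (\<Sum>i<n. (v i)\<^sup>2) = 1 \<and> (\<forall>i<n. (\<Sum>j<n. A $$ (i, j) * v j) = \<mu> * v i)"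
proof -
  define C where "C = map_mat complex_of_real A"
  have C: "C \<in> carrier_mat n n" using A by (simp add: C_def)
  have aij: "A $$ (i, j) = A $$ (j, i)" if "i < n" "j < n" for i j
    using arg_cong[OF sym, of "\<lambda>M. M $$ (i, j)"] A that by simp
  obtain as where as: "char_poly C = (\<Prod>a\<leftarrow>as. [:- a, 1:])" "length as = n"
    using char_poly_factorized[OF C] by auto
  then obtain z where "z \<in> set as" using n by (cases as) auto
  then have "poly (char_poly C) z = 0" unfolding as(1) by (auto simp: poly_prod_list prod_list_zero_iff)
  then have "eigenvalue C z" using eigenvalue_root_char_poly[OF C] by simp
  then obtain w where w: "w \<in> carrier_vec n" "w \<noteq> 0\<^sub>v n" "C *\<^sub>v w = z \<cdot>\<^sub>v w"
    using C by (auto simp: eigenvalue_def eigenvector_def)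
  define u where "u i = w $ i" for i
  have eig: "(\<Sum>j<n. of_real (A $$ (i, j)) * u j) = z * u i" if "i < n" for i
  proof -
    have "(C *\<^sub>v w) $ i = (\<Sum>j<n. of_real (A $$ (i, j)) * u j)"
      using w(1) A that by (simp add: scalar_prod_def C_def u_def atLeast0LessThan)
    then show ?thesis using w that by (simp add: u_def)
  qed
  define N where "N = (\<Sum>i<n. (cmod (u i))\<^sup>2)"
  obtain i0 where i0: "i0 < n" "u i0 \<noteq> 0" using w by (metis carrier_vecD eq_vecI index_zero_vec u_def)
  have "0 < (cmod (u i0))\<^sup>2" using i0 by simp
  also have "\<dots> \<le> N" unfolding N_def by (rule member_le_sum) (use i0 in auto)
  finally have N: "0 < N" .
  have zN: "z * of_real N = (\<Sum>i<n. \<Sum>j<n. of_real (A $$ (i, j)) * (cnj (u i) * u j))"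
  proof -
    have "z * of_real N = (\<Sum>i<n. cnj (u i) * (z * u i))" unfolding N_def of_real_sum sum_distrib_left
    proof (rule sum.cong[OF refl])
      fix i
      show "z * of_real ((cmod (u i))\<^sup>2) = cnj (u i) * (z * u i)" unfolding complex_norm_square by simp
    qed
    also have "\<dots> = (\<Sum>i<n. cnj (u i) * (\<Sum>j<n. of_real (A $$ (i, j)) * u j))" using eig by (intro sum.cong) auto
    finally show ?thesis by (simp add: sum_distrib_left mult_ac)
  qed
  have "cnj (z * of_real N) = (\<Sum>i<n. \<Sum>j<n. of_real (A $$ (i, j)) * (u i * cnj (u j)))" unfolding zN by simp
  also have "\<dots> = (\<Sum>j<n. \<Sum>i<n. of_real (A $$ (i, j)) * (u i * cnj (u j)))" by (rule sum.swap)
  also have "\<dots> = z * of_real N" unfolding zN using aij by (intro sum.cong refl) (auto simp: mult_ac)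
  finally have "cnj z = z" using N by simp
  then have z: "z = of_real (Re z)" by (simp add: complex_eq_iff)
  have re: "(\<Sum>j<n. A $$ (i, j) * Re (u j)) = Re z * Re (u i)"
    and im: "(\<Sum>j<n. A $$ (i, j) * Im (u j)) = Re z * Im (u i)" if "i < n" for i
    using arg_cong[OF eig[OF that], of Re] arg_cong[OF eig[OF that], of Im] by (subst (asm) (1 2) z, simp)+
  have unit: "\<exists>v \<mu>. (\<Sum>i<n. (v i)\<^sup>2) = 1 \<and> (\<forall>i<n. (\<Sum>j<n. A $$ (i, j) * v j) = \<mu> * v i)"
    if y: "\<And>i. i < n \<Longrightarrow> (\<Sum>j<n. A $$ (i, j) * y j) = Re z * y i" and y0: "y i0 \<noteq> 0" for y
  proof -
    define s where "s = (\<Sum>i<n. (y i)\<^sup>2)"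
    have "0 < (y i0)\<^sup>2" using y0 by simp
    also have "\<dots> \<le> s" unfolding s_def by (rule member_le_sum) (use i0 in auto)
    finally have s: "0 < s" .
    have "(\<Sum>i<n. (y i / sqrt s)\<^sup>2) = 1" using s by (simp add: power_divide s_def flip: sum_divide_distrib)
    moreover have "\<forall>i<n. (\<Sum>j<n. A $$ (i, j) * (y j / sqrt s)) = Re z * (y i / sqrt s)"
      using y by (simp flip: sum_divide_distrib)
    ultimately show ?thesis by (intro exI[of _ "\<lambda>i. y i / sqrt s"] exI[of _ "Re z"]) simp
  qed
  from i0 have "Re (u i0) \<noteq> 0 \<or> Im (u i0) \<noteq> 0" by (auto simp: complex_eq_iff)
  then show ?thesis using unit[OF re] unit[OF im] by auto
qed

text \<open>The reflection exchanging the first unit vector and v: u = v - e_0 has squared length 2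
  - 2 v_0, so c = 2 / |u|^2. If v_0 = 1 then u = 0, and c = 0 gives the identity.\<close>

lemma householder:
  fixes v :: "nat \<Rightarrow> real"
  assumes v: "(\<Sum>i<n. (v i)\<^sup>2) = 1" and n: "0 < n"
  shows "\<exists>P. P \<in> carrier_mat n n \<and> transpose_mat P = P \<and> P * P = 1\<^sub>m n \<and> (\<forall>i<n. P $$ (i, 0) = v i)"
proof -
  define u where "u i = v i - (if i = 0 then 1 else 0)" for i
  define c where "c = (if v 0 = 1 then 0 else 1 / (1 - v 0))"
  define f where "f i j = (if i = j then 1 else 0) - c * u i * u j" for i j
  define P where "P = mat n n (\<lambda>(i, j). f i j)"
  have u2: "(\<Sum>i<n. u i * u i) = 2 - 2 * v 0"
  proof -
    have "u i * u i = (v i)\<^sup>2 + (if i = 0 then 1 - 2 * v 0 else 0)" for i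
      by (simp add: u_def power2_eq_square algebra_simps)
    then show ?thesis using v n by (simp add: sum.distrib)
  qed
  have cu: "c * (\<Sum>i<n. u i * u i) = (if v 0 = 1 then 0 else 2)" unfolding u2 c_def by (auto simp: field_simps)
  have u_zero: "u i = 0" if "v 0 = 1" "i < n" for i
  proof -
    have "(\<Sum>i<n. u i * u i) = 0" using u2 that by simp
    then have "u i * u i = 0" using that by (subst (asm) sum_nonneg_eq_0_iff) auto
    then show ?thesis by simp
  qed
  have "P * P = 1\<^sub>m n"
  proof (rule eq_matI)
    fix i j assume "i < dim_row (1\<^sub>m n)" "j < dim_col (1\<^sub>m n)"
    then have ij: "i < n" "j < n" by auto
    have "(P * P) $$ (i, j) = (\<Sum>k<n. f i k * f k j)"
      using ij by (simp add: P_def scalar_prod_def atLeast0LessThan)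
    also have "\<dots> = (\<Sum>k<n. (if k = i then if i = j then 1 else 0 else 0) - (if k = i then c * u i * u j else 0) -
        (if k = j then c * u i * u j else 0) + c * u i * u j * (c * (u k * u k)))"
      by (rule sum.cong) (auto simp: f_def algebra_simps)
    also have "\<dots> = (if i = j then 1 else 0) - 2 * (c * u i * u j) + c * u i * u j * (c * (\<Sum>k<n. u k * u k))"
      using ij by (simp add: sum.distrib sum_subtractf sum_distrib_left)
    also have "\<dots> = (if i = j then 1 else 0)" unfolding cu using u_zero ij by simp
    finally show "(P * P) $$ (i, j) = 1\<^sub>m n $$ (i, j)" using ij by simp
  qed (auto simp: P_def)
  moreover have "transpose_mat P = P" by (rule eq_matI) (auto simp: P_def f_def)
  moreover have "P $$ (i, 0) = v i" if "i < n" for i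
  proof -
    have "P $$ (i, 0) = f i 0" using that n by (simp add: P_def)
    also have "\<dots> = v i" using u_zero[OF _ that] by (cases "v 0 = 1") (auto simp: f_def c_def u_def field_simps)
    finally show ?thesis .
  qed
  ultimately show ?thesis by (intro exI[of _ P]) (auto simp: P_def)
qed

text \<open>Deflation: conjugation by the reflection whose first column is an eigenvector splits off
  a 1 x 1 block. Having \<open>transpose_mat Q\<close> as the inverse witness records that Q is
  orthogonal.\<close>

lemma real_symmetric_diagonalization:
  fixes A :: "real mat"
  assumes "A \<in> carrier_mat n n" "transpose_mat A = A"
  shows "\<exists>Q d. similar_mat_wit A (mat_diag n d) Q (transpose_mat Q)"
  using assms
proof (induction n arbitrary: A)
  case 0
  then show ?case by (intro exI[of _ "1\<^sub>m 0"] exI) (auto intro!: similar_mat_witI[of _ _ 0] simp: mat_diag_def)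
next
  case (Suc n)
  note A = Suc.prems(1) and sym = Suc.prems(2)
  obtain v \<mu> where v: "(\<Sum>i<Suc n. (v i)\<^sup>2) = 1"
    "\<And>i. i < Suc n \<Longrightarrow> (\<Sum>j<Suc n. A $$ (i, j) * v j) = \<mu> * v i" using real_symmetric_eigenvector[OF A sym] by auto
  obtain P where P: "P \<in> carrier_mat (Suc n) (Suc n)" "transpose_mat P = P" "P * P = 1\<^sub>m (Suc n)"
    and P0: "\<And>i. i < Suc n \<Longrightarrow> P $$ (i, 0) = v i" using householder[OF v(1)] by auto
  define B where "B = P * A * P"
  have B: "B \<in> carrier_mat (Suc n) (Suc n)" using P A by (simp add: B_def)
  have symB: "transpose_mat B = B"
    using P A sym by (simp add: B_def transpose_mult[of _ "Suc n" "Suc n" _ "Suc n"])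
  have PAP: "A = P * B * P"
  proof -
    have "P * B * P = (P * P) * A * (P * P)"
      unfolding B_def using P(1) A by (simp add: assoc_mult_mat[of _ "Suc n" "Suc n" _ "Suc n" _ "Suc n"])
    then show ?thesis using P(3) A by simp
  qed
  have B0: "B $$ (i, 0) = (if i = 0 then \<mu> else 0)" if i: "i < Suc n" for i
  proof -
    have AP: "(A * P) $$ (k, 0) = \<mu> * P $$ (k, 0)" if "k < Suc n" for k
      using A P(1) that v(2)[OF that] P0 by (simp add: scalar_prod_def atLeast0LessThan del: sum.lessThan_Suc)
    have "B = P * (A * P)" unfolding B_def using P(1) A by (simp add: assoc_mult_mat[of _ "Suc n" "Suc n" _ "Suc n" _ "Suc n"])
    then have "B $$ (i, 0) = (\<Sum>k<Suc n. P $$ (i, k) * (A * P) $$ (k, 0))"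
      using A P(1) i by (simp add: scalar_prod_def atLeast0LessThan del: sum.lessThan_Suc)
    also have "\<dots> = \<mu> * (\<Sum>k<Suc n. P $$ (i, k) * P $$ (k, 0))"
      unfolding sum_distrib_left by (rule sum.cong) (auto simp: AP)
    also have "(\<Sum>k<Suc n. P $$ (i, k) * P $$ (k, 0)) = (P * P) $$ (i, 0)"
      using P(1) i by (simp add: scalar_prod_def atLeast0LessThan del: sum.lessThan_Suc)
    finally show ?thesis unfolding P(3) using i by simp
  qed
  define A' where "A' = mat n n (\<lambda>(i, j). B $$ (Suc i, Suc j))"
  have A': "A' \<in> carrier_mat n n" by (simp add: A'_def)
  have bij: "B $$ (i, j) = B $$ (j, i)" if "i < Suc n" "j < Suc n" for i j
    using arg_cong[OF symB, of "\<lambda>M. M $$ (i, j)"] B that by simp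
  have symA': "transpose_mat A' = A'" by (rule eq_matI) (auto simp: A'_def intro: bij)
  obtain Q d where Q: "similar_mat_wit A' (mat_diag n d) Q (transpose_mat Q)" using Suc.IH[OF A' symA'] by auto
  note Qd = similar_mat_witD2[OF A' Q]
  have B_block: "B = four_block_mat (mat 1 1 (\<lambda>_. \<mu>)) (0\<^sub>m 1 n) (0\<^sub>m n 1) A'"
  proof (rule eq_matI)
    fix i j assume "i < dim_row (four_block_mat (mat 1 1 (\<lambda>_. \<mu>)) (0\<^sub>m 1 n) (0\<^sub>m n 1) A')"
      "j < dim_col (four_block_mat (mat 1 1 (\<lambda>_. \<mu>)) (0\<^sub>m 1 n) (0\<^sub>m n 1) A')"
    then have "i < Suc n" "j < Suc n" by (auto simp: A'_def)
    then show "B $$ (i, j) = four_block_mat (mat 1 1 (\<lambda>_. \<mu>)) (0\<^sub>m 1 n) (0\<^sub>m n 1) A' $$ (i, j)"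
      using B0[of i] B0[of j] bij[of 0 j] by (cases i; cases j) (auto simp: A'_def)
  qed (use B in \<open>auto simp: A'_def\<close>)
  define d' where "d' i = (case i of 0 \<Rightarrow> \<mu> | Suc k \<Rightarrow> d k)" for i
  have D_block: "mat_diag (Suc n) d' = four_block_mat (mat 1 1 (\<lambda>_. \<mu>)) (0\<^sub>m 1 n) (0\<^sub>m n 1) (mat_diag n d)"
    by (rule eq_matI) (auto simp: mat_diag_def d'_def split: nat.splits)
  define R where "R = four_block_mat (1\<^sub>m 1) (0\<^sub>m 1 n) (0\<^sub>m n 1) Q"
  have RT: "transpose_mat R = four_block_mat (1\<^sub>m 1) (0\<^sub>m 1 n) (0\<^sub>m n 1) (transpose_mat Q)"
    unfolding R_def using Qd by (subst transpose_four_block_mat[of _ 1 1 _ n _ n]) auto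
  have one: "four_block_mat (1\<^sub>m 1) (0\<^sub>m 1 n) (0\<^sub>m n 1) (1\<^sub>m n) = (1\<^sub>m (Suc n) :: real mat)"
    using four_block_one_mat[of 1 n] by simp
  have R: "similar_mat_wit B (mat_diag (Suc n) d') R (transpose_mat R)"
  proof (rule similar_mat_witI[of _ _ "Suc n"])
    show "R * transpose_mat R = 1\<^sub>m (Suc n)" unfolding RT unfolding R_def using Qd
      by (subst mult_four_block_mat[of _ 1 1 _ n _ n _ _ 1 _ n]) (auto simp: one)
    show "transpose_mat R * R = 1\<^sub>m (Suc n)" unfolding RT unfolding R_def using Qd
      by (subst mult_four_block_mat[of _ 1 1 _ n _ n _ _ 1 _ n]) (auto simp: one)
    show "B = R * mat_diag (Suc n) d' * transpose_mat R"
    proof -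
      define D where "D = mat_diag n d"
      have D: "D \<in> carrier_mat n n" by (simp add: D_def)
      have Q': "Q \<in> carrier_mat n n" "A' = Q * D * transpose_mat Q"
        using Qd by (auto simp: D_def assoc_mult_mat[of _ n n _ n _ n])
      have "R * mat_diag (Suc n) d' = four_block_mat (mat 1 1 (\<lambda>_. \<mu>)) (0\<^sub>m 1 n) (0\<^sub>m n 1) (Q * D)"
        unfolding D_block R_def D_def[symmetric] using D Q'
        by (subst mult_four_block_mat[of _ 1 1 _ n _ n _ _ 1 _ n]) auto
      moreover have "four_block_mat (mat 1 1 (\<lambda>_. \<mu>)) (0\<^sub>m 1 n) (0\<^sub>m n 1) (Q * D) * transpose_mat R =
          four_block_mat (mat 1 1 (\<lambda>_. \<mu>)) (0\<^sub>m 1 n) (0\<^sub>m n 1) (Q * D * transpose_mat Q)"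
        unfolding RT using D Q'(1) by (subst mult_four_block_mat[of _ 1 1 _ n _ n _ _ 1 _ n]) auto
      ultimately show ?thesis unfolding B_block Q'(2) by simp
    qed
  qed (use B Qd in \<open>auto simp: R_def\<close>)
  have "similar_mat_wit A B P P" by (rule similar_mat_witI[of _ _ "Suc n"]) (use P A B PAP in auto)
  from similar_mat_wit_trans[OF this R]
  have "similar_mat_wit A (mat_diag (Suc n) d') (P * R) (transpose_mat R * P)" .
  moreover have "transpose_mat R * P = transpose_mat (P * R)"
    using P Qd by (subst transpose_mult[of _ "Suc n" "Suc n" _ "Suc n"]) (auto simp: R_def)
  ultimately show ?case by auto
qed

lemma char_poly_mat_diag: "char_poly (mat_diag n d :: real mat) = (\<Prod>i\<leftarrow>[0..<n]. [:- d i, 1:])"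
proof -
  have "char_poly (mat_diag n d :: real mat) = (\<Prod>a\<leftarrow>diag_mat (mat_diag n d). [:- a, 1:])"
    by (rule char_poly_upper_triangular[of _ n]) (auto simp: mat_diag_def upper_triangular_def)
  also have "diag_mat (mat_diag n d) = map d [0..<n]" by (auto simp: diag_mat_def mat_diag_def)
  finally show ?thesis by (simp add: comp_def)
qed

lemma sorted_nth_le_card:
  fixes f :: "nat \<Rightarrow> real"
  assumes "1 \<le> k" "k \<le> p" "sorted_list_of_multiset (image_mset f (mset [0..<p])) ! (k - 1) \<le> s"
  shows "k \<le> card {i. i < p \<and> f i \<le> s}"
proof -
  define L where "L = sorted_list_of_multiset (image_mset f (mset [0..<p]))"
  have L: "mset L = image_mset f (mset [0..<p])" "sorted L" by (auto simp: L_def)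
  have len: "length L = p" using mset_eq_length[of L "map f [0..<p]"] L(1) by simp
  have "x \<le> s" if "x \<in> set (take k L)" for x
  proof -
    obtain i where "i < length (take k L)" "x = take k L ! i" using \<open>x \<in> set (take k L)\<close> by (metis in_set_conv_nth)
    then have i: "i < k" "i < length L" "x = L ! i" by auto
    then have "L ! i \<le> L ! (k - 1)" using L(2) assms len by (intro sorted_nth_mono) auto
    then show ?thesis using assms i by (simp add: L_def)
  qed
  then have "filter (\<lambda>x. x \<le> s) (take k L) = take k L" by (simp add: filter_id_conv)
  then have "k = length (filter (\<lambda>x. x \<le> s) (take k L))" using assms len by simp
  also have "\<dots> \<le> length (filter (\<lambda>x. x \<le> s) (take k L)) + length (filter (\<lambda>x. x \<le> s) (drop k L))" by simp
  also have "\<dots> = length (filter (\<lambda>x. x \<le> s) L)"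
    by (simp only: append_take_drop_id flip: filter_append length_append)
  also have "\<dots> = size (filter_mset (\<lambda>x. x \<le> s) (mset L))" by (simp only: mset_filter[symmetric] size_mset)
  also have "\<dots> = size (filter_mset (\<lambda>i. f i \<le> s) (mset [0..<p]))"
    unfolding L(1) by (simp add: filter_mset_image_mset)
  also have "\<dots> = card {i. i < p \<and> f i \<le> s}"
  proof -
    have "size (filter_mset (\<lambda>i. f i \<le> s) (mset [0..<p])) = length (filter (\<lambda>i. f i \<le> s) [0..<p])"
      by (simp only: mset_filter[symmetric] size_mset)
    also have "\<dots> = card (set (filter (\<lambda>i. f i \<le> s) [0..<p]))" by (rule distinct_card[symmetric]) simp
    also have "set (filter (\<lambda>i. f i \<le> s) [0..<p]) = {i. i < p \<and> f i \<le> s}" by auto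
    finally show ?thesis .
  qed
  finally show ?thesis .
qed

(* The orthonormal family comes from the eigenvectors of H^T H. *)
lemma small_sing_val_orthonormal:
  assumes k: "1 \<le> k" "k \<le> p" and s: "0 \<le> s" and sv: "sing_val (mat_of_fun m p H) (p - k + 1) \<le> s"
  shows "\<exists>U :: nat \<Rightarrow> nat \<Rightarrow> real.
    (\<forall>j<k. \<forall>j'<k. (\<Sum>l<p. U l j * U l j') = (if j = j' then 1 else 0)) \<and>
    (\<forall>j<k. (\<Sum>i<m. (\<Sum>l<p. H (i, l) * U l j)\<^sup>2) \<le> s\<^sup>2)"
proof -
  define M where "M = mat_of_fun m p H"
  have M: "M \<in> carrier_mat m p" by (simp add: M_def mat_of_fun_def)
  define A where "A = transpose_mat M * M"
  have A: "A \<in> carrier_mat p p" using M by (simp add: A_def)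
  have sym: "transpose_mat A = A" using M by (simp add: A_def transpose_mult[of _ p m])
  obtain Q d where Q: "similar_mat_wit A (mat_diag p d) Q (transpose_mat Q)"
    using real_symmetric_diagonalization[OF A sym] by auto
  note Qd = similar_mat_witD2[OF A Q]
  have "char_poly A = (\<Prod>i\<leftarrow>[0..<p]. [:- d i, 1:])"
    using char_poly_similar[of A "mat_diag p d"] Q by (auto simp: similar_mat_def char_poly_mat_diag)
  moreover have "proots (\<Prod>i\<leftarrow>xs. [:- d i, 1:]) = image_mset d (mset xs)" for xs
  proof (induction xs)
    case (Cons x xs)
    have "(\<Prod>i\<leftarrow>xs. [:- d i, 1:]) \<noteq> 0" by (auto simp: prod_list_zero_iff)
    then show ?case using Cons by (simp add: proots_mult del: mult_pCons_left)
  qed simp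
  ultimately have roots: "proots (char_poly A) = image_mset d (mset [0..<p])" by simp
  have sv_eq: "singular_values M = rev (sorted_list_of_multiset (image_mset (\<lambda>i. sqrt (d i)) (mset [0..<p])))"
    unfolding singular_values_def A_def[symmetric] roots by (simp add: image_mset.compositionality comp_def)
  define L where "L = sorted_list_of_multiset (image_mset (\<lambda>i. sqrt (d i)) (mset [0..<p]))"
  have len: "length L = p" using mset_eq_length[of L "map (\<lambda>i. sqrt (d i)) [0..<p]"] by (simp add: L_def)
  \<comment> \<open>The list has all p entries, zeros included, so for k \<ge> 1 this index lies
    inside it. In the decreasing order it is the k-th smallest value, at position k - 1 of the
    increasing list.\<close>
  have "sing_val M (p - k + 1) = rev L ! (p - k)"
    unfolding sing_val_def sv_eq L_def[symmetric] using k len by simp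
  also have "\<dots> = L ! (k - 1)" using k len by (simp add: rev_nth)
  finally have "L ! (k - 1) \<le> s" using sv by (simp add: M_def)
  then have "k \<le> card {i. i < p \<and> sqrt (d i) \<le> s}" unfolding L_def by (rule sorted_nth_le_card[OF k])
  then obtain T where T: "T \<subseteq> {i. i < p \<and> sqrt (d i) \<le> s}" "card T = k" "finite T"
    by (rule obtain_subset_with_card_n)
  then obtain g where g: "bij_betw g {..<k} T"
    using ex_bij_betw_nat_finite[of T] by (auto simp: atLeast0LessThan)
  have gT: "g j < p" "sqrt (d (g j)) \<le> s" if "j < k" for j using g T that by (auto simp: bij_betw_def)
  have gi: "g j = g j' \<longleftrightarrow> j = j'" if "j < k" "j' < k" for j j'
    using g that by (auto simp: bij_betw_def inj_on_def)
  have orth: "(\<Sum>l<p. Q $$ (l, a) * Q $$ (l, b)) = (if a = b then 1 else 0)" if "a < p" "b < p" for a b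
  proof -
    have "(transpose_mat Q * Q) $$ (a, b) = (\<Sum>l<p. Q $$ (l, a) * Q $$ (l, b))"
      using Qd(6) that by (simp add: scalar_prod_def atLeast0LessThan)
    moreover have QQ: "transpose_mat Q * Q = 1\<^sub>m p" using Qd by simp
    ultimately have "1\<^sub>m p $$ (a, b) = (\<Sum>l<p. Q $$ (l, a) * Q $$ (l, b))" by (simp only: QQ)
    then show ?thesis using that by simp
  qed
  have eig: "(\<Sum>i<m. (\<Sum>l<p. H (i, l) * Q $$ (l, a))\<^sup>2) = d a" if a: "a < p" for a
  proof -
    have MQ: "(M * Q) $$ (i, a) = (\<Sum>l<p. H (i, l) * Q $$ (l, a))" if "i < m" for i
      using Qd M a that by (simp add: scalar_prod_def atLeast0LessThan M_def mat_of_fun_def)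
    have "transpose_mat (M * Q) * (M * Q) = transpose_mat Q * A * Q" using Qd(6) M unfolding A_def
      by (simp add: transpose_mult[of _ m p _ p] assoc_mult_mat[of _ p m _ p _ p] assoc_mult_mat[of _ p p _ m _ p]
          assoc_mult_mat[of _ p p _ p _ p])
    also have "\<dots> = (transpose_mat Q * Q) * mat_diag p d * (transpose_mat Q * Q)"
    proof -
      define D where "D = mat_diag p d"
      have c: "D \<in> carrier_mat p p" "Q \<in> carrier_mat p p" "transpose_mat Q \<in> carrier_mat p p"
        using Qd(6) by (auto simp: D_def)
      note c' = c(3) mult_carrier_mat[OF c(2,1)] mult_carrier_mat[OF c(3,2)]
      have "transpose_mat Q * (Q * D * transpose_mat Q) * Q = transpose_mat Q * (Q * D) * transpose_mat Q * Q"
        by (simp only: assoc_mult_mat[OF c'(1,2,1)])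
      also have "\<dots> = transpose_mat Q * Q * D * transpose_mat Q * Q" by (simp only: assoc_mult_mat[OF c(3,2,1)])
      also have "\<dots> = (transpose_mat Q * Q) * D * (transpose_mat Q * Q)"
        by (rule assoc_mult_mat[OF mult_carrier_mat[OF c'(3) c(1)] c(3,2)])
      finally show ?thesis using Qd(3) by (simp only: D_def[symmetric])
    qed
    also have "\<dots> = mat_diag p d"
      unfolding Qd(2) left_mult_one_mat[OF mat_diag_dim] right_mult_one_mat[OF mat_diag_dim] by (rule refl)
    finally have eq: "transpose_mat (M * Q) * (M * Q) = mat_diag p d" .
    have "(transpose_mat (M * Q) * (M * Q)) $$ (a, a) = (\<Sum>i<m. (M * Q) $$ (i, a) * (M * Q) $$ (i, a))"
      using Qd M a by (simp add: scalar_prod_def atLeast0LessThan del: index_mult_mat(1))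
         (simp add: scalar_prod_def atLeast0LessThan)
    also have "\<dots> = (\<Sum>i<m. (\<Sum>l<p. H (i, l) * Q $$ (l, a))\<^sup>2)" by (rule sum.cong) (auto simp: MQ power2_eq_square)
    finally show ?thesis unfolding eq using a by (simp add: mat_diag_def)
  qed
  show ?thesis
  proof (intro exI[of _ "\<lambda>l j. Q $$ (l, g j)"] conjI allI impI)
    fix j j' assume "j < k" "j' < k"
    then show "(\<Sum>l<p. Q $$ (l, g j) * Q $$ (l, g j')) = (if j = j' then 1 else 0)" using orth gT gi by simp
  next
    fix j assume j: "j < k"
    have "0 \<le> d (g j)" unfolding eig[OF gT(1)[OF j], symmetric] by (rule sum_nonneg) simp
    then have "d (g j) \<le> s\<^sup>2" using gT(2)[OF j] s by (simp add: real_sqrt_le_iff' sqrt_le_D)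
    then show "(\<Sum>i<m. (\<Sum>l<p. H (i, l) * Q $$ (l, g j))\<^sup>2) \<le> s\<^sup>2" unfolding eig[OF gT(1)[OF j]] .
  qed
qed

section \<open>The union bound\<close>

lemma row_fun_cong:
  assumes "\<And>l. l < 2 * d \<Longrightarrow> \<tau> l = \<tau>' l"
  shows "row_fun d k L a P v W \<tau> = row_fun d k L a P v W \<tau>'"
proof -
  have "(\<Sum>l<2 * d. f l * \<tau> l) = (\<Sum>l<2 * d. f l * \<tau>' l)"
    "(\<Sum>l<2 * d. \<tau> l * f l) = (\<Sum>l<2 * d. \<tau>' l * f l)" for f using assms by (auto intro!: sum.cong)
  then show ?thesis unfolding row_fun_def by (simp only:)
qed

text \<open>Domination by the sum over the net; for each net point the rows of H are independent,
  which gives the m-th power.\<close>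

lemma rand_mat_union_bound:
  fixes W :: "'z \<Rightarrow> nat \<Rightarrow> nat \<Rightarrow> real" and B C :: real
  assumes "finite Z" "0 \<le> C"
    and row: "\<And>z. z \<in> Z \<Longrightarrow> lexpect (1/4) {..<2 * d} (row_fun d k L a P v (W z)) \<le> B"
    and cover: "\<And>H. (\<And>i. i \<in> {..<m} \<times> {..<2 * d} \<Longrightarrow> H i \<in> {-1, 0, 1}) \<Longrightarrow> H \<in> E \<Longrightarrow>
       \<exists>z\<in>Z. 1 \<le> C * (\<Prod>i<m. row_fun d k L a P v (W z) (\<lambda>l. H (i, l)))"
  shows "measure_pmf.prob (rand_mat m (2 * d)) E \<le> card Z * (C * B ^ m)"
proof -
  define f where "f z H = C * (\<Prod>i<m. row_fun d k L a P v (W z) (\<lambda>l. H (i, l)))" for z and H :: "nat \<times> nat \<Rightarrow> real"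
  have f0: "0 \<le> f z H" for z H unfolding f_def by (intro mult_nonneg_nonneg assms prod_nonneg row_fun_nonneg)
  have law: "law ({..<m} \<times> {..<2 * d}) (\<lambda>_. {-1, 0, 1::real}) (\<lambda>_. lazy (1/4))" by (rule law_lazy) auto
  have "measure_pmf.prob (rand_mat m (2 * d)) E \<le> lexpect (1/4) ({..<m} \<times> {..<2 * d}) (\<lambda>H. \<Sum>z\<in>Z. f z H)"
  proof (rule rand_mat_prob_le)
    fix H :: "nat \<times> nat \<Rightarrow> real"
    assume H: "\<And>i. i \<in> {..<m} \<times> {..<2 * d} \<Longrightarrow> H i \<in> {-1, 0, 1}" "H \<in> E"
    obtain z where z: "z \<in> Z" "1 \<le> f z H" using cover[OF H] unfolding f_def by auto
    have "f z H \<le> (\<Sum>z\<in>Z. f z H)" by (rule member_le_sum) (use z assms f0 in auto)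
    then show "1 \<le> (\<Sum>z\<in>Z. f z H)" using z by simp
  next
    fix H H' :: "nat \<times> nat \<Rightarrow> real"
    assume eq: "\<And>i. i \<in> {..<m} \<times> {..<2 * d} \<Longrightarrow> H i = H' i"
    have "row_fun d k L a P v (W z) (\<lambda>l. H (i, l)) = row_fun d k L a P v (W z) (\<lambda>l. H' (i, l))" if "i < m" for i z
      using that by (intro row_fun_cong eq) auto
    then show "(\<Sum>z\<in>Z. f z H) = (\<Sum>z\<in>Z. f z H')" unfolding f_def by simp
  qed (intro sum_nonneg f0)
  also have "\<dots> = (\<Sum>z\<in>Z. lexpect (1/4) ({..<m} \<times> {..<2 * d}) (f z))" by (rule expect_sum)
  also have "\<dots> \<le> (\<Sum>z\<in>Z. C * B ^ m)"
  proof (rule sum_mono)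
    fix z assume z: "z \<in> Z"
    have "lexpect (1/4) ({..<m} \<times> {..<2 * d}) (f z) =
        C * (\<Prod>i<m. lexpect (1/4) {..<2 * d} (row_fun d k L a P v (W z)))" unfolding f_def expect_mult_left
      by (subst expect_rows[OF law, where f = "\<lambda>_. row_fun d k L a P v (W z)"]) (auto intro: row_fun_cong)
    also have "\<dots> \<le> C * (\<Prod>i<m. B)"
      by (intro mult_left_mono prod_mono conjI row z assms expect_nonneg[OF law_lazy] row_fun_nonneg) auto
    finally show "lexpect (1/4) ({..<m} \<times> {..<2 * d}) (f z) \<le> C * B ^ m" by simp
  qed
  finally show ?thesis by simp
qed

lemma residual_split:
  fixes H :: "nat \<times> nat \<Rightarrow> real" and k :: nat and r s :: real
  assumes small: "\<And>j. j < k \<Longrightarrow> (\<Sum>i<m. (\<Sum>l<p. H (i, l) * U l j)\<^sup>2) \<le> s\<^sup>2"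
    and res: "(\<Sum>i<m. \<Sum>j<k. (\<Sum>l<p. H (i, l) * (W l j - U l j))\<^sup>2) \<le> r"
  shows "(\<Sum>i<m. wnorm p k W (\<lambda>l. H (i, l))) \<le> 2 * (k * s\<^sup>2) + 2 * r"
proof -
  have "(\<Sum>i<m. wnorm p k W (\<lambda>l. H (i, l))) \<le>
      (\<Sum>i<m. \<Sum>j<k. 2 * (\<Sum>l<p. H (i, l) * U l j)\<^sup>2 + 2 * (\<Sum>l<p. H (i, l) * (W l j - U l j))\<^sup>2)"
  proof (intro sum_mono)
    fix i j
    have "(\<Sum>l<p. H (i, l) * W l j) = (\<Sum>l<p. H (i, l) * U l j) + (\<Sum>l<p. H (i, l) * (W l j - U l j))"
      unfolding sum.distrib[symmetric] by (simp add: right_diff_distrib)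
    moreover have "(x + y)\<^sup>2 \<le> 2 * x\<^sup>2 + 2 * y\<^sup>2" for x y :: real
      using zero_le_power2[of "x - y"] by (simp add: power2_eq_square algebra_simps)
    ultimately show "(\<Sum>l<p. H (i, l) * W l j)\<^sup>2 \<le>
        2 * (\<Sum>l<p. H (i, l) * U l j)\<^sup>2 + 2 * (\<Sum>l<p. H (i, l) * (W l j - U l j))\<^sup>2" by simp
  qed
  also have "\<dots> = 2 * (\<Sum>j<k. \<Sum>i<m. (\<Sum>l<p. H (i, l) * U l j)\<^sup>2) +
      2 * (\<Sum>i<m. \<Sum>j<k. (\<Sum>l<p. H (i, l) * (W l j - U l j))\<^sup>2)"
    unfolding sum.distrib sum_distrib_left[symmetric] by (subst sum.swap) (rule refl)
  also have "\<dots> \<le> 2 * (\<Sum>j<k. s\<^sup>2) + 2 * r" by (intro add_mono mult_left_mono sum_mono small res) auto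
  finally show ?thesis by simp
qed

text \<open>The rates at a = 1/64 and \<eta> = 1/256: the small ball factor gains 45/10^6 * 127/256,
  about 2.2/10^5, and the energy factor loses 1/512 * 1/128, about 1.5/10^5. The remaining 7/10^6
  leaves room for the rate 1/200000. The two factors 3 enter with total power 129/256, hence at most
  3.\<close>

lemma rate_combine:
  fixes k :: nat
  defines "B2 \<equiv> 3 * exp (8 * (1/64)\<^sup>2 * real k)"
    and "B3 \<equiv> 3 * (ball_rate (1/64) (1/524288) k)"
  shows "B3 powr ((1 - 2 * (1/256)) / 2) * B2 powr (2 * (1/256)) \<le> 3 * exp (- real k / 200000)"
proof -
  have "B3 = exp (ln 3 + real k * (8 * (1/64)\<^sup>2 * (1/524288) +
      (- (3/32) * (1 - 2 * (1/64)\<^sup>2) * (2 * (1/64)\<^sup>2 / (1 + 8 * (2 * (1/64)\<^sup>2))))))"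
    unfolding B3_def distrib_left exp_add by (simp add: mult_ac)
  also have "\<dots> \<le> exp (ln 3 + real k * (- 45 / 1000000))" by (simp add: power2_eq_square mult_left_mono)
  finally have B3: "B3 powr ((1 - 2 * (1/256)) / 2) \<le> exp (ln 3 + real k * (- 45 / 1000000)) powr ((1 - 2 * (1/256)) / 2)"
    by (intro powr_mono2) (auto simp: B3_def)
  have B2: "B2 = exp (ln 3 + real k * (1 / 512))" unfolding B2_def exp_add by (simp add: power2_eq_square)
  have "B3 powr ((1 - 2 * (1/256)) / 2) * B2 powr (2 * (1/256)) \<le>
      exp (ln 3 + real k * (- 45 / 1000000)) powr ((1 - 2 * (1/256)) / 2) * exp (ln 3 + real k * (1 / 512)) powr (2 * (1/256))"
    unfolding B2 by (intro mult_right_mono B3) auto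
  also have "\<dots> = exp (ln 3 * (129/256) + real k * (- 45 / 1000000 * (127/256) + 1/512 * (1/128)))"
    unfolding exp_powr_real exp_add[symmetric] by (simp add: algebra_simps)
  also have "\<dots> \<le> exp (ln 3 + real k * (- 1 / 200000))"
  proof -
    have "real k * (- 45 / 1000000 * (127/256) + 1/512 * (1/128)) \<le> real k * (- 1 / 200000)"
      by (intro mult_left_mono) auto
    moreover have "ln 3 * (129/256) \<le> ln (3::real)" using ln_ge_zero[of 3] by simp
    ultimately show ?thesis by (simp only: exp_le_cancel_iff add_mono)
  qed
  also have "\<dots> = 3 * exp (- real k / 200000)" unfolding exp_add by simp
  finally show ?thesis .
qed

definition net_energy_bound :: "nat \<Rightarrow> real" where
  "net_energy_bound k = 3 * exp (8 * (1/64)\<^sup>2 * real k)"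

definition net_ball_bound :: "nat \<Rightarrow> real" where
  "net_ball_bound k = 3 * (ball_rate (1/64) (1/524288) k)"

text \<open>With 2 d rows the product p e^2 is 1/524288, independent of d and small enough that the
  rounding cost in \<open>ball_rate\<close> is negligible.\<close>

definition mesh :: "nat \<Rightarrow> real" where
  "mesh d = 1 / (1024 * sqrt d)"

definition net_mat :: "nat \<Rightarrow> (nat \<times> nat \<Rightarrow> int) \<Rightarrow> nat \<Rightarrow> nat \<Rightarrow> real" where
  "net_mat d z = (\<lambda>l j. mesh d * of_int (z (l, j)))"

abbreviation net_box :: "nat \<Rightarrow> nat \<Rightarrow> (nat \<times> nat \<Rightarrow> int) set" where
  "net_box d k \<equiv> PiE ({..<2 * d} \<times> {..<k}) (\<lambda>_. {- int (nat \<lceil>2 / mesh d\<rceil>)..int (nat \<lceil>2 / mesh d\<rceil>)})"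

text \<open>The box gives finiteness. The Euclidean ball gives the size exp (O(d k)), whereas
  counting the box alone would bring a factor log d into the exponent. The other conditions are the
  inputs of \<open>row_fun_expect\<close>.\<close>

definition net :: "nat \<Rightarrow> nat \<Rightarrow> nat \<Rightarrow> (nat \<times> nat \<Rightarrow> int) set" where
  "net d k L = {z \<in> net_box d k.
     (\<Sum>i\<in>{..<2 * d} \<times> {..<k}. (real_of_int (z i))\<^sup>2) \<le> 4 * real k / (mesh d)\<^sup>2 \<and>
     (\<forall>l<2 * d. \<forall>j<k. \<bar>net_mat d z l j\<bar> \<le> 2) \<and>
     gauss_energy (2 * d) k L (1/64) d (net_mat d z) \<le> net_energy_bound k \<and>
     small_ball (2 * d) k (1/64) (net_mat d z) \<le> net_ball_bound k}"

lemma mesh_sq: "0 < d \<Longrightarrow> (mesh d)\<^sup>2 = 1 / (1048576 * d)"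
  by (simp add: mesh_def power_mult_distrib power_divide)

lemma finite_net: "finite (net d k L)"
  unfolding net_def by (rule finite_subset[of _ "net_box d k"])
    (auto intro: finite_PiE)

lemma card_net_le:
  assumes "0 < d"
  shows "card (net d k L) \<le> exp (30 * (real k * real d))"
proof -
  let ?I = "{..<2 * d} \<times> {..<k}"
  let ?N = "{z \<in> net_box d k.
     (\<Sum>i\<in>?I. (real_of_int (z i))\<^sup>2) \<le> 4 * real k / (mesh d)\<^sup>2}"
  have "finite ?N" by (rule finite_subset[of _ "net_box d k"])
      (auto intro: finite_PiE)
  then have "card (net d k L) \<le> card ?N" by (rule card_mono) (auto simp: net_def)
  then have "real (card (net d k L)) \<le> real (card ?N)" by simp
  \<comment> \<open>With x = 1/1024 the quotient x^2 / mesh^2 is d, so the ball costs 4 k d; each of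
    the 2 d k coordinates costs a factor 4100 \<le> exp 13.\<close>
  also have "\<dots> \<le> exp ((1/1024)\<^sup>2 * (4 * real k / (mesh d)\<^sup>2)) * (4 * (1 + 1 / (1/1024))) ^ card ?I"
    by (rule card_lattice_ball) auto
  also have "(1/1024)\<^sup>2 * (4 * real k / (mesh d)\<^sup>2) = 4 * (real k * real d)"
    using assms unfolding mesh_sq[OF assms] by (simp add: power2_eq_square)
  also have "(4 * (1 + 1 / (1/1024 :: real))) ^ card ?I \<le> exp 13 ^ card ?I"
  proof (rule power_mono)
    have "(2::real) ^ 13 \<le> exp 1 ^ 13" using exp_ge_add_one_self[of 1] by (intro power_mono) auto
    also have "\<dots> = exp 13" by (simp flip: exp_of_nat_mult)
    finally show "4 * (1 + 1 / (1/1024 :: real)) \<le> exp 13" by simp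
  qed simp
  also have "exp (13::real) ^ card ?I = exp (26 * (real k * real d))"
    by (simp flip: exp_of_nat_mult add: mult_ac)
  also have "exp (4 * (real k * real d)) * exp (26 * (real k * real d)) = exp (30 * (real k * real d))"
    by (simp flip: exp_add)
  finally show ?thesis by simp
qed

lemma net_cover:
  fixes H :: "nat \<times> nat \<Rightarrow> real"
  assumes "0 < d" "0 < m" "0 < L" and orth: "orthonormal (2 * d) k U"
    and H: "\<And>i l. i < m \<Longrightarrow> l < 2 * d \<Longrightarrow> \<bar>H (i, l)\<bar> \<le> 1"
    and small: "\<And>j. j < k \<Longrightarrow> (\<Sum>i<m. (\<Sum>l<2 * d. H (i, l) * U l j)\<^sup>2) \<le> s\<^sup>2"
  obtains z where "z \<in> net d k L"
    and "(\<Sum>i<m. wnorm (2 * d) k (net_mat d z) (\<lambda>l. H (i, l))) \<le> 2 * (k * s\<^sup>2) + 6 * (m * (real k + 1)) / 524288"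
proof -
  let ?e = "mesh d"
  have e0: "0 < ?e" using assms by (simp add: mesh_def)
  note e2 = mesh_sq[OF assms(1)]
  have pe: "real (2 * d) * ?e\<^sup>2 = 1/524288" using assms unfolding e2 by simp
  have e1: "?e \<le> 1"
  proof -
    have "1 \<le> sqrt d" using assms by simp
    then have "1 \<le> 1024 * sqrt d" by linarith
    moreover have "1 / x \<le> 1" if "1 \<le> x" for x :: real using that by simp
    ultimately show ?thesis unfolding mesh_def by blast
  qed
  have h1: "6 * (real (2 * d) * ?e\<^sup>2) \<le> 1" unfolding pe by simp
  have "27 * (?e\<^sup>2 * real d) = 27/2 * (real (2 * d) * ?e\<^sup>2)" by simp
  also have "\<dots> \<le> 1" unfolding pe by simp
  finally have h2: "27 * (?e\<^sup>2 * real d) \<le> 1" .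
  have h3: "96 * (1/64)\<^sup>2 \<le> (1::real)" by (simp add: power2_eq_square)
  obtain z where z: "z \<in> PiE ({..<2 * d} \<times> {..<k}) (round_set ?e U)"
    and res: "(\<Sum>i<m. \<Sum>j<k. (\<Sum>l<2 * d. H (i, l) * (?e * of_int (z (l, j)) - U l j))\<^sup>2) \<le>
       3 * (real m * (real k + 1) * real (2 * d) * ?e\<^sup>2)"
    and ge: "gauss_energy (2 * d) k L (1/64) d (lattice_mat ?e z) \<le> 3 * exp (8 * (1/64)\<^sup>2 * k)"
    and sb: "small_ball (2 * d) k (1/64) (lattice_mat ?e z) \<le>
       3 * (ball_rate (1/64) (real (2 * d) * ?e\<^sup>2) k)"
    by (rule good_rounding[where D = "real d" and a = "1/64" and H = H and L = L and m = m and p = "2 * d"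
          and k = k and U = U and e = ?e, OF orth e0 h1 h2 _ h3 _ assms(3) assms(2) _ H])
      (use assms in auto)
  have bound: "\<bar>?e * of_int (z (l, j))\<bar> \<le> 2" if "l < 2 * d" "j < k" for l j
    by (rule rounding_bounded[OF orth e0 e1 z that])
  have "z \<in> net_box d k"
  proof (rule PiE_I)
    fix i assume "i \<in> {..<2 * d} \<times> {..<k}"
    then obtain l j where i: "i = (l, j)" "l < 2 * d" "j < k" by auto
    have "\<bar>real_of_int (z i)\<bar> \<le> 2 / ?e" using bound[OF i(2,3)] e0 by (simp add: i abs_mult field_simps)
    also have "\<dots> \<le> real (nat \<lceil>2 / ?e\<rceil>)" by (rule real_nat_ceiling_ge)
    finally have "real_of_int \<bar>z i\<bar> \<le> real_of_int (int (nat \<lceil>2 / ?e\<rceil>))"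
      by (simp only: of_int_abs of_int_of_nat_eq)
    then have "\<bar>z i\<bar> \<le> int (nat \<lceil>2 / ?e\<rceil>)" by (simp only: of_int_le_iff)
    then show "z i \<in> {- int (nat \<lceil>2 / ?e\<rceil>)..int (nat \<lceil>2 / ?e\<rceil>)}" by auto
  next
    fix i assume "i \<notin> {..<2 * d} \<times> {..<k}"
    then show "z i = undefined" by (rule PiE_arb[OF z])
  qed
  moreover have "(\<Sum>i\<in>{..<2 * d} \<times> {..<k}. (real_of_int (z i))\<^sup>2) \<le> 4 * real k / ?e\<^sup>2"
  proof (rule rounding_norm[OF orth e0 _ z])
    show "real (2 * d) * ?e\<^sup>2 \<le> 1" unfolding pe by simp
  qed
  moreover have "gauss_energy (2 * d) k L (1/64) d (net_mat d z) \<le> net_energy_bound k"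
    using ge unfolding net_mat_def net_energy_bound_def .
  moreover have "small_ball (2 * d) k (1/64) (net_mat d z) \<le> net_ball_bound k"
    using sb unfolding net_mat_def net_ball_bound_def pe .
  moreover have "\<forall>l<2 * d. \<forall>j<k. \<bar>net_mat d z l j\<bar> \<le> 2" using bound unfolding net_mat_def by blast
  ultimately have "z \<in> net d k L" unfolding net_def mem_Collect_eq by (intro conjI)
  moreover have "(\<Sum>i<m. wnorm (2 * d) k (net_mat d z) (\<lambda>l. H (i, l))) \<le>
      2 * (k * s\<^sup>2) + 6 * (m * (real k + 1)) / 524288"
  proof -
    have "2 * (3 * (real m * (real k + 1) * real (2 * d) * ?e\<^sup>2)) = 6 * (m * (real k + 1)) * (real (2 * d) * ?e\<^sup>2)"
      by simp
    also have "\<dots> = 6 * (m * (real k + 1)) / 524288" unfolding pe by simp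
    finally show ?thesis using residual_split[OF small res] unfolding net_mat_def by (simp only:)
  qed
  ultimately show ?thesis by (rule that)
qed

lemma net_row_expect:
  fixes G :: real
  assumes D: "D_alpha d \<alpha> v > 16" and "0 \<le> \<alpha>" "\<alpha> \<le> 1" "0 < d" "0 < P" and L: "L = 16 * (2 * d)\<^sup>2"
    and z: "z \<in> net d k L" and "0 < vnorm d v"
    and G: "4 / P + 8 / (vnorm d v * sqrt (3/8 * (1/256))) + exp (- (3/8 * (1/256)) * (\<alpha> * d)) \<le> G"
  shows "lexpect (1/4) {..<2 * d} (row_fun d k L (1/64) P v (net_mat d z)) \<le> 3 * exp (- real k / 200000) * G\<^sup>2"
proof -
  have "lexpect (1/4) {..<2 * d} (row_fun d k L (1/64) P v (net_mat d z)) \<le>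
    net_ball_bound k powr ((1 - 2 * (1/256)) / 2) * net_energy_bound k powr (2 * (1/256)) * G\<^sup>2"
    by (rule row_fun_expect[OF D _ _ _ _ _ _ _ _ _ _ L]) (use assms in \<open>auto simp: net_def net_ball_bound_def net_energy_bound_def\<close>)
  also have "\<dots> \<le> 3 * exp (- real k / 200000) * G\<^sup>2"
    unfolding net_ball_bound_def net_energy_bound_def by (intro mult_right_mono rate_combine) simp
  finally show ?thesis .
qed

lemma row_product_lower:
  assumes "0 < L" "2 \<le> P"
    and Q: "(\<Sum>i<m. wnorm (2 * d) k W (\<lambda>l. H (i, l))) \<le> Q"
    and T: "(\<Sum>i<m. (\<Sum>l<d. H (i, l) * v l)\<^sup>2) \<le> T" "(\<Sum>i<m. (\<Sum>l<d. H (i, d + l) * v l)\<^sup>2) \<le> T"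
  shows "1 \<le> 16 ^ m * exp (16 * a\<^sup>2 * Q + 128 * T) * (\<Prod>i<m. row_fun d k L a P v W (\<lambda>l. H (i, l)))"
proof -
  define e where "e i = - 16 * a\<^sup>2 * wnorm (2 * d) k W (\<lambda>l. H (i, l))
      - 64 * ((\<Sum>l<d. H (i, l) * v l)\<^sup>2 + (\<Sum>l<d. H (i, d + l) * v l)\<^sup>2)" for i
  have "(\<Sum>i<m. e i) = (- 16 * a\<^sup>2) * (\<Sum>i<m. wnorm (2 * d) k W (\<lambda>l. H (i, l)))
      - 64 * ((\<Sum>i<m. (\<Sum>l<d. H (i, l) * v l)\<^sup>2) + (\<Sum>i<m. (\<Sum>l<d. H (i, d + l) * v l)\<^sup>2))"
    by (simp only: e_def sum_subtractf sum.distrib sum_distrib_left[symmetric])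
  moreover have "16 * a\<^sup>2 * (\<Sum>i<m. wnorm (2 * d) k W (\<lambda>l. H (i, l))) \<le> 16 * a\<^sup>2 * Q"
    by (rule mult_left_mono[OF Q]) simp
  moreover have "0 \<le> 16 * a\<^sup>2 * Q + 128 * T + S"
    if "S = (- 16 * a\<^sup>2) * x - 64 * (y + y')" "16 * a\<^sup>2 * x \<le> 16 * a\<^sup>2 * Q" "y \<le> T" "y' \<le> T" for S x y y'
    using that by simp
  ultimately have e: "0 \<le> 16 * a\<^sup>2 * Q + 128 * T + (\<Sum>i<m. e i)" using T by blast
  have "(\<Prod>i<m. exp (e i) / 16) \<le> (\<Prod>i<m. row_fun d k L a P v W (\<lambda>l. H (i, l)))"
    unfolding e_def by (intro prod_mono conjI row_fun_lower assms) auto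
  then have "16 ^ m * exp (16 * a\<^sup>2 * Q + 128 * T) * (\<Prod>i<m. exp (e i) / 16) \<le>
      16 ^ m * exp (16 * a\<^sup>2 * Q + 128 * T) * (\<Prod>i<m. row_fun d k L a P v W (\<lambda>l. H (i, l)))"
    by (rule mult_left_mono) simp
  moreover have "16 ^ m * exp (16 * a\<^sup>2 * Q + 128 * T) * (\<Prod>i<m. exp (e i) / 16) =
      exp (16 * a\<^sup>2 * Q + 128 * T + (\<Sum>i<m. e i))" by (simp add: prod_dividef exp_add exp_sum)
  moreover have "1 \<le> exp (16 * a\<^sup>2 * Q + 128 * T + (\<Sum>i<m. e i))" using e by simp
  ultimately show ?thesis by linarith
qed

section \<open>Assembly and choice of constants\<close>

lemma vnorm_scale: "vnorm d (\<lambda>i. r * x i) = \<bar>r\<bar> * vnorm d x"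
  by (simp add: vnorm_def power_mult_distrib real_sqrt_mult flip: sum_distrib_left)

lemma sum_squares_vnorm: "(\<Sum>i<m. (f i)\<^sup>2) = (vnorm m f)\<^sup>2"
  by (simp add: vnorm_def sum_nonneg)

theorem theorem5p1:
  fixes n d k :: nat and c\<^sub>0 \<alpha> N :: real and X :: "nat \<Rightarrow> real"
  assumes "0 < c\<^sub>0" and "c\<^sub>0 \<le> 2 powr (-24)"
    and "0 < d" and "real d \<le> c\<^sub>0\<^sup>2 * real n"
    and "0 < \<alpha>" and "\<alpha> < 1"
    and "real k \<le> 2 powr (-10) * \<alpha> * real d"
    and "0 < N" and "N \<le> exp (2 powr (-10) * \<alpha> * real d)"
    and "vnorm d X \<ge> c\<^sub>0 * 2 powr (-10) * sqrt (real n) * N"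
    and "D_alpha d \<alpha> (\<lambda>i. (c\<^sub>0 / (16 * sqrt (real n))) * X i) > 16"
  shows "measure_pmf.prob (rand_mat (n - d) (2 * d))
           {H. sing_val (mat_of_fun (n - d) (2 * d) H) (2 * d - k + 1) \<le> c\<^sub>0 * 2 powr (-4) * sqrt (real n)
               \<and> vnorm (n - d) (\<lambda>i. \<Sum>j<d. H (i, j) * X j) \<le> real n
               \<and> vnorm (n - d) (\<lambda>i. \<Sum>j<d. H (i, d + j) * X j) \<le> real n}
         \<le> exp (- c\<^sub>0 * real n * real k / 4) * ((2 powr 39 * c\<^sub>0 powr (-3)) / N) ^ (2 * n - 2 * d)"
    (is "measure_pmf.prob _ ?E \<le> _")
proof -
  note c0 = assms(1) and d0 = assms(3) and N0 = assms(8) and D = assms(11)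
  have pw: "2 powr (-24) = (1/16777216::real)" "2 powr (-10) = (1/1024::real)" "2 powr (-4) = (1/16::real)"
    "2 powr 39 = (549755813888::real)" by (simp_all add: powr_minus_divide)
  have c1: "c\<^sub>0 \<le> 1/16777216" using assms(2) pw by simp
  have c2: "c\<^sub>0\<^sup>2 \<le> 1/281474976710656" using power_mono[OF c1, of 2] c0 by (simp add: power_divide)
  have n0: "0 < real n" using assms(3,4) by (cases "n = 0") auto
  have c2n: "c\<^sub>0\<^sup>2 * n \<le> n / 281474976710656" using mult_right_mono[OF c2, of n] by simp
  have dn: "real d \<le> n / 281474976710656" using assms(4) c2n by linarith
  define m where "m = n - d"
  have "real d \<le> real n" using dn n0 by linarith
  then have m: "real m = real n - real d" by (simp add: m_def of_nat_diff)
  have mn: "real n \<le> 2 * real m" "real m \<le> real n" using m dn n0 by linarith+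
  have m0: "0 < m" using mn(1) n0 by (cases "m = 0") auto
  have k2d: "k \<le> 2 * d"
  proof -
    have "real k \<le> 1/1024 * 1 * real d"
      using order_trans[OF assms(7)[unfolded pw] mult_right_mono[of "1/1024 * \<alpha>" "1/1024 * 1" "real d"]] assms(6) by simp
    then have "real k \<le> real (2 * d)" by simp
    then show ?thesis by (simp only: of_nat_le_iff)
  qed
  define r where "r = c\<^sub>0 / (16 * sqrt n)"
  define v where "v i = r * X i" for i
  have r0: "0 < r" using c0 n0 by (simp add: r_def)
  have r2: "r\<^sup>2 = c\<^sub>0\<^sup>2 / (256 * n)" using n0 by (simp add: r_def power_divide power_mult_distrib)
  have Dv: "D_alpha d \<alpha> v > 16" using D unfolding v_def r_def .
  have \<nu>: "c\<^sub>0\<^sup>2 * N / 16384 \<le> vnorm d v"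
  proof -
    have "r * (c\<^sub>0 * (1/1024) * sqrt n * N) \<le> r * vnorm d X"
      using assms(10) r0 unfolding pw by (intro mult_left_mono) auto
    moreover have "r * (c\<^sub>0 * (1/1024) * sqrt n * N) = c\<^sub>0\<^sup>2 * N / 16384"
    proof -
      have "r * (c\<^sub>0 * (1/1024) * sqrt n * N) = (r * sqrt n) * (c\<^sub>0 * (1/1024) * N)" by simp
      also have "r * sqrt n = c\<^sub>0 / 16" using n0 by (simp add: r_def)
      finally show ?thesis by (simp add: power2_eq_square)
    qed
    ultimately have "c\<^sub>0\<^sup>2 * N / 16384 \<le> r * vnorm d X" by linarith
    then show ?thesis unfolding v_def vnorm_scale using r0 by simp
  qed
  have cN: "0 < c\<^sub>0\<^sup>2 * N" using c0 N0 by simp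
  have \<nu>0: "0 < vnorm d v" using \<nu> cN by linarith
  \<comment> \<open>N \<le> P makes the discretisation term 4 / P harmless, and
    \<open>fejer_lower\<close> requires 2 \<le> P.\<close>
  define P where "P = nat \<lceil>N\<rceil> + 2"
  have P: "2 \<le> P" "N \<le> P" unfolding P_def using real_nat_ceiling_ge[of N] by linarith+
  define L where "L = 16 * (2 * d)\<^sup>2"
  have L0: "0 < L" using d0 by (simp add: L_def)
  \<comment> \<open>The Gaussian term contributes 2^22 / (c_0^2 N); doubling it covers the two terms
    of order 1 / N.\<close>
  define G where "G = 8388608 / (c\<^sub>0\<^sup>2 * N)"
  have G: "4 / P + 8 / (vnorm d v * sqrt (3/8 * (1/256))) + exp (- (3/8 * (1/256)) * (\<alpha> * d)) \<le> G"
  proof -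
    have 1: "4 / P \<le> 4 / N" using P N0 by (intro divide_left_mono) auto
    have 2: "8 / (vnorm d v * sqrt (3/8 * (1/256))) \<le> 8 / (c\<^sub>0\<^sup>2 * N / 16384 * (1/32))"
    proof (intro divide_left_mono mult_mono \<nu> mult_pos_pos)
      show "1/32 \<le> sqrt (3/8 * (1/256))" by (rule real_le_rsqrt) (simp add: power2_eq_square)
    qed (use \<nu>0 c0 N0 in auto)
    have 3: "exp (- (3/8 * (1/256)) * (\<alpha> * d)) \<le> 1 / N"
    proof -
      \<comment> \<open>Here \<eta> meets the hypothesis on N: 3/8 * 1/256 = 3/2048 exceeds
        2^-10.\<close>
      have "N \<le> exp (3/8 * (1/256) * (\<alpha> * d))"
        using assms(9) unfolding pw by (rule order_trans) (use assms(5) in simp)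
      then have "1 / exp (3/8 * (1/256) * (\<alpha> * d)) \<le> 1 / N" using N0 by (intro divide_left_mono) auto
      then show ?thesis by (simp add: exp_minus inverse_eq_divide)
    qed
    have "4 / P + 8 / (vnorm d v * sqrt (3/8 * (1/256))) + exp (- (3/8 * (1/256)) * (\<alpha> * d)) \<le>
        4 / N + 8 / (c\<^sub>0\<^sup>2 * N / 16384 * (1/32)) + 1 / N" by (intro add_mono 1 2 3)
    also have "\<dots> = 5 / N + 4194304 / (c\<^sub>0\<^sup>2 * N)" by simp
    also have "\<dots> \<le> 5 / (c\<^sub>0\<^sup>2 * N) + 4194304 / (c\<^sub>0\<^sup>2 * N)"
      using c2 N0 cN mult_right_mono[of "c\<^sub>0\<^sup>2" 1 N] by (intro add_right_mono divide_left_mono) auto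
    also have "\<dots> = 4194309 / (c\<^sub>0\<^sup>2 * N)" by (simp flip: add_divide_distrib)
    also have "\<dots> \<le> G" unfolding G_def using cN by (intro divide_right_mono) auto
    finally show ?thesis .
  qed
  define B where "B = 3 * exp (- real k / 200000) * G\<^sup>2"
  define Q where "Q = 2 * (k * (c\<^sub>0 * (1/16) * sqrt n)\<^sup>2) + 6 * (m * (real k + 1)) / 524288"
  define T where "T = c\<^sub>0\<^sup>2 * n / 256"
  define C where "C = 16 ^ m * exp (16 * (1/64)\<^sup>2 * Q + 128 * T)"
  have "measure_pmf.prob (rand_mat m (2 * d)) ?E \<le> card (net d k L) * (C * B ^ m)"
  proof (rule rand_mat_union_bound[where W = "net_mat d" and k = k and L = L and P = P and v = v and a = "1/64"])
    show "finite (net d k L)" by (rule finite_net)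
    show "0 \<le> C" by (simp add: C_def)
    show "lexpect (1/4) {..<2 * d} (row_fun d k L (1/64) P v (net_mat d z)) \<le> B" if "z \<in> net d k L" for z
      unfolding B_def by (rule net_row_expect[OF Dv _ _ d0 _ L_def that \<nu>0 G]) (use assms P in auto)
    fix H :: "nat \<times> nat \<Rightarrow> real"
    assume H: "\<And>i. i \<in> {..<m} \<times> {..<2 * d} \<Longrightarrow> H i \<in> {-1, 0, 1}" and E: "H \<in> ?E"
    have H1: "\<bar>H (i, l)\<bar> \<le> 1" if "i < m" "l < 2 * d" for i l using H[of "(i, l)"] that by auto
    have "\<exists>U. orthonormal (2 * d) k U \<and> (\<forall>j<k. (\<Sum>i<m. (\<Sum>l<2 * d. H (i, l) * U l j)\<^sup>2) \<le> (c\<^sub>0 * (1/16) * sqrt n)\<^sup>2)"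
    \<comment> \<open>For k = 0 the singular value in the event carries an index beyond the list;
      the empty family is then a valid U.\<close>
    proof (cases "k = 0")
      case True
      then show ?thesis by (simp add: orthonormal_def)
    next
      case False
      then show ?thesis using small_sing_val_orthonormal[of k "2 * d" "c\<^sub>0 * (1/16) * sqrt n" m H] E k2d c0
        unfolding orthonormal_def pw m_def by simp
    qed
    then obtain U where U: "orthonormal (2 * d) k U"
      "\<And>j. j < k \<Longrightarrow> (\<Sum>i<m. (\<Sum>l<2 * d. H (i, l) * U l j)\<^sup>2) \<le> (c\<^sub>0 * (1/16) * sqrt n)\<^sup>2" by auto
    obtain z where z: "z \<in> net d k L" "(\<Sum>i<m. wnorm (2 * d) k (net_mat d z) (\<lambda>l. H (i, l))) \<le> Q"
      unfolding Q_def by (rule net_cover[OF d0 m0 L0 U(1) H1 U(2)])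
    have T: "(\<Sum>i<m. (\<Sum>l<d. f i l * v l)\<^sup>2) \<le> T" if "vnorm m (\<lambda>i. \<Sum>l<d. f i l * X l) \<le> n" for f
    proof -
      have "(\<Sum>l<d. f i l * v l) = r * (\<Sum>l<d. f i l * X l)" for i by (simp add: v_def sum_distrib_left mult_ac)
      then have "(\<Sum>i<m. (\<Sum>l<d. f i l * v l)\<^sup>2) = r\<^sup>2 * (vnorm m (\<lambda>i. \<Sum>l<d. f i l * X l))\<^sup>2"
        unfolding sum_squares_vnorm by (simp add: vnorm_scale power_mult_distrib)
      also have "\<dots> \<le> r\<^sup>2 * (real n)\<^sup>2"
        using that by (intro mult_left_mono power_mono) (auto simp: vnorm_def sum_nonneg)
      also have "\<dots> = T" unfolding r2 T_def using n0 by (simp add: power2_eq_square)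
      finally show ?thesis .
    qed
    have "1 \<le> C * (\<Prod>i<m. row_fun d k L (1/64) P v (net_mat d z) (\<lambda>l. H (i, l)))"
      unfolding C_def by (rule row_product_lower[OF L0 P(1) z(2)]) (use T E in \<open>simp_all add: m_def\<close>)
    then show "\<exists>z\<in>net d k L. 1 \<le> C * (\<Prod>i<m. row_fun d k L (1/64) P v (net_mat d z) (\<lambda>l. H (i, l)))"
      using z(1) by blast
  qed
  also have "\<dots> \<le> exp (30 * (real k * real d)) * (C * B ^ m)"
    by (intro mult_right_mono card_net_le d0) (simp add: C_def B_def)
  also have "\<dots> = exp (30 * (real k * real d) + (16 * (1/64)\<^sup>2 * Q + 128 * T) - real m * (real k / 200000)) * (48 * G\<^sup>2) ^ m"
  proof -
    have "B = exp (- (real k / 200000)) * (3 * G\<^sup>2)" by (simp add: B_def)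
    then have "B ^ m = exp (- (real k / 200000)) ^ m * (3 * G\<^sup>2) ^ m" by (simp only: power_mult_distrib)
    also have "exp (- (real k / 200000)) ^ m = exp (- (real m * (real k / 200000)))"
      unfolding exp_of_nat_mult[symmetric] by simp
    finally have "B ^ m = exp (- (real m * (real k / 200000))) * (3 * G\<^sup>2) ^ m" .
    moreover have "16 ^ m * (3 * G\<^sup>2) ^ m = (48 * G\<^sup>2) ^ m" unfolding power_mult_distrib[symmetric] by simp
    moreover have "exp x * (s * exp y * (exp (- w) * t)) = exp (x + y - w) * (s * t)" for x y w s t :: real
      by (simp only: diff_conv_add_uminus exp_add mult_ac)
    ultimately show ?thesis unfolding C_def by (simp only:)
  qed
  also have "\<dots> \<le> exp (- c\<^sub>0 * n * k / 4 + m) * (48 * G\<^sup>2) ^ m"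
  \<comment> \<open>The gain k m / 200000, with m \<ge> n / 2, pays for the net, for the k-dependent
    part of Q and for c_0 n k / 4, because d / n and c_0 are tiny. The parts without k, from k + 1
    in Q and from T, are at most m; they leave as a factor e per row.\<close>
  proof (intro mult_right_mono)
    define kn where "kn = real k * real n"
    define km where "km = real k * real m"
    have 0: "0 \<le> kn" "0 \<le> km" by (simp_all add: kn_def km_def)
    have 1: "real k * real d \<le> kn / 281474976710656" using mult_left_mono[OF dn, of k] by (simp add: kn_def)
    have 2: "k * (c\<^sub>0\<^sup>2 * n) \<le> kn / 281474976710656" using mult_left_mono[OF c2n, of k] by (simp add: kn_def)
    have 3: "c\<^sub>0 * kn \<le> kn / 16777216" using mult_right_mono[OF c1 0(1)] by simp
    have 4: "kn \<le> 2 * km" using mult_left_mono[OF mn(1), of k] by (simp_all add: kn_def km_def)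
    have 5: "16 * (1/64)\<^sup>2 * Q = k * (c\<^sub>0\<^sup>2 * n) / 32768 + 6 * (km + m) / 134217728"
      unfolding Q_def km_def by (simp add: power_mult_distrib power_divide field_simps)
    have 6: "real m * (real k / 200000) = km / 200000" "- c\<^sub>0 * n * k / 4 = - (c\<^sub>0 * kn) / 4"
      by (simp_all add: km_def kn_def)
    have lin: "30 * x + (y / 32768 + 6 * (km + m') / 134217728 + 128 * (u / 256)) - km / 200000 \<le> - w / 4 + m'"
      if "x \<le> kn / 281474976710656" "y \<le> kn / 281474976710656" "w \<le> kn / 16777216" "kn \<le> 2 * km"
        "u \<le> n' / 281474976710656" "n' \<le> 2 * m'" "0 \<le> km" "0 \<le> m'" for x y u w n' m' kn km :: real
      using that by (simp add: field_simps)
    show "exp (30 * (real k * real d) + (16 * (1/64)\<^sup>2 * Q + 128 * T) - real m * (real k / 200000)) \<le> exp (- c\<^sub>0 * n * k / 4 + m)"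
      unfolding exp_le_cancel_iff 5 6 T_def by (rule lin[OF 1 2 3 4 c2n mn(1) 0(2)]) simp
  qed (simp add: zero_le_mult_iff)
  also have "\<dots> = exp (- c\<^sub>0 * n * k / 4) * (exp 1 * (48 * G\<^sup>2)) ^ m"
  proof -
    have "exp (real m) = exp 1 ^ m" using exp_of_nat_mult[of m "1::real"] by simp
    then show ?thesis by (simp only: exp_add power_mult_distrib mult.assoc)
  qed
  also have "\<dots> \<le> exp (- c\<^sub>0 * n * k / 4) * (((2 powr 39 * c\<^sub>0 powr (-3)) / N)\<^sup>2) ^ m"
  proof (intro mult_left_mono power_mono)
    \<comment> \<open>The base per row is 48 e G^2, where 48 is 16 from the minorant times 3 from
      the row expectation; it is of order c_0^-4 / N^2. As 144 * 2^46 c_0^2 is below 2^78, it fits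
      under the square of R / N.\<close>
    have "exp 1 * (48 * G\<^sup>2) \<le> 3 * (48 * G\<^sup>2)" using exp_le by (intro mult_right_mono) auto
    also have "\<dots> = 144 * 70368744177664 * c\<^sub>0\<^sup>2 / (c\<^sub>0 ^ 6 * N\<^sup>2)"
      using c0 N0 by (simp add: G_def power_divide power_mult_distrib field_simps)
    also have "\<dots> \<le> 549755813888\<^sup>2 / (c\<^sub>0 ^ 6 * N\<^sup>2)" using c2 c0 N0 by (intro divide_right_mono) auto
    also have "\<dots> = ((2 powr 39 * c\<^sub>0 powr (-3)) / N)\<^sup>2"
      using c0 N0 unfolding pw by (simp add: powr_minus_divide power_divide power_mult_distrib)
    finally show "exp 1 * (48 * G\<^sup>2) \<le> ((2 powr 39 * c\<^sub>0 powr (-3)) / N)\<^sup>2" .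
  qed auto
  also have "(((2 powr 39 * c\<^sub>0 powr (-3)) / N)\<^sup>2) ^ m = ((2 powr 39 * c\<^sub>0 powr (-3)) / N) ^ (2 * n - 2 * d)"
    unfolding power_mult[symmetric] m_def by (simp add: diff_mult_distrib2)
  finally show ?thesis unfolding m_def .
qed

end
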